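(* Let $\alpha_1,\alpha_2,\alpha_3\in\overline{\mathbb{Q}}^*$ be fixed and put $\xi:=\max_{1\le i<j\le 3}h(\alpha_i/\alpha_j)$; assume $\xi>0$. Let $\theta\ge 0$ be fixed. Consider all sequences of the form $a_n=c_1\alpha_1^n+c_2\alpha_2^n+c_3\alpha_3^n$ $(n\in\mathbb{N}_0)$ with coefficients $c_1,c_2,c_3\in\overline{\mathbb{Q}}^*$ satisfying $\max_{1\le i<j\le 3}h(c_i/c_j)\le\theta$. Then at most $24$ inequivalent such sequences possess a zero (i.e. an index $n$ with $a_n=0$) with $$n\ge\frac{2.8+6\theta}{\xi},$$ while at most $5$ inequivalent such sequences possess a zero with $$n\ge\frac{33.1+73.1\,\theta}{\xi}.$$ That is, any collection of pairwise inequivalent such sequences, each of which possesses a zero in the first (respectively second) range, has at most $24$ (respectively $5$) members.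
   Context: $\mathbb{N}_0$ is the set of non-negative integers and $h:\overline{\mathbb{Q}}^*\to\mathbb{R}_{\ge0}$ is the absolute logarithmic Weil height. Each sequence is understood to be given together with its coefficient vector $(c_1,c_2,c_3)$ with respect to the fixed $(\alpha_1,\alpha_2,\alpha_3)$. Two sequences, with coefficient vectors $(c_1,c_2,c_3)$ and $(c_1',c_2',c_3')$, are called equivalent if one is obtained from the other by translating the index and rescaling by a non-zero constant, i.e. if there exist $k\in\mathbb{Z}$ and $\lambda\in\overline{\mathbb{Q}}^*$ such that $c_i=\lambda\alpha_i^kc_i'$ for $i=1,2,3$. *)

theory Defs
  imports "HOL-Analysis.Analysis" "HOL-Computational_Algebra.Polynomial_Factorial"
begin

text \<open>
  The field of algebraic numbers is the set of complex \<open>z\<close> with \<^term>\<open>algebraic z\<close>.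

  The minimal polynomial over the integers. Irreducibility in the ring of integer polynomials
  includes primitivity; lemma \<open>ex1_min_int_poly\<close> shows that the description is proper for
  algebraic numbers.
\<close>

definition min_int_poly :: "complex \<Rightarrow> int poly" where
  "min_int_poly x =
     (THE p. irreducible p \<and> lead_coeff p > 0 \<and> poly (map_poly of_int p) x = 0)"

text \<open>
  The absolute logarithmic Weil height \<open>h(x) = (log |a\<^sub>0| + \<Sum>\<^sub>i log max(1, |x\<^sub>i|)) / d\<close>, where
  \<open>a\<^sub>0 \<Prod>\<^sub>i (X - x\<^sub>i)\<close> is the minimal polynomial of \<open>x\<close> over the integers and \<open>d\<close> its degree.
\<close>

definition weil_height :: "complex \<Rightarrow> real" where
  "weil_height x =
     (let p = min_int_poly x in
       (ln (real_of_int \<bar>lead_coeff p\<bar>)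
         + (\<Sum>z\<in>#proots (map_poly complex_of_int p). ln (max 1 (cmod z)))) / real (degree p))"

text \<open>The index type \<^typ>\<open>3\<close> has the elements \<open>1\<close>, \<open>2\<close> and \<open>3 = 0\<close>.\<close>

definition nonzero_algebraic_vectors :: "(complex ^ 3) set" where
  "nonzero_algebraic_vectors = {x. \<forall>i. algebraic (x $ i) \<and> x $ i \<noteq> 0}"

definition max_ratio_height :: "complex ^ 3 \<Rightarrow> real" where
  "max_ratio_height x =
     Max {weil_height (x $ 1 / x $ 2), weil_height (x $ 1 / x $ 3), weil_height (x $ 2 / x $ 3)}"

definition exp_sum_seq :: "complex ^ 3 \<Rightarrow> complex ^ 3 \<Rightarrow> nat \<Rightarrow> complex" where
  "exp_sum_seq \<alpha> c n = (\<Sum>i\<in>UNIV. c $ i * \<alpha> $ i ^ n)"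

definition equivalent_coeffs :: "complex ^ 3 \<Rightarrow> complex ^ 3 \<Rightarrow> complex ^ 3 \<Rightarrow> bool" where
  "equivalent_coeffs \<alpha> c c' \<longleftrightarrow>
     (\<exists>k::int. \<exists>\<mu>::complex. algebraic \<mu> \<and> \<mu> \<noteq> 0 \<and> (\<forall>i. c $ i = \<mu> * (\<alpha> $ i) powi k * c' $ i))"



lemma poly_of_int_add:
  "poly (map_poly of_int (p + q)) (x :: complex) =
     poly (map_poly of_int p) x + poly (map_poly of_int q) x"
proof -
  have "map_poly of_int (p + q) = (map_poly of_int p + map_poly of_int q :: complex poly)"
    by (rule poly_eqI) (simp add: coeff_map_poly)
  thus ?thesis by simp
qed

lemma poly_of_int_smult:
  "poly (map_poly of_int (smult c q)) (x :: complex) = of_int c * poly (map_poly of_int q) x"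
proof -
  have "map_poly of_int (smult c q) = (smult (of_int c) (map_poly of_int q) :: complex poly)"
    by (rule poly_eqI) (simp add: coeff_map_poly)
  thus ?thesis by simp
qed

lemma poly_of_int_mult:
  "poly (map_poly of_int (p * q)) (x :: complex) =
     poly (map_poly of_int p) x * poly (map_poly of_int q) x"
  by (induction p)
     (simp_all add: map_poly_pCons poly_of_int_add poly_of_int_smult algebra_simps)

lemma ex_prime_factor_root:
  fixes p :: "int poly" and x :: complex
  assumes "p \<noteq> 0" "poly (map_poly of_int p) x = 0"
  shows   "\<exists>q. prime q \<and> q dvd p \<and> poly (map_poly of_int q) x = 0"
  using assms
proof (induction p rule: prime_divisors_induct)
  case zero
  thus ?case by simp
next
  case (unit p)
  then obtain c where "p = [:c:]" "c \<noteq> 0"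
    by (auto simp: is_unit_poly_iff)
  thus ?case using unit by (simp add: map_poly_pCons)
next
  case (factor q p)
  show ?case
  proof (cases "poly (map_poly of_int q) x = 0")
    case True
    with factor show ?thesis by auto
  next
    case False
    with factor.prems have "p \<noteq> 0" "poly (map_poly of_int p) x = 0"
      by (auto simp: poly_of_int_mult)
    with factor.IH show ?thesis by (auto intro: dvd_mult)
  qed
qed

lemma normalize_int_poly_eq_iff:
  fixes p :: "int poly"
  assumes "p \<noteq> 0"
  shows "normalize p = p \<longleftrightarrow> lead_coeff p > 0"
proof
  assume "normalize p = p"
  moreover have "lead_coeff (normalize p) = \<bar>lead_coeff p\<bar>"
    by (simp add: normalize_poly_eq_map_poly coeff_map_poly degree_map_poly sgn_if)
  ultimately have "lead_coeff p = \<bar>lead_coeff p\<bar>"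
    by simp
  with assms show "lead_coeff p > 0"
    using leading_coeff_0_iff[of p] by linarith
next
  assume "lead_coeff p > 0"
  thus "normalize p = p"
    by (simp add: normalize_poly_eq_map_poly sgn_if)
qed

lemma ex1_min_int_poly:
  fixes x :: complex
  assumes "algebraic x"
  shows "\<exists>!p. irreducible p \<and> lead_coeff p > 0 \<and> poly (map_poly of_int p) x = 0"
proof -
  let ?P = "\<lambda>p :: int poly. p \<noteq> 0 \<and> poly (map_poly of_int p) x = 0"
  obtain f where f: "\<forall>i. coeff f i \<in> \<int>" "f \<noteq> 0" "poly f x = 0"
    using assms by (auto simp: algebraic_def)
  define g :: "int poly" where "g = map_poly (\<lambda>z. \<lfloor>Re z\<rfloor>) f"
  have "map_poly of_int g = f"
  proof (rule poly_eqI)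
    fix n
    obtain k where "coeff f n = of_int k"
      using f(1) by (meson Ints_cases)
    thus "coeff (map_poly of_int g) n = coeff f n"
      by (simp add: g_def coeff_map_poly)
  qed
  with f have "?P g" by auto
  then obtain m where m: "?P m" and m_min: "\<And>q. ?P q \<Longrightarrow> degree m \<le> degree q"
    using ex_has_least_nat[of ?P g degree] by blast
  obtain r where r: "prime r" "r dvd m" "poly (map_poly of_int r) x = 0"
    using ex_prime_factor_root m by blast
  show ?thesis
  proof (intro ex1I conjI)
    show "irreducible r" using r(1) by (simp add: prime_elem_imp_irreducible)
    show "lead_coeff r > 0"
      using r(1) normalize_int_poly_eq_iff[of r] by (auto simp: normalize_prime)
    show "poly (map_poly of_int r) x = 0" by fact
  next
    fix q :: "int poly"
    assume q: "irreducible q \<and> lead_coeff q > 0 \<and> poly (map_poly of_int q) x = 0"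
    obtain a d where ad: "a \<noteq> 0" "smult a q = m * d + pseudo_mod q m"
      using pseudo_mod(1)[of m q] m by blast
    have "poly (map_poly of_int (smult a q)) x = 0"
      using q by (simp add: poly_of_int_smult)
    hence "poly (map_poly of_int (pseudo_mod q m)) x = 0"
      unfolding ad(2) using m by (simp add: poly_of_int_add poly_of_int_mult)
    with pseudo_mod(2)[of m q] m m_min[of "pseudo_mod q m"] have "pseudo_mod q m = 0"
      by force
    with ad have "m dvd [:a:] * q" by simp
    with r have "r dvd [:a:] * q" using dvd_trans by blast
    moreover have "\<not> r dvd [:a:]"
    proof
      assume "r dvd [:a:]"
      then obtain c where "r = [:c:]"
        using ad(1) by (metis degree_pCons_0 dvd_imp_degree_le le_zero_eq degree_eq_zeroE pCons_eq_0_iff)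
      with r show False by (auto simp: map_poly_pCons)
    qed
    ultimately have "r dvd q"
      using r(1) by (meson prime_dvd_multD)
    moreover from this have "q dvd r"
      using q r(1) by (meson irreducible_altdef not_prime_unit prime_elem_not_unit prime_def)
    ultimately have "normalize q = normalize r" by (simp add: associated_iff_dvd)
    thus "q = r"
      using q r(1) normalize_int_poly_eq_iff[of q] by (auto simp: normalize_prime)
  qed
qed

end

(*
  A zero of index n of the sequence with coefficients c gives the point (c_i \<alpha>_i^n) on the line
  x + y + z = 0, and inequivalent sequences give distinct projective points. Let x and y be such
  points, with indices n <= m.

  For every N there are binary forms W_i of degree N with integer coefficients such that
  sum_i x_i^(2N+1) W_i(x) = 0: the three summands are the integrals of ((t-a)(t-b)(t-c))^N over the
  sides of the triangle with side vectors x_1, x_2, x_3. Since also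
  sum_i x_i^(2N+1) (y_i / x_i^(2N+1)) = 0, the vector (x_i^(2N+1)) is proportional to the cross
  product of (W_i) and (y_i / x_i^(2N+1)), unless that vanishes. Hence the projective height
  satisfies (N+1) h(x) <= h(y / x^(2N+1)) + O(N + 1), and y / x^(2N+1) is \<alpha>^(m - (2N+1)n) up to
  a factor of height O((N+1) \<theta>). For large n this excludes m / n from an interval close to
  ((3N+1)/2, 3N+2). For N = 0 it forces m to be nearly 2n at least. Consecutive N cannot both be
  degenerate, because a three-term recurrence for the integrals has non-zero determinant; so all large
  ratios m / n are excluded.

  The height inequalities are sums of local ones over the places (p, \<sigma>) of a number field K, where
  p is infinity or a prime, \<sigma> is an embedding of K into the complex numbers, and the p-adic absolute
  value is extended to all algebraic numbers: a maximal subring of the complex numbers that does not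
  contain 1/p is a valuation ring. For a fixed p, every place of K above p occurs among the (p, \<sigma>) as
  often as its local degree.
*)

theory Submission
  imports Defs "HOL-Computational_Algebra.Fundamental_Theorem_Algebra"
begin

section \<open>Polynomials over subfields of the complex numbers\<close>

text \<open>The bound 24 is 19 + 5. Above the second threshold the error terms of the Pade
  inequalities, which grow linearly in N like the main term, stay within a fixed fraction of it, and
  the excluded intervals then overlap for all large N; six zeros reach such a ratio m / n by near
  doubling. Between the two thresholds doubling alone bounds the number of sequences. Which of two
  consecutive N is nondegenerate is not known, so m / n has to lie in the excluded intervals of
  both. Such an interval is not symmetric about 2N + 1, because inverting the coordinates can double
  a projective height. The recurrence argument has one exception, the equilateral triangle; there x
  has height 0, which is impossible for a large index. Only finitely many places are kept. The cross
  product need not be a unit outside them, so the product formula is used as an inequality for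
  elements integral at all other places and as an equation for units; the inequality points in the
  right direction.\<close>

definition over :: "complex set \<Rightarrow> complex poly \<Rightarrow> bool" where
  "over F p \<longleftrightarrow> (\<forall>i. coeff p i \<in> F)"

text \<open>Subrings are sets of complex numbers, not types, so that polynomials over different
  rings share the type \<open>complex poly\<close> and their roots are at hand.\<close>

locale csubring =
  fixes F :: "complex set"
  assumes one [simp]: "1 \<in> F"
    and add [intro]: "x \<in> F \<Longrightarrow> y \<in> F \<Longrightarrow> x + y \<in> F"
    and uminus [intro]: "x \<in> F \<Longrightarrow> - x \<in> F"
    and mult [intro]: "x \<in> F \<Longrightarrow> y \<in> F \<Longrightarrow> x * y \<in> F"
begin

lemma zero [simp]: "0 \<in> F"
  using add[OF one uminus[OF one]] by simp

lemma diff [intro]: "x \<in> F \<Longrightarrow> y \<in> F \<Longrightarrow> x - y \<in> F"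
  using add[of x "- y"] uminus[of y] by simp

lemma power [intro]: "x \<in> F \<Longrightarrow> x ^ n \<in> F"
  by (induction n) auto

lemma sum [intro]: "(\<And>i. i \<in> I \<Longrightarrow> f i \<in> F) \<Longrightarrow> sum f I \<in> F"
  by (induction I rule: infinite_finite_induct) auto

lemma of_nat [intro, simp]: "of_nat n \<in> F"
  by (induction n) auto

lemma of_int [intro, simp]: "of_int n \<in> F"
  by (cases n rule: int_cases2) auto

lemma over_0 [simp]: "over F 0" and over_1 [simp]: "over F 1"
  and over_pCons [simp]: "over F (pCons a p) \<longleftrightarrow> a \<in> F \<and> over F p"
  by (auto simp: over_def coeff_pCons one_pCons split: nat.splits)

lemma over_add [intro]: "over F p \<Longrightarrow> over F q \<Longrightarrow> over F (p + q)"
  and over_diff [intro]: "over F p \<Longrightarrow> over F q \<Longrightarrow> over F (p - q)"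
  and over_uminus [intro]: "over F p \<Longrightarrow> over F (- p)"
  and over_smult [intro]: "c \<in> F \<Longrightarrow> over F p \<Longrightarrow> over F (smult c p)"
  by (auto simp: over_def)

lemma over_mult [intro]: "over F p \<Longrightarrow> over F q \<Longrightarrow> over F (p * q)"
  by (auto simp: over_def coeff_mult)

lemma over_pcompose [intro]: "over F p \<Longrightarrow> over F q \<Longrightarrow> over F (pcompose p q)"
  by (induction p) (auto simp: pcompose_pCons)

lemma poly_in: "over F p \<Longrightarrow> x \<in> F \<Longrightarrow> poly p x \<in> F"
  by (induction p) auto

lemma over_pderiv [intro]: "over F p \<Longrightarrow> over F (pderiv p)"
  by (induction p) (auto simp: pderiv_pCons)

end

locale cfield = csubring +
  assumes inverse [intro]: "x \<in> F \<Longrightarrow> inverse x \<in> F"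
begin

lemma divide [intro]: "x \<in> F \<Longrightarrow> y \<in> F \<Longrightarrow> x / y \<in> F"
  using mult[of x "inverse y"] inverse[of y] by (simp add: field_simps)

lemma Rats_subset: "\<rat> \<subseteq> F"
proof
  fix x :: complex assume "x \<in> \<rat>"
  then obtain a b where "x = of_int a / of_int b" by (auto elim!: Rats_cases')
  thus "x \<in> F" by auto
qed

lemma infinite_subfield: "infinite F"
proof
  assume "finite F"
  hence "finite (range (of_nat :: nat \<Rightarrow> complex))" by (rule finite_subset[rotated]) auto
  thus False by (simp add: finite_image_iff inj_on_def)
qed

lemma over_mod [intro]: "over F p \<Longrightarrow> over F q \<Longrightarrow> over F (p mod q)"
proof (induction p)
  case (pCons a p)
  hence "over F (pCons a (p mod q))" by simp
  moreover from this pCons.prems have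
    "coeff (pCons a (p mod q)) (degree q) / coeff q (degree q) \<in> F"
    unfolding over_def by blast
  ultimately show ?case
    using pCons by (cases "q = 0") (auto simp: mod_pCons_eq)
qed auto

lemma over_div:
  assumes "over F p" "over F q"
  shows "over F (p div q)"
  using assms
proof (induction p)
  case (pCons a p)
  hence "over F (pCons a (p mod q))" by (simp add: over_mod)
  with pCons.prems have
    "coeff (pCons a (p mod q)) (degree q) / coeff q (degree q) \<in> F"
    unfolding over_def by blast
  thus ?case using pCons
    by (cases "q = 0") (auto simp: div_pCons_eq)
qed auto

lemma ex_minimal_poly:
  assumes "over F p" "p \<noteq> 0" "poly p x = 0"
  obtains m where "over F m" "lead_coeff m = 1" "poly m x = 0"
    "\<And>f. over F f \<Longrightarrow> poly f x = 0 \<Longrightarrow> m dvd f"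
proof -
  let ?P = "\<lambda>p. over F p \<and> p \<noteq> 0 \<and> poly p x = 0"
  obtain m where m: "?P m" and m_min: "\<And>q. ?P q \<Longrightarrow> degree m \<le> degree q"
    using ex_has_least_nat[of ?P p degree] assms by blast
  define m' where "m' = smult (inverse (lead_coeff m)) m"
  have "m dvd f" if f: "over F f" "poly f x = 0" for f
  proof -
    have "poly (f mod m) x = 0"
      using f m div_mult_mod_eq[of f m]
      by (metis add_cancel_right_left mult_zero_right poly_add poly_mult)
    moreover have "over F (f mod m)" using f m by auto
    ultimately have "f mod m = 0"
      using m_min[of "f mod m"] degree_mod_less[of m f] m by fastforce
    thus ?thesis by (simp add: mod_eq_0_iff_dvd)
  qed
  moreover have "lead_coeff m \<in> F" using m by (simp add: over_def)
  ultimately show ?thesis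
    using m by (intro that[of m']) (auto simp: m'_def smult_dvd_iff)
qed

text \<open>Newton interpolation: splitting off X - a at a point a of A lowers the degree, and the
  quotient again takes values in F on the rest of A. The lemma replaces the theorem on symmetric
  functions: for a product over all roots it suffices to know its values at points of F.\<close>

lemma over_if_values:
  assumes "infinite A" "A \<subseteq> F" "\<And>a. a \<in> A \<Longrightarrow> poly p a \<in> F"
  shows "over F p"
  using assms
proof (induction "degree p" arbitrary: p A rule: less_induct)
  case less
  obtain a where a: "a \<in> A" using less.prems(1) by fastforce
  show ?case
  proof (cases "degree p = 0")
    case True
    then obtain c where "p = [:c:]" by (rule degree_eq_zeroE)
    thus ?thesis using less.prems(3)[OF a] by simp
  next
    case False
    define q where "q = synthetic_div p a"
    have p: "p = [:-a, 1:] * q + [:poly p a:]"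
      unfolding q_def using synthetic_div_correct'[of a p] by simp
    have "over F q"
    proof (rule less.hyps)
      show "degree q < degree p" using False by (simp add: q_def degree_synthetic_div)
      show "infinite (A - {a})" "A - {a} \<subseteq> F" using less.prems by auto
      fix b assume b: "b \<in> A - {a}"
      have "poly p b = (b - a) * poly q b + poly p a" by (subst p) (simp add: algebra_simps)
      hence "poly q b = (poly p b - poly p a) / (b - a)" using b by (simp add: field_simps)
      thus "poly q b \<in> F" using less.prems a b by auto
    qed
    thus ?thesis using a less.prems(2,3) by (subst p) (intro over_add over_mult; auto)
  qed
qed

end

section \<open>Resultants and norms\<close>

lemma poly_eq_prod_proots:
  "poly p (x :: complex) = lead_coeff p * (\<Prod>r\<in>#proots p. x - r)"
proof -
  have "p = smult (lead_coeff p) (\<Prod>r\<in>#proots p. [:-r, 1:])"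
    by (simp add: complex_poly_decompose_multiset)
  hence "poly p x = poly (smult (lead_coeff p) (\<Prod>r\<in>#proots p. [:-r, 1:])) x" by simp
  thus ?thesis by (simp add: poly_prod_mset image_mset.compositionality o_def algebra_simps)
qed

lemma prod_mset_diff_swap:
  "(\<Prod>r\<in>#A. \<Prod>s\<in>#B. r - s) = (- 1) ^ (size A * size B) * (\<Prod>s\<in>#B. \<Prod>r\<in>#A. s - (r :: complex))"
proof (induction A)
  case (add a A)
  have 1: "(\<Prod>s\<in>#B. a - s) = (-1) ^ size B * (\<Prod>s\<in>#B. s - a)"
    by (induction B) (auto simp: algebra_simps)
  show ?case by (simp add: add.IH 1 prod_mset.distrib power_add mult_ac)
qed simp

text \<open>Symmetry of the resultant: the left side is Res(f, g), the right side Res(g, f) with its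
  sign.\<close>

lemma prod_mset_proots_swap:
  fixes f g :: "complex poly"
  shows "(\<Prod>r\<in>#proots f. poly g r) * lead_coeff f ^ degree g =
    (- 1) ^ (degree f * degree g) * lead_coeff g ^ degree f * (\<Prod>s\<in>#proots g. poly f s)"
  by (simp add: poly_eq_prod_proots[of f] poly_eq_prod_proots[of g] prod_mset.distrib
        size_proots_complex prod_mset_diff_swap[of "proots f" "proots g"] algebra_simps
        del: proots_mult)

text \<open>The product is a resultant up to a power of the leading coefficient of f. As in the
  Euclidean algorithm, g is reduced modulo f, which keeps its values at the roots of f, and swapping
  the two polynomials then leads to a product over fewer roots.\<close>

lemma (in cfield) prod_proots_in:
  assumes "over F f" "over F g"
  shows "(\<Prod>r\<in>#proots f. poly g r) \<in> F"
  using assms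
proof (induction "degree f" arbitrary: f g rule: less_induct)
  case less
  show ?case
  proof (cases "degree f = 0 \<or> f dvd g")
    case True
    thus ?thesis
    proof
      assume "f dvd g"
      hence "\<forall>r\<in>#proots f. poly g r = 0"
        by (cases "f = 0") (auto elim!: dvdE)
      hence "(\<Prod>r\<in>#proots f. poly g r) = 0 ^ size (proots f)"
        by (simp add: image_mset_cong[of "proots f" "poly g" "\<lambda>_. 0"] del: proots_mult)
      thus ?thesis by (auto simp: power_0_left)
    qed (auto elim!: degree_eq_zeroE)
  next
    case False
    define h where "h = g mod f"
    have f0: "f \<noteq> 0" using False by auto
    have h: "over F h" "h \<noteq> 0" "degree h < degree f"
      using less.prems False degree_mod_less[OF f0, of g]
      by (auto simp: h_def mod_eq_0_iff_dvd)
    have "poly g r = poly h r" if "r \<in># proots f" for r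
    proof -
      have "poly f r = 0" using that f0 by simp
      thus ?thesis using div_mult_mod_eq[of g f]
        by (metis add_0 h_def mult_zero_right poly_add poly_mult)
    qed
    hence "(\<Prod>r\<in>#proots f. poly g r) = (\<Prod>r\<in>#proots f. poly h r)"
      by (intro arg_cong[of _ _ prod_mset] image_mset_cong)
    also have "\<dots> = (- 1) ^ (degree f * degree h) * lead_coeff h ^ degree f
        * (\<Prod>s\<in>#proots h. poly f s) / lead_coeff f ^ degree h"
      using prod_mset_proots_swap[where f = f and g = h] f0
      by (simp only: nonzero_eq_divide_eq leading_coeff_0_iff power_eq_0_iff not_False_eq_True simp_thms)
    also have "\<dots> \<in> F"
      using h less.prems less.hyps[OF h(3), of f]
      by (intro divide mult power uminus one) (auto simp: over_def)
    finally show ?thesis .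
  qed
qed

text \<open>For the minimal polynomial m of a generator this is the characteristic polynomial of the
  element f(generator); its roots are the conjugates of that element with multiplicity.\<close>

definition norm_poly :: "complex poly \<Rightarrow> complex poly \<Rightarrow> complex poly" where
  "norm_poly m f = (\<Prod>r\<in>#proots m. [:- poly f r, 1:])"

lemma poly_norm_poly: "poly (norm_poly m f) c = (\<Prod>r\<in>#proots m. c - poly f r)"
  by (simp add: norm_poly_def poly_prod_mset image_mset.compositionality o_def)

lemma norm_poly_nz: "norm_poly m f \<noteq> 0"
  by (auto simp: norm_poly_def prod_mset_zero_iff)

lemma proots_norm_poly: "proots (norm_poly m f) = image_mset (poly f) (proots m)"
proof -
  have "proots (\<Prod>r\<in>#M. [:- poly f r, 1:]) = image_mset (poly f) M" for M
  proof (induction M)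
    case (add r M)
    have "(\<Prod>r\<in>#M. [:- poly f r, 1:]) \<noteq> 0" by (auto simp: prod_mset_zero_iff)
    thus ?case using add by (simp add: proots_mult del: mult_pCons_left)
  qed simp
  thus ?thesis by (simp add: norm_poly_def)
qed

lemma (in cfield) over_norm_poly:
  assumes "over F m" "over F f"
  shows "over F (norm_poly m f)"
proof (rule over_if_values[OF infinite_subfield])
  fix c assume c: "c \<in> F"
  hence "over F ([:c:] - f)" using assms by auto
  from prod_proots_in[OF assms(1) this]
  show "poly (norm_poly m f) c \<in> F" by (simp add: poly_norm_poly)
qed auto

section \<open>Sums, products and primitive elements of algebraic numbers\<close>

interpretation rat: cfield "\<rat> :: complex set"
  by unfold_locales auto

lemma algebraic_iff_over: "algebraic x \<longleftrightarrow> (\<exists>p. over \<rat> p \<and> p \<noteq> 0 \<and> poly p x = 0)"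
  by (simp add: algebraic_altdef over_def)

text \<open>A resultant in disguise: the product of q(X - r) over the roots r of p vanishes at x +
  y, and its value at a rational c is a product of q(c - r) over these roots, hence
  rational.\<close>

lemma algebraic_add:
  fixes x y :: complex
  assumes "algebraic x" "algebraic y"
  shows "algebraic (x + y)"
proof -
  obtain p q where p: "over \<rat> p" "p \<noteq> 0" "poly p x = 0"
    and q: "over \<rat> q" "q \<noteq> 0" "poly q y = 0"
    using assms algebraic_iff_over by metis
  define G where "G = (\<Prod>r\<in>#proots p. pcompose q [:- r, 1:])"
  have "over \<rat> G"
  proof (rule rat.over_if_values[OF rat.infinite_subfield])
    fix c :: complex assume c: "c \<in> \<rat>"
    have "over \<rat> (pcompose q [:c, - 1:])" using q c by auto
    from rat.prod_proots_in[OF p(1) this]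
    show "poly G c \<in> \<rat>"
      by (simp add: G_def poly_prod_mset image_mset.compositionality o_def poly_pcompose)
  qed auto
  moreover have "pcompose q [:- r, 1:] \<noteq> 0" for r
    using q(2) by (simp add: pcompose_eq_0_iff)
  hence "G \<noteq> 0" by (auto simp: G_def prod_mset_zero_iff)
  moreover have "poly G (x + y) = 0"
    using p q by (auto simp: G_def poly_prod_mset prod_mset_zero_iff poly_pcompose
        image_mset.compositionality o_def intro!: image_eqI[of _ _ x])
  ultimately show ?thesis using algebraic_iff_over by blast
qed

lemma algebraic_of_nat_mult: "algebraic y \<Longrightarrow> algebraic (of_nat n * (y :: complex))"
  by (induction n) (auto simp: algebra_simps intro: algebraic_add)

definition adjoin :: "complex \<Rightarrow> complex set" where
  "adjoin g = {poly f g |f. over \<rat> f}"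

lemma adjoinE:
  assumes "x \<in> adjoin g"
  obtains f where "over \<rat> f" "x = poly f g"
  using assms by (auto simp: adjoin_def)

lemma adjoin_self: "g \<in> adjoin g"
  unfolding adjoin_def by (rule CollectI, rule exI[of _ "[:0, 1:]"]) auto

lemma algebraic_adjoin:
  assumes "algebraic g" "x \<in> adjoin g"
  shows "algebraic x"
proof -
  obtain f where f: "over \<rat> f" "x = poly f g" using assms(2) by (rule adjoinE)
  obtain m where m: "over \<rat> m" "m \<noteq> 0" "poly m g = 0"
    using assms(1) algebraic_iff_over by metis
  have "poly (norm_poly m f) x = 0"
    using m f by (auto simp: poly_norm_poly prod_mset_zero_iff intro!: image_eqI[of _ _ g])
  thus ?thesis
    using rat.over_norm_poly[OF m(1) f(1)] norm_poly_nz algebraic_iff_over by blast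
qed

lemma adjoin_trans:
  assumes "h \<in> adjoin g"
  shows "adjoin h \<subseteq> adjoin g"
proof
  fix x assume "x \<in> adjoin h"
  then obtain f where f: "over \<rat> f" "x = poly f h" by (rule adjoinE)
  obtain k where k: "over \<rat> k" "h = poly k g" using assms by (rule adjoinE)
  have "x = poly (pcompose f k) g" using f k by (simp add: poly_pcompose)
  thus "x \<in> adjoin g" using f k unfolding adjoin_def by blast
qed

lemma inverse_in_adjoin:
  assumes "algebraic x"
  shows "inverse x \<in> adjoin x"
proof (cases "x = 0")
  case True
  thus ?thesis using adjoin_self[of 0] by simp
next
  case False
  obtain p where p: "\<And>i. coeff p i \<in> \<rat>" "poly p x = 0" "coeff p 0 \<noteq> 0"
    using algebraicE'_nonzero[OF assms False]
    by (metis Ints_subset_Rats subsetD Ints_of_int coeff_map_poly of_int_0 Ints_subset_Rats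
        of_int_eq_0_iff Rats_of_int)
  obtain a q where pq: "p = pCons a q" by (cases p)
  have q: "over \<rat> q" "a \<in> \<rat>" "a \<noteq> 0"
    using p(1,3) unfolding over_def by (auto simp: pq coeff_pCons split: nat.splits)
       (metis old.nat.simps(5), metis old.nat.simps(4))
  have "x * poly q x = - a" using p(2) by (simp add: pq add_eq_0_iff)
  hence "inverse x = poly (smult (- inverse a) q) x"
    using False q(3) by (simp add: field_simps)
  thus ?thesis unfolding adjoin_def using q by blast
qed

lemma cfield_adjoin:
  assumes "algebraic g"
  shows "cfield (adjoin g)"
proof
  show "1 \<in> adjoin g" unfolding adjoin_def by (rule CollectI, rule exI[of _ 1]) auto
next
  fix x y assume "x \<in> adjoin g" "y \<in> adjoin g"
  then obtain p q where pq: "over \<rat> p" "over \<rat> q" "x = poly p g" "y = poly q g"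
    by (metis adjoinE)
  have "x + y = poly (p + q) g" "x * y = poly (p * q) g" "over \<rat> (p + q)" "over \<rat> (p * q)"
    using pq by auto
  thus "x + y \<in> adjoin g" "x * y \<in> adjoin g" unfolding adjoin_def by blast+
next
  fix x assume x: "x \<in> adjoin g"
  then obtain p where p: "over \<rat> p" "x = poly p g" by (metis adjoinE)
  have "- x = poly (- p) g" "over \<rat> (- p)" using p by auto
  thus "- x \<in> adjoin g" unfolding adjoin_def by blast
  show "inverse x \<in> adjoin g"
    using inverse_in_adjoin[OF algebraic_adjoin[OF assms x]] adjoin_trans[OF x] by blast
qed

lemma monic_root_degree:
  assumes "lead_coeff p = 1" "poly p (x :: complex) = 0"
  shows "degree p \<noteq> 0"
proof
  assume "degree p = 0"
  then obtain c where "p = [:c:]" by (rule degree_eq_zeroE)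
  with assms show False by simp
qed

text \<open>With g = x + n y, the minimal polynomial m of y over Q(g) divides both q and p(g - n X).
  For all but finitely many n these have only the root y in common, so m is a power of X - y; it is
  linear because y is a simple root of q, the minimal polynomial over the rationals.\<close>

lemma primitive_element2:
  assumes "algebraic x" "algebraic y"
  obtains g where "algebraic g" "x \<in> adjoin g" "y \<in> adjoin g"
proof -
  obtain p where p: "over \<rat> p" "p \<noteq> 0" "poly p x = 0"
    using assms(1) algebraic_iff_over by metis
  obtain q0 where q0: "over \<rat> q0" "q0 \<noteq> 0" "poly q0 y = 0"
    using assms(2) algebraic_iff_over by metis
  obtain q where q: "over \<rat> q" "lead_coeff q = 1" "poly q y = 0"
    and q_min: "\<And>f. over \<rat> f \<Longrightarrow> poly f y = 0 \<Longrightarrow> q dvd f"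
    using rat.ex_minimal_poly[OF q0] by blast
  have qnz: "q \<noteq> 0" using q(2) by auto
  \<comment> \<open>The values n at which x + n y = r + n s for some roots r and s with s different
    from y. For s = y the division by zero only adds 0 to the set.\<close>
  define B where "B = (\<lambda>(r, s). (r - x) / (y - s)) ` ({r. poly p r = 0} \<times> {s. poly q s = 0})"
  have "finite B" unfolding B_def using p(2) qnz by (simp add: poly_roots_finite)
  moreover have "infinite (range (of_nat :: nat \<Rightarrow> complex))"
    by (simp add: finite_image_iff inj_on_def)
  ultimately obtain n where n: "of_nat n \<notin> B" by (metis finite_subset image_subsetI)
  define g where "g = x + of_nat n * y"
  have g: "algebraic g" unfolding g_def using assms by (intro algebraic_add algebraic_of_nat_mult)
  interpret K: cfield "adjoin g" by (rule cfield_adjoin[OF g])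
  have overK: "over (adjoin g) f" if "over \<rat> f" for f
    using that K.Rats_subset by (auto simp: over_def)
  obtain m where m: "over (adjoin g) m" "lead_coeff m = 1" "poly m y = 0"
    and m_min: "\<And>f. over (adjoin g) f \<Longrightarrow> poly f y = 0 \<Longrightarrow> m dvd f"
    using K.ex_minimal_poly[OF overK[OF q(1)] qnz q(3)] by blast
  have mq: "m dvd q" using m_min[OF overK] q by blast
  define h where "h = pcompose p [:g, - of_nat n:]"
  have "over (adjoin g) h" unfolding h_def
    using adjoin_self[of g] by (intro K.over_pcompose overK[OF p(1)]) auto
  moreover have "poly h y = 0" using p by (simp add: h_def g_def poly_pcompose)
  ultimately have mh: "m dvd h" using m_min by blast
  have root: "z = y" if z: "poly m z = 0" for z
  proof (rule ccontr)
    assume zy: "z \<noteq> y"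
    have "poly q z = 0" using mq z by (auto elim!: dvdE)
    moreover have "poly h z = 0" using mh z by (auto elim!: dvdE)
    hence "poly p (g - of_nat n * z) = 0" by (simp add: h_def poly_pcompose mult.commute)
    moreover have "of_nat n = ((g - of_nat n * z) - x) / (y - z)"
      using zy by (simp add: g_def field_simps)
    ultimately have "of_nat n \<in> B"
      unfolding B_def by (intro image_eqI[of _ _ "(g - of_nat n * z, z)"]) auto
    with n show False by blast
  qed
  have "set_mset (proots m) \<subseteq> {y}" using m(2) root by (cases "m = 0") auto
  hence "proots m = replicate_mset (size (proots m)) y" by (rule set_mset_subset_singletonD)
  hence pm: "proots m = replicate_mset (degree m) y" by (simp add: size_proots_complex)
  have meq: "m = [:- y, 1:] ^ degree m"
  proof -
    have "m = smult (lead_coeff m) (\<Prod>r\<in>#proots m. [:-r, 1:])"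
      by (simp add: complex_poly_decompose_multiset)
    thus ?thesis using m(2) by (simp add: pm)
  qed
  have "degree m \<le> 1"
  proof (rule ccontr)
    assume "\<not> degree m \<le> 1"
    hence "[:- y, 1:] ^ 2 dvd [:- y, 1:] ^ degree m" by (intro le_imp_power_dvd) auto
    hence "[:- y, 1:] ^ 2 dvd m" by (subst meq)
    hence "[:- y, 1:] ^ 2 dvd q" using mq by (rule dvd_trans)
    then obtain k where "q = [:- y, 1:] ^ 2 * k" by (rule dvdE)
    hence k: "q = [:- y, 1:] * ([:- y, 1:] * k)" by (simp only: power2_eq_square mult.assoc)
    define K where "K = [:- y, 1:] * k"
    have dq: "pderiv q = [:- y, 1:] * pderiv K + K * pderiv [:- y, 1:]"
      unfolding k K_def[symmetric] by (rule pderiv_mult)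
    have "poly (pderiv q) y = 0" unfolding dq poly_add poly_mult K_def by simp
    hence "q dvd pderiv q" by (rule q_min[OF rat.over_pderiv[OF q(1)]])
    moreover have "degree q \<noteq> 0" using monic_root_degree[OF q(2,3)] .
    ultimately show False
      using dvd_imp_degree_le[of q "pderiv q"] by (simp add: degree_pderiv pderiv_eq_0_iff)
  qed
  moreover have "degree m \<noteq> 0" using monic_root_degree[OF m(2,3)] .
  ultimately have "degree m = 1" by linarith
  have "m = [:- y, 1:] ^ 1" using meq unfolding \<open>degree m = 1\<close> .
  hence "- y \<in> adjoin g" using m(1) by simp
  from K.uminus[OF this] have y: "y \<in> adjoin g" by simp
  have "x = g - of_nat n * y" by (simp add: g_def)
  hence "x \<in> adjoin g" by (metis K.diff[OF adjoin_self K.mult[OF K.of_nat y]])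
  with g y show ?thesis using that by blast
qed

lemma algebraic_mult:
  fixes x y :: complex
  assumes "algebraic x" "algebraic y"
  shows "algebraic (x * y)"
proof -
  obtain g where g: "algebraic g" "x \<in> adjoin g" "y \<in> adjoin g"
    using primitive_element2[OF assms] by blast
  interpret K: cfield "adjoin g" by (rule cfield_adjoin[OF g(1)])
  show ?thesis by (rule algebraic_adjoin[OF g(1) K.mult[OF g(2,3)]])
qed

theorem primitive_element:
  assumes "finite E" "\<And>x. x \<in> E \<Longrightarrow> algebraic x"
  obtains g where "algebraic g" "E \<subseteq> adjoin g"
  using assms
proof (induction E arbitrary: thesis rule: finite_induct)
  case empty
  show ?case by (rule empty(1)[of 0]) auto
next
  case (insert x E)
  obtain g where g: "algebraic g" "E \<subseteq> adjoin g" using insert.IH insert.prems(2) by blast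
  obtain h where h: "algebraic h" "x \<in> adjoin h" "g \<in> adjoin h"
    using primitive_element2[of x g] insert.prems(2) g by blast
  show ?case by (rule insert.prems(1)[of h]) (use g h adjoin_trans in auto)
qed

section \<open>Extending the p-adic absolute value to algebraic numbers\<close>

lemma (in csubring) poly_inverse_times_power:
  assumes "over F f" "y \<in> F" "x * y = 1" "degree f \<le> n"
  shows "poly f x * y ^ n \<in> F"
  using assms
proof (induction f arbitrary: n)
  case (pCons a f)
  show ?case
  proof (cases "f = 0")
    case True
    thus ?thesis using pCons.prems by auto
  next
    case False
    then obtain k where n: "n = Suc k" using pCons.prems(4) by (cases n) auto
    have "poly f x * y ^ k \<in> F" using pCons.prems False by (intro pCons.IH) (auto simp: n)
    moreover have "poly (pCons a f) x * y ^ n = a * y ^ n + (x * y) * (poly f x * y ^ k)"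
      by (simp add: n algebra_simps)
    ultimately show ?thesis using pCons.prems by auto
  qed
qed auto

lemma (in csubring) csubring_adjoin:
  shows "csubring {poly f x |f. over F f}"
proof
  show "1 \<in> {poly f x |f. over F f}" by (auto intro!: exI[of _ 1])
next
  fix y z assume "y \<in> {poly f x |f. over F f}" "z \<in> {poly f x |f. over F f}"
  then obtain f g where "over F f" "over F g" "y = poly f x" "z = poly g x" by blast
  thus "y + z \<in> {poly f x |f. over F f}" "y * z \<in> {poly f x |f. over F f}"
    "- y \<in> {poly f x |f. over F f}"
    by (auto intro: exI[of _ "f + g"] exI[of _ "f * g"] exI[of _ "- f"])
qed

locale padic_ring = csubring A for A +
  fixes p :: nat
  assumes prime: "prime p"
    and not_in: "1 / of_nat p \<notin> A"
    and maximal: "\<And>B. csubring B \<Longrightarrow> A \<subseteq> B \<Longrightarrow> 1 / of_nat p \<notin> B \<Longrightarrow> B = A"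

text \<open>Zorn's lemma; the ring \<open>\<int>\<close> shows that the family is non-empty.\<close>

lemma ex_padic_ring:
  assumes "prime p"
  shows "\<exists>A. padic_ring A p"
proof -
  let ?S = "{B. csubring B \<and> 1 / complex_of_nat p \<notin> B}"
  have p: "p > 1" using assms by (rule prime_gt_1_nat)
  have "1 / complex_of_nat p \<notin> \<int>"
  proof
    assume "1 / complex_of_nat p \<in> \<int>"
    then obtain k where "1 / complex_of_nat p = of_int k" by (elim Ints_cases)
    hence "of_int 1 = (of_int (k * int p) :: complex)" using p by (simp add: field_simps)
    hence "k * int p = 1" using of_int_eq_iff by metis
    thus False using p by (metis dvd_triv_right int_one_le_iff_zero_less nat_dvd_1_iff_1 nat_neq_iff of_nat_1 of_nat_dvd_iff of_nat_0_less_iff)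
  qed
  moreover have "csubring (\<int> :: complex set)" by unfold_locales auto
  ultimately have "?S \<noteq> {}" by blast
  moreover have "\<Union>C \<in> ?S" if C: "C \<noteq> {}" "subset.chain ?S C" for C
  proof -
    have sub: "B \<in> C \<Longrightarrow> csubring B" "B \<in> C \<Longrightarrow> 1 / complex_of_nat p \<notin> B" for B
      using C(2) by (auto simp: subset.chain_def)
    have tot: "\<exists>B\<in>C. x \<in> B \<and> y \<in> B" if "x \<in> \<Union>C" "y \<in> \<Union>C" for x y
      using that C(2) unfolding subset_chain_def by blast
    have "csubring (\<Union>C)"
    proof
      show "1 \<in> \<Union>C" using C(1) sub csubring.one by blast
    next
      fix x y assume "x \<in> \<Union>C" "y \<in> \<Union>C"
      then obtain B where "B \<in> C" "x \<in> B" "y \<in> B" using tot by blast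
      thus "x + y \<in> \<Union>C" "x * y \<in> \<Union>C" "- x \<in> \<Union>C"
        using sub(1) csubring.add csubring.mult csubring.uminus by blast+
    qed
    thus ?thesis using sub(2) by blast
  qed
  ultimately obtain A where A: "A \<in> ?S" "\<forall>X\<in>?S. A \<subseteq> X \<longrightarrow> X = A"
    using subset_Zorn_nonempty[of ?S] by blast
  have "padic_ring A p"
    unfolding padic_ring_def padic_ring_axioms_def using A assms by blast
  thus ?thesis ..
qed

context padic_ring
begin

lemma p_nz [simp]: "complex_of_nat p \<noteq> 0" "p \<noteq> 0" "p > 0"
  using prime prime_gt_0_nat by auto

lemma p_mult_neq_1: "b \<in> A \<Longrightarrow> of_nat p * b \<noteq> 1"
proof
  assume b: "b \<in> A" "of_nat p * b = 1"
  hence "b = 1 / of_nat p" using p_nz by (metis nonzero_mult_div_cancel_left)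
  thus False using b not_in by simp
qed

text \<open>Maximality applied to A[x], which properly contains A and hence contains 1/p.\<close>

lemma inverse_p_in_adjoin:
  assumes "x \<notin> A"
  obtains f where "over A f" "1 = of_nat p * poly f x"
proof -
  let ?B = "{poly f x |f. over A f}"
  have "A \<subseteq> ?B"
  proof
    fix a assume "a \<in> A"
    hence "over A [:a:]" "a = poly [:a:] x" by auto
    thus "a \<in> ?B" by blast
  qed
  moreover have "over A [:0, 1:]" "x = poly [:0, 1:] x" by auto
  hence "x \<in> ?B" by blast
  ultimately have "1 / of_nat p \<in> ?B" using maximal[OF csubring_adjoin] assms by blast
  then obtain f where "over A f" "1 / of_nat p = poly f x" by blast
  thus ?thesis using that[of f] p_nz by (metis nonzero_mult_div_cancel_left times_divide_eq_right mult_1_right)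
qed

text \<open>If u = 1 - p b were no unit, 1/p would lie in A[1/u]. Clearing denominators makes a
  power of u a multiple of p, while every power of u is 1 modulo p; so p would be a unit.\<close>

lemma one_minus_unit:
  assumes "b \<in> A"
  shows "1 / (1 - of_nat p * b) \<in> A"
proof (rule ccontr)
  let ?u = "1 - of_nat p * b"
  assume "1 / ?u \<notin> A"
  then obtain f where f: "over A f" "1 = of_nat p * poly f (1 / ?u)" by (rule inverse_p_in_adjoin)
  have u: "?u \<in> A" "?u \<noteq> 0" using p_mult_neq_1[OF assms] diff[OF one mult[OF of_nat assms]] by auto
  have "poly f (1 / ?u) * ?u ^ degree f \<in> A"
    by (rule poly_inverse_times_power[OF f(1) u(1)]) (use u in auto)
  then obtain a where a: "a \<in> A" "?u ^ degree f = of_nat p * a"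
    using f(2) by (metis mult.assoc mult_1)
  have "\<exists>c\<in>A. ?u ^ n = 1 - of_nat p * c" for n
  proof (induction n)
    case (Suc n)
    then obtain c where c: "c \<in> A" "?u ^ n = 1 - of_nat p * c" by blast
    have "?u ^ Suc n = ?u * (1 - of_nat p * c)" by (simp add: c)
    also have "\<dots> = 1 - of_nat p * (b + c - of_nat p * (b * c))" by (simp add: algebra_simps)
    finally show ?case using c assms by (intro bexI[of _ "b + c - of_nat p * (b * c)"]) auto
  qed auto
  then obtain c where c: "c \<in> A" "?u ^ degree f = 1 - of_nat p * c" by blast
  have "of_nat p * (a + c) = 1" using a c by (simp add: algebra_simps)
  thus False using p_mult_neq_1 a c by blast
qed

text \<open>The descent step of Chevalley's argument. Let b be the constant term of g. As 1 - p b is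
  a unit, the relation for 1/x expresses x^m, with m the degree of g, as p times a polynomial in x
  of smaller degree; this is substituted into the leading term of f.\<close>

lemma reduce_degree:
  assumes x: "x \<noteq> 0" and f: "over A f" "1 = of_nat p * poly f x"
    and g: "over A g" "1 = of_nat p * poly g (1 / x)" and le: "degree g \<le> degree f"
  shows "\<exists>h. over A h \<and> 1 = of_nat p * poly h x \<and> degree h < degree f"
proof -
  obtain b g1 where gb: "g = pCons b g1" by (cases g)
  have b: "b \<in> A" "over A g1" using g(1) gb by auto
  have "g1 \<noteq> 0" using g(2) p_mult_neq_1[OF b(1)] by (auto simp: gb)
  hence dg: "degree g = Suc (degree g1)" by (simp add: gb)
  define u where "u = 1 - of_nat p * b"
  have u: "1 / u \<in> A" "u \<noteq> 0"
    using one_minus_unit[OF b(1)] p_mult_neq_1[OF b(1)] by (auto simp: u_def)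
  define k where "k = smult (1 / u) (reflect_poly g1)"
  define n where "n = degree f"
  define m where "m = degree g"
  have "coeff (reflect_poly g1) i \<in> A" for i
    using b(2) by (auto simp: coeff_reflect_poly over_def)
  hence k: "over A k" using u(1) by (auto simp: k_def over_def simp del: times_divide_eq_left)
  have "u * x = of_nat p * poly g1 (inverse x)"
    using g(2) x by (simp add: gb u_def field_simps)
  hence "u * x ^ m = of_nat p * (x ^ degree g1 * poly g1 (inverse x))"
    by (simp add: m_def dg algebra_simps)
  hence xm: "x ^ m = of_nat p * poly k x"
    using u(2) x by (simp add: k_def poly_reflect_poly_nz field_simps)
  define f1 where "f1 = f - monom (coeff f n) n"
  define h where "h = f1 + smult (coeff f n * of_nat p) (monom 1 (n - m) * k)"
  have npos: "n > 0" "m \<le> n" using le dg by (auto simp: n_def m_def)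
  have fn: "coeff f n \<in> A" using f by (auto simp: over_def)
  have "over A (monom c i)" if "c \<in> A" for c i using that by (auto simp: over_def)
  hence "over A h" unfolding h_def f1_def using f(1) k fn
    by (intro over_add over_diff over_smult over_mult mult of_nat) auto
  moreover have "poly h x = poly f x"
  proof -
    have "poly h x = poly f x - coeff f n * x ^ n + coeff f n * x ^ (n - m) * x ^ m"
      by (simp add: h_def f1_def poly_monom xm algebra_simps)
    also have "x ^ n = x ^ (n - m) * x ^ m" using npos by (simp flip: power_add)
    finally show ?thesis by simp
  qed
  moreover have "degree h < n"
  proof -
    have "degree f1 < n"
    proof -
      have "degree f1 \<le> n - 1"
      proof (rule degree_le, intro allI impI)
        fix i assume "n - 1 < i"
        hence "i = n \<or> i > degree f" using npos by (auto simp: n_def)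
        thus "coeff f1 i = 0" by (auto simp: f1_def coeff_eq_0 n_def)
      qed
      thus ?thesis using npos by simp
    qed
    moreover have "degree (smult (coeff f n * of_nat p) (monom 1 (n - m) * k)) < n"
    proof -
      have "degree k \<le> degree g1" unfolding k_def
        by (meson degree_reflect_poly_le degree_smult_le order_trans)
      moreover have "degree (monom 1 (n - m) * k) \<le> (n - m) + degree k"
        by (metis degree_mult_le degree_monom_eq zero_neq_one)
      ultimately have "degree (monom 1 (n - m) * k) < n" using npos dg m_def by linarith
      thus ?thesis using degree_smult_le le_less_trans by blast
    qed
    ultimately show ?thesis unfolding h_def by (rule degree_add_less)
  qed
  ultimately show ?thesis using f(2) by (auto simp: n_def)
qed

text \<open>Otherwise 1/p lies both in A[x] and in A[1/x]. Of the two relations the one of larger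
  degree can always be shortened, so the sum of the degrees would descend for ever.\<close>

lemma valuation_ring: "x \<in> A \<or> 1 / x \<in> A"
proof (rule ccontr)
  assume neg: "\<not> (x \<in> A \<or> 1 / x \<in> A)"
  hence x: "x \<noteq> 0" by auto
  have no: "False" if "over A f" "1 = of_nat p * poly f x" "over A g" "1 = of_nat p * poly g (1 / x)"
    for f g
    using that
  proof (induction "degree f + degree g" arbitrary: f g rule: less_induct)
    case less
    show ?case
    proof (cases "degree g \<le> degree f")
      case True
      obtain h where h: "over A h" "1 = of_nat p * poly h x" "degree h < degree f"
        using reduce_degree[OF x less.prems True] by blast
      show ?thesis by (rule less.hyps[OF _ h(1,2) less.prems(3,4)]) (use h in simp)
    next
      case False
      have "\<exists>h. over A h \<and> 1 = of_nat p * poly h (1 / x) \<and> degree h < degree g"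
        by (rule reduce_degree[of _ _ f]) (use x less.prems False in simp_all)
      then obtain h where h: "over A h" "1 = of_nat p * poly h (1 / x)" "degree h < degree g"
        by blast
      show ?thesis by (rule less.hyps[OF _ less.prems(1,2) h(1,2)]) (use h in simp)
    qed
  qed
  obtain f where "over A f" "1 = of_nat p * poly f x"
    using neg inverse_p_in_adjoin[of x] by blast
  moreover obtain g where "over A g" "1 = of_nat p * poly g (1 / x)"
    using neg inverse_p_in_adjoin[of "1 / x"] by blast
  ultimately show False by (rule no)
qed

lemma power_in_imp: "z ^ k \<in> A \<Longrightarrow> k > 0 \<Longrightarrow> z \<in> A"
proof (rule ccontr)
  assume z: "z ^ k \<in> A" "k > 0" "z \<notin> A"
  hence "1 / z \<in> A" "z \<noteq> 0" using valuation_ring by force+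
  moreover have "z ^ k * (1 / z) ^ (k - 1) = z"
    using z(2) \<open>z \<noteq> 0\<close> by (cases k) (auto simp: field_simps)
  ultimately show False using z by (metis mult power)
qed

lemma coprime_int_unit:
  assumes "\<not> int p dvd n"
  shows "1 / of_int n \<in> A"
proof -
  have "coprime (int p) n" using prime assms by (simp add: prime_imp_coprime)
  then obtain s t where st: "s * int p + t * n = 1" using bezout_int[of "int p" n] by auto
  have "1 / (1 - of_nat p * of_int s) \<in> A" by (rule one_minus_unit) simp
  moreover have eq: "1 - of_nat p * of_int s = (of_int (t * n) :: complex)"
    using arg_cong[OF st, of complex_of_int] by (simp add: algebra_simps)
  ultimately have "1 / (of_int t * of_int n) \<in> A" by simp
  moreover have "t \<noteq> 0"
  proof
    assume "t = 0"
    hence "1 = complex_of_nat p * of_int s" using eq by simp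
    thus False using p_mult_neq_1[of "of_int s"] by simp
  qed
  ultimately have "of_int t * (1 / (of_int t * of_int n)) \<in> A" by (intro mult) auto
  thus ?thesis using \<open>t \<noteq> 0\<close> by simp
qed

text \<open>On all complex numbers the valuation of A need not have rank one; this lemma makes it
  real-valued on the algebraic ones. If x is not in A, then 1/x is, and an equation for x over the
  integers with leading coefficient a gives a x as a polynomial in 1/x, hence in A; the part of a
  prime to p is a unit.\<close>

lemma algebraic_imp_power_mult_in:
  assumes "algebraic x"
  shows "\<exists>k. of_nat p ^ k * x \<in> A"
proof (cases "x \<in> A")
  case True
  thus ?thesis by (intro exI[of _ 0]) simp
next
  case False
  hence x: "1 / x \<in> A" "x \<noteq> 0" using valuation_ring by force+
  obtain f where f: "\<And>i. coeff f i \<in> \<int>" "f \<noteq> 0" "poly f x = 0"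
    using assms by (auto simp: algebraic_def)
  obtain a0 h where h: "reflect_poly f = pCons a0 h" by (cases "reflect_poly f")
  have "a0 = lead_coeff f" using h by (metis coeff_0_reflect_poly coeff_pCons_0)
  with f obtain a where a: "a0 = of_int a" "a \<noteq> 0"
    by (metis Ints_cases leading_coeff_0_iff of_int_0)
  have "coeff (reflect_poly f) i \<in> A" for i
    using f(1) by (auto simp: coeff_reflect_poly elim!: Ints_cases[OF f(1)])
       (metis Ints_cases f(1) of_int)
  hence "over A h" using h by (metis over_def over_pCons)
  moreover have "poly (reflect_poly f) (1 / x) = 0"
  proof -
    have "poly (reflect_poly f) (1 / x) = (1 / x) ^ degree f * poly f x"
      using x(2) by (simp add: poly_reflect_poly_nz)
    thus ?thesis using f by simp
  qed
  hence "a0 * x = - poly h (1 / x)" using x(2) by (simp add: h field_simps add_eq_0_iff)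
  ultimately have ax: "of_int a * x \<in> A" using a x(1) poly_in by auto
  obtain k u where ku: "a = int p ^ k * u" "\<not> int p dvd u"
    using multiplicity_decompose'[of a "int p"] a(2) prime by (metis not_prime_unit prime_nat_int_transfer)
  have "1 / of_int u * (of_int a * x) \<in> A" by (rule mult[OF coprime_int_unit[OF ku(2)] ax])
  moreover have "u \<noteq> 0" using ku by auto
  hence "1 / of_int u * (of_int a * x) = of_nat p ^ k * x" by (simp add: ku field_simps)
  ultimately show ?thesis by auto
qed

text \<open>Says, for b > 0, that the valuation of x, normalised to 1 at p, is at least a/b.
  Comparison with fractions needs neither a value group nor roots of p. Since A contains z as soon
  as it contains a power z^k with k > 0, only the quotient a/b matters.\<close>

definition ge :: "complex \<Rightarrow> int \<Rightarrow> nat \<Rightarrow> bool" where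
  "ge x a b \<longleftrightarrow> x ^ b * of_nat p powi (- a) \<in> A"

lemma ge_scale:
  assumes "k > 0"
  shows "ge x (a * int k) (b * k) \<longleftrightarrow> ge x a b"
proof -
  have "x ^ (b * k) * complex_of_nat p powi (- (a * int k)) = (x ^ b * of_nat p powi (- a)) ^ k"
    by (simp add: power_mult power_mult_distrib power_int_mult flip: mult_minus_left)
  thus ?thesis unfolding ge_def using power_in_imp[OF _ assms] power by metis
qed

lemma powi_in: "i \<ge> 0 \<Longrightarrow> of_nat p powi i \<in> A"
  by (auto simp: power_int_def)

lemma powi_not_in:
  assumes "i < 0"
  shows "of_nat p powi i \<notin> A"
proof
  assume "of_nat p powi i \<in> A"
  hence "of_nat p powi i * of_nat p powi (- 1 - i) \<in> A" using assms powi_in by auto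
  also have "of_nat p powi i * of_nat p powi (- 1 - i) = 1 / complex_of_nat p"
    by (simp add: power_int_minus field_simps flip: power_int_add)
  finally show False using not_in by simp
qed

lemma ge_mono:
  assumes "ge x a b" "b > 0" "b' > 0" "a' * int b \<le> a * int b'"
  shows "ge x a' b'"
proof -
  have "x ^ (b * b') * of_nat p powi (- (a * int b')) \<in> A"
    using ge_scale[OF assms(3), of x a b] assms(1) by (simp add: ge_def)
  moreover have "of_nat p powi (a * int b' - a' * int b) \<in> A" using assms(4) by (intro powi_in) auto
  ultimately have "x ^ (b * b') * of_nat p powi (- (a * int b'))
      * of_nat p powi (a * int b' - a' * int b) \<in> A" by auto
  also have "x ^ (b * b') * of_nat p powi (- (a * int b')) * of_nat p powi (a * int b' - a' * int b)
      = x ^ (b * b') * of_nat p powi (- (a' * int b))"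
    by (simp add: mult.assoc flip: power_int_add)
  finally have "ge x (a' * int b) (b' * b)"
    by (simp add: ge_def mult.commute)
  thus ?thesis using ge_scale[OF assms(2)] by blast
qed

lemma ge_mult:
  assumes "ge x a b" "ge y a' b'" "b > 0" "b' > 0"
  shows "ge (x * y) (a * int b' + a' * int b) (b * b')"
proof -
  have "ge x (a * int b') (b * b')" "ge y (a' * int b) (b' * b)"
    using ge_scale assms by auto
  hence "(x ^ (b * b') * of_nat p powi (- (a * int b'))) *
      (y ^ (b' * b) * of_nat p powi (- (a' * int b))) \<in> A"
    unfolding ge_def by (rule mult)
  also have "(x ^ (b * b') * of_nat p powi (- (a * int b'))) *
      (y ^ (b' * b) * of_nat p powi (- (a' * int b))) =
      (x * y) ^ (b * b') * (of_nat p powi (- (a * int b')) * of_nat p powi (- (a' * int b)))"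
    by (simp add: power_mult_distrib mult_ac)
  also have "of_nat p powi (- (a * int b')) * of_nat p powi (- (a' * int b)) =
      (of_nat p powi (- (a * int b' + a' * int b)) :: complex)"
    by (simp flip: power_int_add)
  finally show ?thesis unfolding ge_def .
qed

lemma not_ge_inverse:
  assumes "\<not> ge x a b"
  shows "ge (inverse x) (- a) b"
proof -
  have "inverse (x ^ b * of_nat p powi (- a)) \<in> A"
    using assms valuation_ring[of "x ^ b * of_nat p powi (- a)"]
    by (simp add: ge_def inverse_eq_divide)
  thus ?thesis by (simp add: ge_def power_int_minus power_inverse)
qed

lemma ge_1: "ge 1 a b \<longleftrightarrow> a \<le> 0"
  using powi_in[of "- a"] powi_not_in[of "- a"] by (cases "a \<le> 0") (auto simp: ge_def)

text \<open>The ultrametric inequality: x/y or y/x lies in A, and in the first case x + y is y times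
  an element of A.\<close>

lemma ge_add:
  assumes "ge x a b" "ge y a b"
  shows "ge (x + y) a b"
proof -
  have *: "ge (x + y) a b" if "ge x a b" "y \<noteq> 0" "x / y \<in> A" "ge y a b" for x y
  proof -
    have "(x / y + 1) ^ b * (y ^ b * of_nat p powi (- a)) \<in> A"
      using that unfolding ge_def by (intro mult[OF power[OF add[OF _ one]]])
    also have "(x / y + 1) ^ b * (y ^ b * of_nat p powi (- a)) = ((x / y + 1) * y) ^ b * of_nat p powi (- a)"
      by (simp add: power_mult_distrib)
    also have "(x / y + 1) * y = x + y" using that by (simp add: field_simps)
    finally show ?thesis by (simp add: ge_def)
  qed
  show ?thesis
  proof (cases "x = 0 \<or> y = 0")
    case False
    have "x / y \<in> A \<or> y / x \<in> A" using valuation_ring[of "x / y"] by simp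
    thus ?thesis using *[of x y] *[of y x] assms False by (auto simp: add.commute)
  qed (use assms in auto)
qed

text \<open>The cut determined by \<open>ge\<close>. For non-zero algebraic x the set is non-empty
  and bounded above; for x = 0 it contains every fraction, so the absolute value treats 0
  apart.\<close>

definition val :: "complex \<Rightarrow> real" where
  "val x = Sup {real_of_int a / real b |a b. b > 0 \<and> ge x a b}"

lemma ge_bounds:
  assumes "algebraic x" "x \<noteq> 0"
  shows "\<exists>k. ge x k 1" "\<exists>k::nat. \<forall>a b. b > 0 \<longrightarrow> ge x a b \<longrightarrow> real_of_int a / real b \<le> k"
proof -
  obtain k where "of_nat p ^ k * x \<in> A" using algebraic_imp_power_mult_in assms by blast
  hence "ge x (- int k) 1" by (simp add: ge_def mult.commute)
  thus "\<exists>k. ge x k 1" ..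
  obtain k where "of_nat p ^ k * inverse x \<in> A"
    using algebraic_imp_power_mult_in[of "inverse x"] assms by auto
  hence k: "ge (inverse x) (- int k) 1" by (simp add: ge_def mult.commute)
  have "real_of_int a / real b \<le> k" if "b > 0" "ge x a b" for a b
  proof -
    have "ge 1 (a * int 1 + - int k * int b) (b * 1)"
      using ge_mult[OF that(2) k that(1)] assms by simp
    hence "a \<le> int k * int b" by (simp add: ge_1)
    hence "real_of_int a \<le> real k * real b" by (metis of_int_le_iff of_int_mult of_int_of_nat_eq)
    thus ?thesis using that(1) by (simp add: field_simps)
  qed
  thus "\<exists>k::nat. \<forall>a b. b > 0 \<longrightarrow> ge x a b \<longrightarrow> real_of_int a / real b \<le> k" by blast
qed

lemma le_val:
  assumes "algebraic x" "x \<noteq> 0" "ge x a b" "b > 0"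
  shows "real_of_int a / real b \<le> val x"
  unfolding val_def
proof (rule cSup_upper)
  show "bdd_above {real_of_int a / real b |a b. b > 0 \<and> ge x a b}"
    using ge_bounds(2)[OF assms(1,2)] by (auto simp: bdd_above_def)
qed (use assms in blast)

text \<open>Strictness spares the question whether the supremum is attained.\<close>

lemma less_val:
  assumes "algebraic x" "x \<noteq> 0" "real_of_int a / real b < val x" "b > 0"
  shows "ge x a b"
proof -
  let ?S = "{real_of_int a / real b |a b. b > 0 \<and> ge x a b}"
  obtain k where "ge x k 1" using ge_bounds(1)[OF assms(1,2)] by blast
  hence "real_of_int k / real 1 \<in> ?S" by blast
  hence "?S \<noteq> {}" by blast
  then obtain a' b' where ab: "real_of_int a / real b < real_of_int a' / real b'" "b' > 0" "ge x a' b'"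
    using less_cSupD[of ?S] assms(3) unfolding val_def by blast
  have "real_of_int a * real b' \<le> real_of_int a' * real b" using ab assms by (simp add: field_simps)
  hence "a * int b' \<le> a' * int b" by (metis of_int_le_iff of_int_mult of_int_of_nat_eq)
  thus ?thesis using ge_mono[OF ab(3) ab(2) assms(4)] by blast
qed

lemma between_rat:
  assumes "r < (s :: real)"
  obtains a b where "r < real_of_int a / real b" "real_of_int a / real b < s" "b > 0"
proof -
  obtain q where q: "q \<in> \<rat>" "r < q" "q < s" using Rats_dense_in_real[OF assms] by blast
  from q(1) obtain a b where "b > 0" "q = of_int a / of_int b" by (rule Rats_cases')
  thus ?thesis using that[of a "nat b"] q by auto
qed

lemma val_mult_ge:
  assumes "algebraic x" "x \<noteq> 0" "algebraic y" "y \<noteq> 0"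
  shows "val x + val y \<le> val (x * y)"
proof (rule ccontr)
  assume "\<not> ?thesis"
  \<comment> \<open>Each valuation is approximated to within half of the supposed deficit.\<close>
  hence less: "val x - (val x + val y - val (x * y)) / 2 < val x"
    "val y - (val x + val y - val (x * y)) / 2 < val y" by auto
  obtain a b where ab: "val x - (val x + val y - val (x * y)) / 2 < real_of_int a / real b"
    "real_of_int a / real b < val x" "b > 0" using between_rat[OF less(1)] by blast
  obtain a' b' where ab': "val y - (val x + val y - val (x * y)) / 2 < real_of_int a' / real b'"
    "real_of_int a' / real b' < val y" "b' > 0" using between_rat[OF less(2)] by blast
  have "ge (x * y) (a * int b' + a' * int b) (b * b')"
    using ab ab' assms less_val by (intro ge_mult) auto
  hence "real_of_int (a * int b' + a' * int b) / real (b * b') \<le> val (x * y)"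
    using assms ab ab' by (intro le_val algebraic_mult) auto
  moreover have "real_of_int (a * int b' + a' * int b) / real (b * b') = real_of_int a / real b + real_of_int a' / real b'"
    using ab(3) ab'(3) by (simp add: field_simps)
  ultimately have "real_of_int a / real b + real_of_int a' / real b' \<le> val (x * y)" by argo
  with ab(1) ab'(1) show False by argo
qed

lemma val_1: "val 1 = 0"
proof (rule antisym)
  show "val 1 \<le> 0"
  proof (rule ccontr)
    assume "\<not> val 1 \<le> 0"
    then obtain a b where ab: "0 < real_of_int a / real b" "real_of_int a / real b < val 1" "b > 0"
      using between_rat[of 0 "val 1"] by auto
    hence "a \<le> 0" using less_val[of 1 a b] by (auto simp: ge_1)
    thus False using ab by (simp add: zero_less_divide_iff)
  qed
  show "0 \<le> val 1" using le_val[of 1 0 1] by (simp add: ge_1)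
qed

text \<open>Where \<open>ge\<close> fails for x, it holds for the inverse with the opposite bound,
  because A is a valuation ring; so no gap remains between the two suprema.\<close>

lemma val_inverse:
  assumes "algebraic x" "x \<noteq> 0"
  shows "val (inverse x) = - val x"
proof (rule antisym)
  have inv: "algebraic (inverse x)" "inverse x \<noteq> 0" using assms by auto
  show "val (inverse x) \<le> - val x"
    using val_mult_ge[OF assms inv] assms(2) by (simp add: val_1)
  show "- val x \<le> val (inverse x)"
  proof (rule ccontr)
    assume "\<not> - val x \<le> val (inverse x)"
    then obtain a b where ab: "val x < real_of_int a / real b" "real_of_int a / real b < - val (inverse x)" "b > 0"
      using between_rat[of "val x" "- val (inverse x)"] by auto
    hence "\<not> ge x a b" using le_val[OF assms] by force
    hence "real_of_int (- a) / real b \<le> val (inverse x)"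
      using le_val[OF inv not_ge_inverse ab(3)] by blast
    thus False using ab by simp
  qed
qed

lemma val_mult:
  assumes "algebraic x" "x \<noteq> 0" "algebraic y" "y \<noteq> 0"
  shows "val (x * y) = val x + val y"
proof (rule antisym)
  have "val (x * y) + val (inverse y) \<le> val (x * y * inverse y)"
    using assms by (intro val_mult_ge algebraic_mult algebraic_inverse) auto
  moreover have "x * y * inverse y = x" using assms by simp
  ultimately show "val (x * y) \<le> val x + val y" using assms by (simp add: val_inverse)
qed (use val_mult_ge assms in blast)

lemma val_add:
  assumes "algebraic x" "x \<noteq> 0" "algebraic y" "y \<noteq> 0" "x + y \<noteq> 0"
  shows "min (val x) (val y) \<le> val (x + y)"
proof (rule ccontr)
  assume "\<not> ?thesis"
  hence less: "val (x + y) < min (val x) (val y)" by (rule not_le_imp_less)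
  obtain a b where ab: "val (x + y) < real_of_int a / real b"
    "real_of_int a / real b < min (val x) (val y)" "b > 0" by (rule between_rat[OF less])
  hence "ge (x + y) a b" using assms less_val by (intro ge_add) auto
  hence "real_of_int a / real b \<le> val (x + y)"
    using assms ab(3) by (intro le_val algebraic_add) auto
  thus False using ab(1) by simp
qed

lemma val_p: "val (of_nat p) = 1"
proof (rule antisym)
  have geiff: "ge (of_nat p) a b \<longleftrightarrow> a \<le> int b" for a b
  proof -
    have "complex_of_nat p ^ b * of_nat p powi (- a) = of_nat p powi (int b - a)"
      by (simp add: power_int_diff power_int_minus_divide p_nz)
    thus ?thesis using powi_in[of "int b - a"] powi_not_in[of "int b - a"] unfolding ge_def
      by (cases "a \<le> int b") auto
  qed
  have alg: "algebraic (complex_of_nat p)" by (intro rat_imp_algebraic) auto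
  show "1 \<le> val (of_nat p)" using le_val[OF alg p_nz(1), of 1 1] geiff by auto
  show "val (of_nat p) \<le> 1"
  proof (rule ccontr)
    assume "\<not> val (of_nat p) \<le> 1"
    then obtain a b where ab: "1 < real_of_int a / real b" "real_of_int a / real b < val (of_nat p)" "b > 0"
      using between_rat[of 1 "val (of_nat p)"] by auto
    hence "a \<le> int b" using less_val[OF alg p_nz(1)] geiff by blast
    thus False using ab by (simp add: field_simps)
  qed
qed

lemma val_nonneg:
  assumes "algebraic x" "x \<noteq> 0" "x \<in> A"
  shows "0 \<le> val x"
  using le_val[of x 0 1] assms by (simp add: ge_def)

end

text \<open>The rules for sums and products are demanded of algebraic numbers only, since the
  valuation is shown to be real-valued only there.\<close>

definition is_padic_abs :: "nat \<Rightarrow> (complex \<Rightarrow> real) \<Rightarrow> bool" where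
  "is_padic_abs p N \<longleftrightarrow> N 0 = 0 \<and> (\<forall>x. x \<noteq> 0 \<longrightarrow> N x > 0) \<and>
     (\<forall>x y. algebraic x \<longrightarrow> algebraic y \<longrightarrow> N (x * y) = N x * N y \<and> N (x + y) \<le> max (N x) (N y)) \<and>
     (\<forall>n::int. N (of_int n) \<le> 1 \<and> (\<not> int p dvd n \<longrightarrow> N (of_int n) = 1)) \<and>
     N (of_nat p) = 1 / real p"

lemma ex_padic_abs:
  assumes "prime p"
  shows "\<exists>N. is_padic_abs p N"
proof -
  obtain A where "padic_ring A p" using ex_padic_ring[OF assms] by blast
  then interpret padic_ring A p .
  define N where "N x = (if x = 0 then 0 else real p powr (- val x))" for x
  have p: "real p > 1" using prime_gt_1_nat[OF assms] by simp
  have N_add: "N (x + y) \<le> max (N x) (N y)" if "algebraic x" "algebraic y" for x y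
  proof (cases "x = 0 \<or> y = 0 \<or> x + y = 0")
    case False
    hence "val x \<le> val (x + y) \<or> val y \<le> val (x + y)" using val_add[of x y] that by linarith
    thus ?thesis using False p by (auto simp: N_def le_max_iff_disj)
  qed (auto simp: N_def le_max_iff_disj)
  have alg: "algebraic (complex_of_int n)" for n by (intro rat_imp_algebraic) auto
  have N_int: "N (of_int n) \<le> 1" for n
    using val_nonneg[OF alg, of n] p powr_mono[of "- val (of_int n)" 0 "real p"] by (auto simp: N_def)
  have N_unit: "N (of_int n) = 1" if "\<not> int p dvd n" for n
  proof -
    have n: "n \<noteq> 0" using that by auto
    have "0 \<le> val (of_int n)" by (rule val_nonneg) (use n alg in auto)
    moreover have "0 \<le> val (inverse (of_int n))"
      using coprime_int_unit[OF that] n by (intro val_nonneg algebraic_inverse alg) (auto simp: inverse_eq_divide)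
    ultimately have "val (of_int n) = 0" using n alg by (simp add: val_inverse)
    thus ?thesis using n p by (simp add: N_def)
  qed
  have "is_padic_abs p N"
    unfolding is_padic_abs_def using N_add N_int N_unit p
    by (auto simp: N_def val_mult powr_add val_p powr_minus_divide powr_diff field_simps)
  thus ?thesis by blast
qed

definition padic_abs :: "nat \<Rightarrow> complex \<Rightarrow> real" where
  "padic_abs p = (SOME N. is_padic_abs p N)"

lemma is_padic_abs_padic_abs: "prime p \<Longrightarrow> is_padic_abs p (padic_abs p)"
  unfolding padic_abs_def using ex_padic_abs someI_ex by metis

section \<open>Gauss norms and the product formula over the rationals\<close>

context
  fixes p :: nat
  assumes p: "prime p"
begin

lemma padic_abs_0 [simp]: "padic_abs p 0 = 0"
  and padic_abs_pos: "x \<noteq> 0 \<Longrightarrow> padic_abs p x > 0"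
  and padic_abs_mult: "algebraic x \<Longrightarrow> algebraic y \<Longrightarrow> padic_abs p (x * y) = padic_abs p x * padic_abs p y"
  and padic_abs_add: "algebraic x \<Longrightarrow> algebraic y \<Longrightarrow> padic_abs p (x + y) \<le> max (padic_abs p x) (padic_abs p y)"
  and padic_abs_of_int_le: "padic_abs p (of_int n) \<le> 1"
  and padic_abs_of_int: "\<not> int p dvd n \<Longrightarrow> padic_abs p (of_int n) = 1"
  and padic_abs_p: "padic_abs p (of_nat p) = 1 / real p"
  using is_padic_abs_padic_abs[OF p] unfolding is_padic_abs_def by blast+

lemma padic_abs_nonneg: "padic_abs p x \<ge> 0"
  using padic_abs_pos[of x] by (cases "x = 0") auto

lemma padic_abs_1 [simp]: "padic_abs p 1 = 1"
  using padic_abs_of_int[of 1] p by (simp add: prime_nat_iff)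

lemma padic_abs_uminus:
  assumes "algebraic x"
  shows "padic_abs p (- x) = padic_abs p x"
proof -
  have "\<not> int p dvd - 1" using p by (simp add: prime_nat_iff)
  from padic_abs_of_int[OF this] have "padic_abs p (- 1) = 1" by simp
  moreover have "algebraic (- 1 :: complex)" by (intro rat_imp_algebraic) auto
  ultimately show ?thesis using padic_abs_mult[of "- 1" x] assms by simp
qed

lemma padic_abs_add_eq:
  assumes "algebraic x" "algebraic y" "padic_abs p y < padic_abs p x"
  shows "padic_abs p (x + y) = padic_abs p x"
proof -
  have "padic_abs p (x + y + - y) \<le> max (padic_abs p (x + y)) (padic_abs p (- y))"
    using assms by (intro padic_abs_add algebraic_add) auto
  thus ?thesis using padic_abs_add[OF assms(1,2)] padic_abs_uminus[OF assms(2)] assms(3)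
    by (simp add: max_def split: if_splits)
qed

lemma padic_abs_prod_mset:
  assumes "\<And>x. x \<in># M \<Longrightarrow> algebraic x"
  shows "algebraic (prod_mset M) \<and> padic_abs p (prod_mset M) = (\<Prod>x\<in>#M. padic_abs p x)"
  using assms
proof (induction M)
  case empty
  show ?case by (auto intro: rat_imp_algebraic)
next
  case (add x M)
  thus ?case by (auto simp: padic_abs_mult intro: algebraic_mult)
qed

lemma padic_abs_power: "algebraic x \<Longrightarrow> padic_abs p (x ^ n) = padic_abs p x ^ n"
  using padic_abs_prod_mset[of "replicate_mset n x"] by (cases "n = 0") auto

text \<open>The Gauss norm as a relation; written as a maximum it would range over an infinite index
  set.\<close>

definition gauss_norm_is :: "complex poly \<Rightarrow> real \<Rightarrow> bool" where
  "gauss_norm_is f G \<longleftrightarrow> (\<forall>i. padic_abs p (coeff f i) \<le> G) \<and> (\<exists>i. padic_abs p (coeff f i) = G)"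

text \<open>Gauss's lemma for a linear factor. Some coefficient c_(i-1) - z c_i must have absolute
  value exactly max(1, |z|) G. If |z| <= 1, let i - 1 be the last index at which f attains G,
  otherwise let i be the first one; then one of the two terms strictly dominates the other.\<close>

lemma gauss_norm_linear_mult:
  assumes f: "\<And>i. algebraic (coeff f i)" and z: "algebraic z"
    and G: "gauss_norm_is f G" "G > 0"
  shows "gauss_norm_is ([:- z, 1:] * f) (max 1 (padic_abs p z) * G)"
proof -
  let ?N = "padic_abs p"
  let ?c = "coeff f"
  have c0: "coeff ([:- z, 1:] * f) 0 = - (z * ?c 0)" by simp
  have cS: "coeff ([:- z, 1:] * f) (Suc i) = ?c i + - (z * ?c (Suc i))" for i by simp
  have le: "?N (?c i) \<le> G" for i using G by (simp add: gauss_norm_is_def)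
  have algz: "algebraic (z * ?c i)" "algebraic (- (z * ?c i))" for i
    using f z algebraic_mult by auto
  have Nz: "?N (- (z * ?c i)) = ?N z * ?N (?c i)" for i
    using f z algz by (simp add: padic_abs_uminus padic_abs_mult)
  have Nz_le: "?N z * ?N (?c i) \<le> max 1 (?N z) * G" for i
    using le[of i] padic_abs_nonneg by (intro mult_mono) (auto intro: order_trans)
  have G_le: "G \<le> max 1 (?N z) * G" using G(2) by simp
  have "?N (coeff ([:- z, 1:] * f) i) \<le> max 1 (?N z) * G" for i
  proof (cases i)
    case 0
    thus ?thesis using Nz_le[of 0] by (simp only: c0 Nz)
  next
    case (Suc j)
    have "?N (?c j + - (z * ?c (Suc j))) \<le> max (?N (?c j)) (?N (- (z * ?c (Suc j))))"
      using f algz by (intro padic_abs_add)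
    also have "\<dots> \<le> max 1 (?N z) * G" using le[of j] G_le Nz_le[of "Suc j"] by (simp add: Nz)
    finally show ?thesis by (simp only: Suc cS)
  qed
  moreover have "\<exists>i. ?N (coeff ([:- z, 1:] * f) i) = max 1 (?N z) * G"
  proof (cases "?N z \<le> 1")
    case True
    define I where "I = {i. ?N (?c i) = G}"
    have "I \<subseteq> {..degree f}" unfolding I_def using G(2) by (auto intro!: le_degree)
    hence fin: "finite I" by (rule finite_subset) simp
    have "I \<noteq> {}" using G(1) unfolding I_def gauss_norm_is_def by blast
    define i where "i = Max I"
    have "i \<in> I" unfolding i_def by (rule Max_in[OF fin \<open>I \<noteq> {}\<close>])
    moreover have "Suc i \<notin> I" using Max_ge[OF fin, of "Suc i"] unfolding i_def by linarith
    ultimately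
    have i: "?N (?c i) = G" "?N (?c (Suc i)) < G" using le[of "Suc i"] by (auto simp: I_def)
    have "?N z * ?N (?c (Suc i)) \<le> 1 * ?N (?c (Suc i))"
      using True padic_abs_nonneg by (intro mult_right_mono)
    hence "?N (?c i + - (z * ?c (Suc i))) = ?N (?c i)"
      using i f algz by (intro padic_abs_add_eq) (auto simp: Nz)
    hence "?N (coeff ([:- z, 1:] * f) (Suc i)) = max 1 (?N z) * G"
      using i True by (simp only: cS) simp
    thus ?thesis by blast
  next
    case False
    define i where "i = (LEAST i. ?N (?c i) = G)"
    have i: "?N (?c i) = G" unfolding i_def using G by (metis (mono_tags) LeastI gauss_norm_is_def)
    show ?thesis
    proof (cases i)
      case 0
      have "?N (coeff ([:- z, 1:] * f) 0) = max 1 (?N z) * G"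
        using i[unfolded 0] False by (simp add: Nz)
      thus ?thesis by blast
    next
      case (Suc j)
      have "?N (?c j) \<noteq> G" using not_less_Least[of j "\<lambda>i. ?N (?c i) = G"] Suc i_def by auto
      hence "?N (?c j) < G" using le[of j] by simp
      also have "G \<le> ?N z * G" using False G(2) by simp
      also have "\<dots> = ?N (- (z * ?c i))" by (simp only: Nz i)
      finally have "?N (- (z * ?c i) + ?c j) = ?N (- (z * ?c i))"
        using f algz by (intro padic_abs_add_eq)
      hence "?N (coeff ([:- z, 1:] * f) i) = max 1 (?N z) * G"
        using False by (simp only: Suc cS add.commute Nz i[unfolded Suc])
      thus ?thesis by blast
    qed
  qed
  ultimately show ?thesis unfolding gauss_norm_is_def by blast
qed

lemma gauss_norm_prod:
  assumes "\<And>z. z \<in># M \<Longrightarrow> algebraic z"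
  shows "(\<forall>i. algebraic (coeff (\<Prod>z\<in>#M. [:- z, 1:]) i)) \<and>
    gauss_norm_is (\<Prod>z\<in>#M. [:- z, 1:]) (\<Prod>z\<in>#M. max 1 (padic_abs p z))"
  using assms
proof (induction M)
  case empty
  show ?case by (auto simp: gauss_norm_is_def coeff_1 intro: rat_imp_algebraic)
next
  case (add z M)
  let ?f = "\<Prod>z\<in>#M. [:- z, 1:]"
  have IH: "\<And>i. algebraic (coeff ?f i)" "gauss_norm_is ?f (\<Prod>z\<in>#M. max 1 (padic_abs p z))"
    and z: "algebraic z" using add by auto
  have "(\<Prod>z\<in>#M. max 1 (padic_abs p z)) > 0"
    by (induction M) auto
  from gauss_norm_linear_mult[OF IH(1) z IH(2) this]
  have "gauss_norm_is ([:- z, 1:] * ?f) (max 1 (padic_abs p z) * (\<Prod>z\<in>#M. max 1 (padic_abs p z)))" .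
  moreover have "algebraic (coeff ([:- z, 1:] * ?f) i)" for i
  proof (cases i)
    case (Suc j)
    have "algebraic (coeff ?f j + - (z * coeff ?f i))"
      using IH(1) z by (intro algebraic_add algebraic_minus algebraic_mult)
    thus ?thesis by (simp add: Suc)
  qed (use IH(1) z algebraic_mult in auto)
  ultimately show ?case by simp
qed

text \<open>The left side is the Gauss norm of q, by multiplicativity, and an irreducible polynomial
  of positive degree is primitive. The formula turns the leading coefficient in the Weil height into
  contributions of the primes.\<close>

lemma padic_mahler:
  fixes q :: "int poly"
  assumes q: "irreducible q" "degree q > 0"
  shows "padic_abs p (of_int (lead_coeff q)) *
    (\<Prod>z\<in>#proots (map_poly complex_of_int q). max 1 (padic_abs p z)) = 1"
proof -
  let ?q = "map_poly complex_of_int q"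
  let ?f = "\<Prod>z\<in>#proots ?q. [:- z, 1:]"
  let ?G = "\<Prod>z\<in>#proots ?q. max 1 (padic_abs p z)"
  let ?a = "complex_of_int (lead_coeff q)"
  have deg: "degree ?q = degree q" by (rule degree_map_poly) auto
  have "?q \<noteq> 0" using q(2) deg by auto
  have alg: "algebraic z" if "z \<in># proots ?q" for z
    using that \<open>?q \<noteq> 0\<close> by (intro algebraicI[of ?q]) (auto simp: coeff_map_poly)
  have eq: "?q = smult ?a ?f"
    using complex_poly_decompose_multiset[of ?q] deg by (simp add: coeff_map_poly)
  have f: "\<And>i. algebraic (coeff ?f i)" "gauss_norm_is ?f ?G"
    using gauss_norm_prod[of "proots ?q"] alg by auto
  have alg_a: "algebraic ?a" by (intro rat_imp_algebraic) auto
  have coeff: "padic_abs p (of_int (coeff q i)) = padic_abs p ?a * padic_abs p (coeff ?f i)" for i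
  proof -
    have "complex_of_int (coeff q i) = coeff ?q i" by (simp add: coeff_map_poly)
    also have "\<dots> = ?a * coeff ?f i" by (subst eq) simp
    finally show ?thesis using alg_a f(1) by (simp add: padic_abs_mult)
  qed
  obtain i where "padic_abs p (coeff ?f i) = ?G" using f(2) by (auto simp: gauss_norm_is_def)
  hence "padic_abs p ?a * ?G \<le> 1" using coeff[of i] padic_abs_of_int_le[of "coeff q i"] by simp
  have "\<exists>j. \<not> int p dvd coeff q j"
  proof (rule ccontr)
    assume "\<not> ?thesis"
    hence "[:int p:] dvd q" by (simp add: const_poly_dvd_iff)
    then obtain k where k: "q = [:int p:] * k" by (elim dvdE)
    have "\<not> [:int p:] dvd 1" using p by (simp add: is_unit_const_poly_iff prime_nat_iff)
    hence "k dvd 1" using irreducibleD[OF q(1) k] by blast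
    hence "degree k = 0" by (auto simp: is_unit_poly_iff)
    hence "degree q = 0" by (simp add: k)
    with q(2) show False by simp
  qed
  then obtain j where "\<not> int p dvd coeff q j" ..
  hence "1 = padic_abs p ?a * padic_abs p (coeff ?f j)" using coeff[of j] padic_abs_of_int by metis
  also have "\<dots> \<le> padic_abs p ?a * ?G"
    using f(2) by (intro mult_left_mono padic_abs_nonneg) (simp add: gauss_norm_is_def)
  finally have "1 \<le> padic_abs p ?a * ?G" .
  with \<open>padic_abs p ?a * ?G \<le> 1\<close> show ?thesis by (rule antisym)
qed

lemma padic_abs_int:
  assumes "n \<noteq> 0"
  shows "ln (padic_abs p (of_int n)) = - real (multiplicity p (nat \<bar>n\<bar>)) * ln (real p)"
proof -
  obtain k where k: "nat \<bar>n\<bar> = p ^ multiplicity p (nat \<bar>n\<bar>) * k" "\<not> p dvd k"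
    using multiplicity_decompose'[of "nat \<bar>n\<bar>" p] assms p not_prime_unit[of p]
    by (metis nat_0_iff abs_le_zero_iff)
  define e where "e = multiplicity p (nat \<bar>n\<bar>)"
  have "\<bar>n\<bar> = int p ^ e * int k" using arg_cong[OF k(1), of int] by (simp add: e_def)
  moreover define u where "u = sgn n * int k"
  ultimately have n: "n = int p ^ e * u" by (metis mult.commute mult.left_commute mult_sgn_abs)
  have "\<not> int p dvd u" using k(2) assms by (auto simp: u_def sgn_if)
  hence u: "padic_abs p (of_int u) = 1" by (rule padic_abs_of_int)
  have alg: "algebraic (complex_of_int m)" "algebraic (complex_of_nat k)" for m k
    by (auto intro!: rat_imp_algebraic)
  have "complex_of_int n = of_nat p ^ e * of_int u" by (simp add: n)
  hence "padic_abs p (of_int n) = (1 / real p) ^ e"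
    using alg u by (metis (no_types, opaque_lifting) mult.right_neutral of_nat_power padic_abs_mult padic_abs_p padic_abs_power)
  thus ?thesis using p prime_gt_0_nat by (simp add: ln_realpow ln_div e_def)
qed

end

lemma product_formula_int:
  fixes n :: int
  assumes "n \<noteq> 0" "finite T" "\<And>q. q \<in> T \<Longrightarrow> prime q" "prime_factors (nat \<bar>n\<bar>) \<subseteq> T"
  shows "(\<Sum>q\<in>T. ln (padic_abs q (of_int n))) = - ln (real_of_int \<bar>n\<bar>)"
proof -
  let ?m = "nat \<bar>n\<bar>"
  have m: "?m \<noteq> 0" using assms by simp
  have "real_of_int \<bar>n\<bar> = real ?m" by simp
  also have "\<dots> = real (\<Prod>q\<in>prime_factors ?m. q ^ multiplicity q ?m)"
    using prod_prime_factors[OF m] by simp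
  also have "\<dots> = (\<Prod>q\<in>prime_factors ?m. real q ^ multiplicity q ?m)" by simp
  also have "(\<Prod>q\<in>prime_factors ?m. real q ^ multiplicity q ?m) = (\<Prod>q\<in>T. real q ^ multiplicity q ?m)"
  proof (rule prod.mono_neutral_left[OF assms(2,4)], intro ballI)
    fix q assume "q \<in> T - prime_factors ?m"
    hence "\<not> q dvd ?m" using assms(3) m by (auto simp: prime_factors_dvd)
    thus "real q ^ multiplicity q ?m = 1" by (simp add: not_dvd_imp_multiplicity_0)
  qed
  also have "ln (\<Prod>q\<in>T. real q ^ multiplicity q ?m) = (\<Sum>q\<in>T. ln (real q ^ multiplicity q ?m))"
    using assms(2,3) prime_gt_0_nat by (subst ln_prod) auto
  also have "\<dots> = - (\<Sum>q\<in>T. ln (padic_abs q (of_int n)))"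
    unfolding sum_negf[symmetric] using assms(1,3) prime_gt_0_nat
    by (intro sum.cong) (auto simp: padic_abs_int ln_realpow)
  finally show ?thesis by simp
qed

lemma product_formula_rat:
  fixes x :: complex
  assumes "x \<in> \<rat>" "x \<noteq> 0"
  obtains T0 where "finite T0" "\<And>q. q \<in> T0 \<Longrightarrow> prime q"
    "\<And>T. finite T \<Longrightarrow> (\<And>q. q \<in> T \<Longrightarrow> prime q) \<Longrightarrow> T0 \<subseteq> T \<Longrightarrow>
      (\<Sum>q\<in>T. ln (padic_abs q x)) = - ln (cmod x)"
proof -
  obtain a b where ab: "b > 0" "x = of_int a / of_int b" using assms(1) by (rule Rats_cases')
  hence a: "a \<noteq> 0" using assms(2) by auto
  have alg: "algebraic (complex_of_int m)" for m by (auto intro!: rat_imp_algebraic)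
  show ?thesis
  proof (rule that[of "prime_factors (nat \<bar>a\<bar>) \<union> prime_factors (nat \<bar>b\<bar>)"])
    fix T assume T: "finite T" "\<And>q. q \<in> T \<Longrightarrow> prime q" "prime_factors (nat \<bar>a\<bar>) \<union> prime_factors (nat \<bar>b\<bar>) \<subseteq> T"
    have "ln (padic_abs q x) = ln (padic_abs q (of_int a)) - ln (padic_abs q (of_int b))" if "q \<in> T" for q
    proof -
      have q: "prime q" using T that by blast
      have "padic_abs q x * padic_abs q (of_int b) = padic_abs q (x * of_int b)"
        using assms alg by (intro padic_abs_mult[symmetric] q rat_imp_algebraic[of x])
      also have "x * of_int b = of_int a" using ab by simp
      finally have "ln (padic_abs q (of_int a)) = ln (padic_abs q x * padic_abs q (of_int b))" by simp
      moreover have "padic_abs q x > 0" "padic_abs q (of_int b) > 0"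
        using padic_abs_pos[OF q] assms(2) ab(1) by auto
      ultimately show ?thesis by (simp only: ln_mult_pos)
    qed
    hence "(\<Sum>q\<in>T. ln (padic_abs q x)) =
      (\<Sum>q\<in>T. ln (padic_abs q (of_int a))) - (\<Sum>q\<in>T. ln (padic_abs q (of_int b)))"
      by (simp add: sum_subtractf)
    also have "\<dots> = - ln (real_of_int \<bar>a\<bar>) - - ln (real_of_int \<bar>b\<bar>)"
      using product_formula_int[OF a T(1,2)] product_formula_int[OF _ T(1,2), of b] ab T(3) by simp
    also have "\<dots> = - ln (cmod x)" using a ab by (simp add: norm_divide ln_div)
    finally show "(\<Sum>q\<in>T. ln (padic_abs q x)) = - ln (cmod x)" .
  qed auto
qed

section \<open>Places of a number field\<close>

text \<open>A is the set of archimedean places, each repeated according to its local degree, so that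
  \<open>card A\<close> stands for the degree of the field. Elements of R have absolute value at
  most 1 at the places left out of V; hence the product formula appears as an inequality, which
  becomes an equation for units of R.\<close>

locale places = csubring R for R +
  fixes V A :: "'v set" and ab :: "'v \<Rightarrow> complex \<Rightarrow> real"
  assumes fin: "finite V" and A_subset: "A \<subseteq> V" and A_nonempty: "A \<noteq> {}"
    and algebraic: "x \<in> R \<Longrightarrow> algebraic x"
    and ab_0 [simp]: "v \<in> V \<Longrightarrow> ab v 0 = 0"
    and ab_pos: "v \<in> V \<Longrightarrow> x \<in> R \<Longrightarrow> x \<noteq> 0 \<Longrightarrow> ab v x > 0"
    and ab_mult: "v \<in> V \<Longrightarrow> x \<in> R \<Longrightarrow> y \<in> R \<Longrightarrow> ab v (x * y) = ab v x * ab v y"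
    and triangle: "v \<in> A \<Longrightarrow> x \<in> R \<Longrightarrow> y \<in> R \<Longrightarrow> ab v (x + y) \<le> ab v x + ab v y"
    and ultrametric: "v \<in> V - A \<Longrightarrow> x \<in> R \<Longrightarrow> y \<in> R \<Longrightarrow> ab v (x + y) \<le> max (ab v x) (ab v y)"
    and sum_ln_nonneg: "x \<in> R \<Longrightarrow> x \<noteq> 0 \<Longrightarrow> 0 \<le> (\<Sum>v\<in>V. ln (ab v x))"
    and weil_height_eq: "x \<in> R \<Longrightarrow> weil_height x * card A = (\<Sum>v\<in>V. ln (max 1 (ab v x)))"

section \<open>Minimal integer polynomials and conjugates\<close>

lemma rat_poly_clear_denominators:
  assumes "over \<rat> F"
  obtains c :: int and G :: "int poly" where "c \<noteq> 0" "map_poly of_int G = smult (of_int c) F"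
  using assms
proof (induction F arbitrary: thesis)
  case 0
  show ?case by (rule 0(1)[of 1 0]) auto
next
  case (pCons a F)
  have "over \<rat> F" "a \<in> \<rat>" using pCons.prems(2) by auto
  obtain c G where cG: "c \<noteq> 0" "map_poly of_int G = smult (of_int c) F"
    using pCons.IH[OF _ \<open>over \<rat> F\<close>] by blast
  obtain u v where uv: "v > 0" "a = of_int u / of_int v" using \<open>a \<in> \<rat>\<close> by (rule Rats_cases')
  have "map_poly of_int (smult v G) = smult (of_int v) (map_poly of_int G :: complex poly)"
    by (rule poly_eqI) (simp add: coeff_map_poly)
  hence "map_poly of_int (pCons (c * u) (smult v G)) = smult (of_int (c * v)) (pCons a F)"
    using uv cG(2) by (simp add: map_poly_pCons mult.commute)
  thus ?case using cG uv by (intro pCons.prems(1)[of "c * v"]) auto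
qed

context
  fixes q :: "int poly"
  assumes irred: "irreducible q"
begin

text \<open>This takes the place of Gauss's lemma on contents: after clearing denominators, F has a
  prime factor over the integers that vanishes at z, and uniqueness of the minimal integer
  polynomial identifies that factor with q up to sign.\<close>

lemma irreducible_dvd_rat_poly:
  assumes F: "over \<rat> F" "poly F z = 0" and z: "poly (map_poly of_int q) z = 0"
  shows "map_poly of_int q dvd F"
proof (cases "F = 0")
  case False
  obtain c and G :: "int poly" where cG: "c \<noteq> 0" "map_poly of_int G = smult (of_int c) F"
    using rat_poly_clear_denominators[OF F(1)] by metis
  have "G \<noteq> 0" using False cG by auto
  moreover have "poly (map_poly of_int G) z = 0" using F cG by simp
  ultimately obtain r where r: "prime r" "r dvd G" "poly (map_poly of_int r) z = 0"
    using ex_prime_factor_root by blast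
  have q0: "q \<noteq> 0" using irred by auto
  have "map_poly complex_of_int q \<noteq> 0"
  proof
    assume "map_poly complex_of_int q = 0"
    hence "complex_of_int (coeff q i) = 0" for i by (metis coeff_0 coeff_map_poly of_int_0)
    thus False using q0 by (auto intro: poly_eqI)
  qed
  hence "algebraic z" using z by (intro algebraicI[of "map_poly of_int q"]) (auto simp: coeff_map_poly)
  obtain k where k: "normalize q = q * k" by (metis dvdE dvd_normalize_iff dvd_refl)
  define n where "n = normalize q"
  have "irreducible n" "n \<noteq> 0" "normalize n = n" using irred q0 by (auto simp: n_def)
  moreover have "poly (map_poly of_int n) z = 0"
    unfolding n_def k poly_of_int_mult using z by simp
  ultimately have "irreducible n \<and> lead_coeff n > 0 \<and> poly (map_poly of_int n) z = 0"
    using normalize_int_poly_eq_iff[of n] by blast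
  moreover have "irreducible r \<and> lead_coeff r > 0 \<and> poly (map_poly of_int r) z = 0"
    using r normalize_int_poly_eq_iff[of r] by (auto simp: normalize_prime prime_elem_imp_irreducible)
  ultimately have "n = r" using ex1_min_int_poly[OF \<open>algebraic z\<close>] by blast
  hence "q dvd G" using r(2) normalize_dvd_iff unfolding n_def by metis
  then obtain k where "G = q * k" by (elim dvdE)
  have "map_poly of_int (q * k) = (map_poly of_int q * map_poly of_int k :: complex poly)"
    by (rule poly_eqI) (simp add: coeff_map_poly coeff_mult)
  hence "map_poly of_int q dvd smult (of_int c) F" using cG(2) \<open>G = q * k\<close> by (metis dvd_triv_left)
  thus ?thesis using cG(1) by (simp add: dvd_smult_iff)
qed auto

text \<open>F is a constant times a power of q: as long as F has a root, q divides it, and the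
  quotient inherits the hypotheses.\<close>

lemma proots_power_of_irreducible:
  assumes "over \<rat> F" "F \<noteq> 0" "degree q > 0"
    and "\<And>z. poly F z = 0 \<Longrightarrow> poly (map_poly of_int q) z = 0"
  obtains e where "proots F = repeat_mset e (proots (map_poly of_int q))"
  using assms
proof (induction "degree F" arbitrary: F thesis rule: less_induct)
  case less
  let ?q = "map_poly complex_of_int q"
  show ?case
  proof (cases "degree F = 0")
    case True
    hence "proots F = {#}" using size_proots_complex[of F] by simp
    thus ?thesis using less.prems(1)[of 0] by simp
  next
    case False
    then obtain z where z: "poly F z = 0"
      using fundamental_theorem_of_algebra constant_degree by metis
    have "?q dvd F" by (rule irreducible_dvd_rat_poly[OF less.prems(2) z less.prems(5)[OF z]])
    hence F: "F = ?q * (F div ?q)" by simp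
    define F' where "F' = F div ?q"
    have nz: "F' \<noteq> 0" "?q \<noteq> 0" using F less.prems(3) unfolding F'_def by auto
    have degq: "degree ?q > 0" using less.prems(4) by (simp add: degree_map_poly)
    have "over \<rat> ?q" by (simp add: over_def coeff_map_poly)
    hence "over \<rat> F'" unfolding F'_def by (intro rat.over_div less.prems)
    moreover have "degree F = degree ?q + degree F'"
      using F nz unfolding F'_def by (metis degree_mult_eq)
    hence "degree F' < degree F" using degq by simp
    moreover have "poly ?q w = 0" if "poly F' w = 0" for w
      using that F less.prems(5)[of w] unfolding F'_def by (metis mult_zero_right poly_mult)
    ultimately obtain e where "proots F' = repeat_mset e (proots ?q)"
      using less.hyps[of F'] nz(1) less.prems(4) by blast
    moreover have "proots F = proots ?q + proots F'"
      using F nz unfolding F'_def by (metis proots_mult)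
    ultimately have "proots F = repeat_mset (Suc e) (proots ?q)" by simp
    thus ?thesis by (rule less.prems(1))
  qed
qed

end

lemma min_int_poly:
  assumes "algebraic x"
  shows "irreducible (min_int_poly x)" "lead_coeff (min_int_poly x) > 0"
    "poly (map_poly of_int (min_int_poly x)) x = 0" "degree (min_int_poly x) > 0"
proof -
  let ?q = "min_int_poly x"
  have *: "irreducible ?q \<and> lead_coeff ?q > 0 \<and> poly (map_poly of_int ?q) x = 0"
    unfolding min_int_poly_def by (rule theI'[OF ex1_min_int_poly[OF assms]])
  thus "irreducible ?q" "lead_coeff ?q > 0" "poly (map_poly of_int ?q) x = 0" by auto
  show "degree ?q > 0"
  proof (rule ccontr)
    assume "\<not> degree ?q > 0"
    then obtain c where "?q = [:c:]" by (auto elim: degree_eq_zeroE)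
    thus False using * by (auto simp: map_poly_pCons)
  qed
qed

lemma ln_prod_mset:
  assumes "\<And>x. x \<in># M \<Longrightarrow> f x > (0 :: real)"
  shows "ln (\<Prod>x\<in>#M. f x) = (\<Sum>x\<in>#M. ln (f x))"
proof -
  from assms have "ln (\<Prod>x\<in>#M. f x) = (\<Sum>x\<in>#M. ln (f x)) \<and> (\<Prod>x\<in>#M. f x) > 0"
    by (induction M) (auto simp: ln_mult_pos)
  thus ?thesis ..
qed

lemma sum_mset_repeat_mset:
  "(\<Sum>z\<in>#repeat_mset e M. f z) = real e * (\<Sum>z\<in>#M. f z)"
  by (induction e) (auto simp: algebra_simps)

lemma sum_mset_nonpos:
  assumes "\<And>x. x \<in># M \<Longrightarrow> f x \<le> (0 :: real)"
  shows "(\<Sum>x\<in>#M. f x) \<le> 0"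
  using assms by (induction M) (auto intro: add_nonpos_nonpos)

locale number_field =
  fixes g :: complex and m :: "complex poly"
  assumes over_m: "over \<rat> m" and m_nz: "m \<noteq> 0" and root_g: "poly m g = 0"
    and minimal: "\<And>f. over \<rat> f \<Longrightarrow> poly f g = 0 \<Longrightarrow> m dvd f"
begin

lemma algebraic_g: "algebraic g"
  using over_m m_nz root_g algebraic_iff_over by blast

sublocale K: cfield "adjoin g"
  by (rule cfield_adjoin[OF algebraic_g])

text \<open>For a root r of m, the embedding of Q(g) that sends g to r. The choice of f does not
  matter, as two candidates differ by a multiple of m.\<close>

definition emb :: "complex \<Rightarrow> complex \<Rightarrow> complex" where
  "emb r x = poly (SOME f. over \<rat> f \<and> poly f g = x) r"

lemma emb_poly:
  assumes "over \<rat> f" "r \<in># proots m"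
  shows "emb r (poly f g) = poly f r"
proof -
  let ?h = "SOME h. over \<rat> h \<and> poly h g = poly f g"
  have h: "over \<rat> ?h \<and> poly ?h g = poly f g" by (rule someI[of _ f]) (use assms in auto)
  have "m dvd ?h - f" by (rule minimal) (use h assms in auto)
  moreover have "poly m r = 0" using assms m_nz by simp
  ultimately have "poly (?h - f) r = 0" by (meson dvd_trans poly_eq_0_iff_dvd)
  thus ?thesis by (simp add: emb_def)
qed

context
  fixes r assumes r: "r \<in># proots m"
begin

lemma emb_add: "x \<in> adjoin g \<Longrightarrow> y \<in> adjoin g \<Longrightarrow> emb r (x + y) = emb r x + emb r y"
  by (elim adjoinE) (simp flip: poly_add add: emb_poly r rat.over_add)

lemma emb_mult: "x \<in> adjoin g \<Longrightarrow> y \<in> adjoin g \<Longrightarrow> emb r (x * y) = emb r x * emb r y"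
  by (elim adjoinE) (simp flip: poly_mult add: emb_poly r rat.over_mult)

lemma emb_uminus: "x \<in> adjoin g \<Longrightarrow> emb r (- x) = - emb r x"
  by (elim adjoinE) (simp flip: poly_minus add: emb_poly r rat.over_uminus)

lemma emb_0 [simp]: "emb r 0 = 0" and emb_1 [simp]: "emb r 1 = 1"
  using emb_poly[of 0 r] emb_poly[of 1 r] r by auto

lemma emb_nonzero:
  assumes "x \<in> adjoin g" "x \<noteq> 0"
  shows "emb r x \<noteq> 0"
proof
  assume "emb r x = 0"
  hence "emb r (x * inverse x) = 0" using emb_mult[of x "inverse x"] K.inverse assms by simp
  thus False using assms by simp
qed

lemma algebraic_emb:
  assumes "x \<in> adjoin g"
  shows "algebraic (emb r x)"
proof -
  obtain f where f: "over \<rat> f" "x = poly f g" using assms by (rule adjoinE)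
  have "emb r x \<in># proots (norm_poly m f)" using r f by (simp add: proots_norm_poly emb_poly)
  hence "poly (norm_poly m f) (emb r x) = 0" using norm_poly_nz by simp
  thus ?thesis using rat.over_norm_poly[OF over_m f(1)] norm_poly_nz algebraic_iff_over by blast
qed

lemma emb_root_min_int_poly:
  assumes "x \<in> adjoin g"
  shows "poly (map_poly of_int (min_int_poly x)) (emb r x) = 0"
proof -
  let ?q = "map_poly complex_of_int (min_int_poly x)"
  obtain f where f: "over \<rat> f" "x = poly f g" using assms by (rule adjoinE)
  have "algebraic x" using algebraic_g assms by (rule algebraic_adjoin)
  hence "poly (pcompose ?q f) g = 0" using min_int_poly(3) f by (simp add: poly_pcompose)
  moreover have "over \<rat> ?q" by (simp add: over_def coeff_map_poly)
  ultimately have "m dvd pcompose ?q f" using f by (intro minimal) auto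
  then obtain k where k: "pcompose ?q f = m * k" by (elim dvdE)
  have "poly m r = 0" using r m_nz by simp
  hence "poly (pcompose ?q f) r = 0" unfolding k poly_mult by simp
  thus ?thesis using f r by (simp add: poly_pcompose emb_poly)
qed

end

text \<open>All roots of the characteristic polynomial of x are roots of its minimal polynomial, so
  the former is a power of the latter up to a constant. The exponent e is the degree of Q(g) over
  Q(x).\<close>

lemma conjugates:
  assumes "x \<in> adjoin g"
  obtains e where "image_mset (\<lambda>r. emb r x) (proots m) = repeat_mset e (proots (map_poly of_int (min_int_poly x)))"
    "degree m = e * degree (min_int_poly x)"
proof -
  let ?q = "map_poly complex_of_int (min_int_poly x)"
  have alg: "algebraic x" using algebraic_g assms by (rule algebraic_adjoin)
  obtain f where f: "over \<rat> f" "x = poly f g" using assms by (rule adjoinE)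
  have emb: "image_mset (\<lambda>r. emb r x) (proots m) = proots (norm_poly m f)"
    unfolding proots_norm_poly f(2) by (intro image_mset_cong) (simp add: emb_poly f)
  have "poly ?q z = 0" if "poly (norm_poly m f) z = 0" for z
  proof -
    have "z \<in># proots (norm_poly m f)" using that norm_poly_nz by simp
    then obtain r where "r \<in># proots m" "z = emb r x" unfolding emb[symmetric] by auto
    thus ?thesis using emb_root_min_int_poly assms by blast
  qed
  then obtain e where e: "proots (norm_poly m f) = repeat_mset e (proots ?q)"
    using proots_power_of_irreducible[OF min_int_poly(1)[OF alg] rat.over_norm_poly[OF over_m f(1)]
        norm_poly_nz min_int_poly(4)[OF alg]] by blast
  have "degree m = size (image_mset (\<lambda>r. emb r x) (proots m))" by (simp add: size_proots_complex)
  also have "\<dots> = e * degree ?q" by (simp add: emb e size_proots_complex)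
  also have "degree ?q = degree (min_int_poly x)" by (rule degree_map_poly) auto
  finally show ?thesis using that e emb by simp
qed

lemma norm_in_Rats: "x \<in> adjoin g \<Longrightarrow> (\<Prod>r\<in>#proots m. emb r x) \<in> \<rat>"
proof (elim adjoinE)
  fix f assume f: "over \<rat> f" "x = poly f g"
  have "(\<Prod>r\<in>#proots m. emb r x) = (\<Prod>r\<in>#proots m. poly f r)"
    by (intro arg_cong[of _ _ prod_mset] image_mset_cong) (simp add: f emb_poly)
  thus ?thesis using rat.prod_proots_in[OF over_m f(1)] by simp
qed

text \<open>For such p the local Mahler formula says that the product of max(1, |z|) over the
  conjugates z is 1; all factors are at least 1, so each equals 1.\<close>

lemma padic_emb_le_1:
  assumes "x \<in> adjoin g" "prime p" "\<not> int p dvd lead_coeff (min_int_poly x)" "r \<in># proots m"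
  shows "padic_abs p (emb r x) \<le> 1"
proof -
  let ?q = "map_poly complex_of_int (min_int_poly x)"
  have alg: "algebraic x" using algebraic_g assms(1) by (rule algebraic_adjoin)
  have "?q \<noteq> 0" using min_int_poly(4)[OF alg] by (metis degree_0 degree_map_poly less_irrefl of_int_eq_0_iff)
  hence "emb r x \<in># proots ?q" using emb_root_min_int_poly[OF assms(4,1)] by simp
  then obtain M where M: "proots ?q = add_mset (emb r x) M" by (metis multi_member_split)
  have "1 = (\<Prod>z\<in>#proots ?q. max 1 (padic_abs p z))"
    using padic_mahler[OF assms(2) min_int_poly(1,4)[OF alg]] padic_abs_of_int[OF assms(2,3)] by simp
  also have "\<dots> = max 1 (padic_abs p (emb r x)) * (\<Prod>z\<in>#M. max 1 (padic_abs p z))" by (simp add: M)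
  also have "\<dots> \<ge> max 1 (padic_abs p (emb r x)) * 1"
  proof (rule mult_left_mono)
    show "1 \<le> (\<Prod>z\<in>#M. max 1 (padic_abs p z))"
      by (induction M) (auto intro: order_trans mult_mono[of 1 _ 1 _, simplified])
  qed simp
  finally show ?thesis by simp
qed

lemma ln_lead_coeff:
  assumes "x \<in> adjoin g" "finite T" "\<And>p. p \<in> T \<Longrightarrow> prime p"
    "prime_factors (nat (lead_coeff (min_int_poly x))) \<subseteq> T"
  shows "ln (real_of_int (lead_coeff (min_int_poly x))) =
    (\<Sum>p\<in>T. \<Sum>z\<in>#proots (map_poly of_int (min_int_poly x)). ln (max 1 (padic_abs p z)))"
proof -
  let ?a = "lead_coeff (min_int_poly x)" and ?q = "map_poly complex_of_int (min_int_poly x)"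
  have alg: "algebraic x" using algebraic_g assms(1) by (rule algebraic_adjoin)
  have a: "?a > 0" using min_int_poly(2)[OF alg] .
  have prod_pos: "(\<Prod>z\<in>#M. max 1 (padic_abs p z)) > 0" for p M
    by (induction M) auto
  have "ln (padic_abs p (of_int ?a)) = - (\<Sum>z\<in>#proots ?q. ln (max 1 (padic_abs p z)))" if "p \<in> T" for p
  proof -
    have p: "prime p" using that assms by blast
    have "0 = ln (padic_abs p (of_int ?a) * (\<Prod>z\<in>#proots ?q. max 1 (padic_abs p z)))"
      using padic_mahler[OF p min_int_poly(1,4)[OF alg]] by simp
    also have "\<dots> = ln (padic_abs p (of_int ?a)) + ln (\<Prod>z\<in>#proots ?q. max 1 (padic_abs p z))"
      using a prod_pos by (intro ln_mult_pos padic_abs_pos p) auto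
    finally show ?thesis by (simp add: ln_prod_mset)
  qed
  moreover have "(\<Sum>p\<in>T. ln (padic_abs p (of_int ?a))) = - ln (real_of_int \<bar>?a\<bar>)"
    using a assms by (intro product_formula_int) auto
  ultimately show ?thesis using a by (simp add: sum_negf)
qed

lemma finite_bad_primes:
  assumes "x \<in> adjoin g"
  shows "finite {p. prime p \<and> (\<exists>r. r \<in># proots m \<and> padic_abs p (emb r x) > 1)}"
proof (rule finite_subset)
  let ?a = "lead_coeff (min_int_poly x)"
  have alg: "algebraic x" using algebraic_g assms(1) by (rule algebraic_adjoin)
  have a: "?a > 0" using min_int_poly(2)[OF alg] .
  show "finite (prime_factors (nat ?a))" by simp
  show "{p. prime p \<and> (\<exists>r. r \<in># proots m \<and> padic_abs p (emb r x) > 1)} \<subseteq> prime_factors (nat ?a)"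
  proof clarify
    fix p r assume p: "prime p" and r: "r \<in># proots m" "padic_abs p (emb r x) > 1"
    hence "int p dvd ?a" using padic_emb_le_1[OF assms p _ r(1)] by force
    hence "p dvd nat ?a" using a by (metis nat_dvd_iff nat_int order_less_imp_le zdvd1_eq int_dvd_int_iff int_nat_eq)
    thus "p \<in> prime_factors (nat ?a)" using p a by (simp add: prime_factors_dvd)
  qed
qed

text \<open>The prime component 0 stands for infinity. Embeddings are numbered by their position in
  a list of the roots, so that (p, j) and (p, k) count as two places even when they define the same
  absolute value.\<close>

definition place_abs :: "complex list \<Rightarrow> nat \<times> nat \<Rightarrow> complex \<Rightarrow> real" where
  "place_abs rs v x = (if fst v = 0 then cmod else padic_abs (fst v)) (emb (rs ! snd v) x)"

text \<open>The S-integers of the field, with T as the set of exceptional primes.\<close>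

definition integers_outside :: "nat set \<Rightarrow> complex set" where
  "integers_outside T =
     {x \<in> adjoin g. \<forall>p r. prime p \<longrightarrow> p \<notin> T \<longrightarrow> r \<in># proots m \<longrightarrow> padic_abs p (emb r x) \<le> 1}"

lemma csubring_integers_outside: "csubring (integers_outside T)"
proof
  show "1 \<in> integers_outside T" by (auto simp: integers_outside_def)
next
  fix x y assume *: "x \<in> integers_outside T" "y \<in> integers_outside T"
  hence K: "x \<in> adjoin g" "y \<in> adjoin g" by (auto simp: integers_outside_def)
  show "x + y \<in> integers_outside T"
  proof (unfold integers_outside_def, safe)
    fix p r assume pr: "prime p" "p \<notin> T" "r \<in># proots m"
    have "padic_abs p (emb r (x + y)) \<le> max (padic_abs p (emb r x)) (padic_abs p (emb r y))"
      unfolding emb_add[OF pr(3) K] by (intro padic_abs_add algebraic_emb pr K)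
    also have "\<dots> \<le> 1" using * pr by (auto simp: integers_outside_def)
    finally show "padic_abs p (emb r (x + y)) \<le> 1" .
  qed (use K in auto)
  show "x * y \<in> integers_outside T"
  proof (unfold integers_outside_def, safe)
    fix p r assume pr: "prime p" "p \<notin> T" "r \<in># proots m"
    have "padic_abs p (emb r (x * y)) = padic_abs p (emb r x) * padic_abs p (emb r y)"
      unfolding emb_mult[OF pr(3) K] by (intro padic_abs_mult algebraic_emb pr K)
    also have "\<dots> \<le> 1 * 1"
      using * pr by (intro mult_mono padic_abs_nonneg) (auto simp: integers_outside_def)
    finally show "padic_abs p (emb r (x * y)) \<le> 1" by simp
  qed (use K in auto)
next
  fix x assume *: "x \<in> integers_outside T"
  thus "- x \<in> integers_outside T"
    by (auto simp: integers_outside_def emb_uminus padic_abs_uminus algebraic_emb)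
qed

lemma places:
  assumes rs: "mset rs = proots m" and T: "finite T" "\<And>p. p \<in> T \<Longrightarrow> prime p"
  shows "places (integers_outside T) ((insert 0 T) \<times> {..<length rs}) ({0} \<times> {..<length rs}) (place_abs rs)"
proof -
  let ?V = "(insert 0 T) \<times> {..<length rs}" and ?A = "{0 :: nat} \<times> {..<length rs}"
    and ?R = "integers_outside T"
  have len: "length rs = degree m" using rs by (metis size_mset size_proots_complex)
  have RK: "x \<in> adjoin g" if "x \<in> ?R" for x using that by (simp add: integers_outside_def)
  have root: "rs ! j \<in># proots m" if "j < length rs" for j using that by (simp flip: rs)
  have T0: "0 \<notin> T" using T(2)[of 0] by auto
  have sum_conj: "(\<Sum>j<length rs. f (rs ! j)) = (\<Sum>r\<in>#proots m. f r)" for f :: "complex \<Rightarrow> real"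
  proof -
    have "(\<Sum>r\<in>#proots m. f r) = sum_list (map f rs)"
      unfolding rs[symmetric] by (simp flip: sum_mset_sum_list mset_map)
    thus ?thesis by (simp add: sum_list_sum_nth atLeast0LessThan)
  qed
  have sum_V: "(\<Sum>v\<in>?V. h (place_abs rs v x)) = (\<Sum>r\<in>#proots m. h (cmod (emb r x))) +
      (\<Sum>p\<in>T. \<Sum>r\<in>#proots m. h (padic_abs p (emb r x)))" for h :: "real \<Rightarrow> real" and x
  proof -
    have "(\<Sum>v\<in>?V. h (place_abs rs v x)) = (\<Sum>p\<in>insert 0 T. \<Sum>j<length rs. h (place_abs rs (p, j) x))"
      by (simp add: sum.cartesian_product)
    also have "\<dots> = (\<Sum>j<length rs. h (place_abs rs (0, j) x)) + (\<Sum>p\<in>T. \<Sum>j<length rs. h (place_abs rs (p, j) x))"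
      using T(1) T0 by simp
    also have "(\<Sum>j<length rs. h (place_abs rs (0, j) x)) = (\<Sum>r\<in>#proots m. h (cmod (emb r x)))"
      by (simp add: place_abs_def sum_conj[of "\<lambda>r. h (cmod (emb r x))"])
    also have "(\<Sum>p\<in>T. \<Sum>j<length rs. h (place_abs rs (p, j) x)) =
        (\<Sum>p\<in>T. \<Sum>r\<in>#proots m. h (padic_abs p (emb r x)))"
    proof (rule sum.cong[OF refl])
      fix p assume "p \<in> T"
      hence "p \<noteq> 0" using T0 by metis
      thus "(\<Sum>j<length rs. h (place_abs rs (p, j) x)) = (\<Sum>r\<in>#proots m. h (padic_abs p (emb r x)))"
        by (simp add: place_abs_def sum_conj[of "\<lambda>r. h (padic_abs p (emb r x))"])
    qed
    finally show ?thesis .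
  qed
  interpret R: csubring ?R by (rule csubring_integers_outside)
  show ?thesis
  proof
    show "finite ?V" using T by simp
    show "?A \<subseteq> ?V" by auto
    have "degree m \<noteq> 0"
    proof
      assume "degree m = 0"
      then obtain c where "m = [:c:]" by (rule degree_eq_zeroE)
      thus False using root_g m_nz by simp
    qed
    thus "?A \<noteq> {}" using len by auto
  next
    fix x assume "x \<in> ?R"
    thus "algebraic x" using RK algebraic_adjoin algebraic_g by blast
  next
    fix v assume "v \<in> ?V"
    thus "place_abs rs v 0 = 0" using root T(2) by (auto simp: place_abs_def)
  next
    fix v x assume v: "v \<in> ?V" and x: "x \<in> ?R" "x \<noteq> 0"
    hence "emb (rs ! snd v) x \<noteq> 0" using emb_nonzero[OF root RK] by auto
    thus "place_abs rs v x > 0" using v T(2) by (auto simp: place_abs_def intro: padic_abs_pos)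
  next
    fix v x y assume v: "v \<in> ?V" and x: "x \<in> ?R" and y: "y \<in> ?R"
    hence r: "rs ! snd v \<in># proots m" and p: "fst v = 0 \<or> prime (fst v)" using root T(2) by auto
    show "place_abs rs v (x * y) = place_abs rs v x * place_abs rs v y"
      using p unfolding place_abs_def emb_mult[OF r RK[OF x] RK[OF y]]
      by (auto simp: norm_mult padic_abs_mult algebraic_emb[OF r RK] x y)
  next
    fix v x y assume v: "v \<in> ?A" and x: "x \<in> ?R" and y: "y \<in> ?R"
    hence r: "rs ! snd v \<in># proots m" and p: "fst v = 0" using root by auto
    show "place_abs rs v (x + y) \<le> place_abs rs v x + place_abs rs v y"
      using p unfolding place_abs_def emb_add[OF r RK[OF x] RK[OF y]] by (auto intro: norm_triangle_ineq)
  next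
    fix v x y assume v: "v \<in> ?V - ?A" and x: "x \<in> ?R" and y: "y \<in> ?R"
    hence r: "rs ! snd v \<in># proots m" and p: "prime (fst v)" using root T(2) by auto
    have p0: "fst v \<noteq> 0" using p by (intro notI) simp
    show "place_abs rs v (x + y) \<le> max (place_abs rs v x) (place_abs rs v y)"
      using p0 padic_abs_add[OF p algebraic_emb[OF r RK[OF x]] algebraic_emb[OF r RK[OF y]]]
      unfolding place_abs_def emb_add[OF r RK[OF x] RK[OF y]] by simp
  next
    fix x assume x: "x \<in> ?R" "x \<noteq> 0"
    \<comment> \<open>The norm of x is rational, so the product formula over the rationals applies
      to it. Its primes outside T contribute non-positive logarithms, because x is integral
      there.\<close>
    define N where "N = (\<Prod>r\<in>#proots m. emb r x)"
    have emb: "emb r x \<noteq> 0" "algebraic (emb r x)" if "r \<in># proots m" for r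
      using emb_nonzero[OF that RK] algebraic_emb[OF that RK] x by auto
    have N: "N \<in> \<rat>" "N \<noteq> 0"
      using norm_in_Rats[OF RK] x(1) emb by (auto simp: N_def prod_mset_zero_iff)
    obtain T0 where T0: "finite T0" "\<And>q. q \<in> T0 \<Longrightarrow> prime q"
      "\<And>T. finite T \<Longrightarrow> (\<And>q. q \<in> T \<Longrightarrow> prime q) \<Longrightarrow> T0 \<subseteq> T \<Longrightarrow> (\<Sum>q\<in>T. ln (padic_abs q N)) = - ln (cmod N)"
      by (rule product_formula_rat[OF N]) blast
    have "cmod N = (\<Prod>r\<in>#proots m. cmod (emb r x))"
    proof -
      have "cmod (\<Prod>r\<in>#M. emb r x) = (\<Prod>r\<in>#M. cmod (emb r x))" for M
        by (induction M) (auto simp: norm_mult)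
      thus ?thesis by (simp add: N_def)
    qed
    hence 1: "ln (cmod N) = (\<Sum>r\<in>#proots m. ln (cmod (emb r x)))"
      using emb by (simp add: ln_prod_mset)
    have 2: "ln (padic_abs q N) = (\<Sum>r\<in>#proots m. ln (padic_abs q (emb r x)))" if q: "prime q" for q
    proof -
      have "padic_abs q N = (\<Prod>r\<in>#proots m. padic_abs q (emb r x))"
        using padic_abs_prod_mset[OF q, of "image_mset (\<lambda>r. emb r x) (proots m)"] emb
        by (auto simp: N_def image_mset.compositionality o_def)
      thus ?thesis using emb padic_abs_pos[OF q] by (simp add: ln_prod_mset)
    qed
    have neg: "ln (padic_abs q N) \<le> 0" if q: "q \<in> T0 - T" for q
    proof -
      have qp: "prime q" using q T0 by auto
      have "ln (padic_abs q (emb r x)) \<le> 0" if r: "r \<in># proots m" for r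
      proof -
        have "padic_abs q (emb r x) > 0" using padic_abs_pos[OF qp] emb(1)[OF r] .
        moreover have "padic_abs q (emb r x) \<le> 1" using x(1) q qp r by (auto simp: integers_outside_def)
        ultimately show ?thesis by simp
      qed
      thus ?thesis unfolding 2[OF qp] by (intro sum_mset_nonpos) auto
    qed
    have "- ln (cmod N) = (\<Sum>q\<in>T \<union> T0. ln (padic_abs q N))"
      using T T0(1,2) by (intro T0(3)[symmetric]) auto
    also have "\<dots> = (\<Sum>q\<in>T \<union> (T0 - T). ln (padic_abs q N))" by simp
    also have "\<dots> = (\<Sum>q\<in>T. ln (padic_abs q N)) + (\<Sum>q\<in>T0 - T. ln (padic_abs q N))"
      using T T0 by (intro sum.union_disjoint) auto
    also have "\<dots> \<le> (\<Sum>q\<in>T. ln (padic_abs q N)) + 0"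
      using neg by (intro add_left_mono sum_nonpos) auto
    finally have "0 \<le> ln (cmod N) + (\<Sum>q\<in>T. ln (padic_abs q N))" by simp
    also have "\<dots> = (\<Sum>v\<in>?V. ln (place_abs rs v x))"
      unfolding sum_V[of ln] 1 using 2 T(2) by simp
    finally show "0 \<le> (\<Sum>v\<in>?V. ln (place_abs rs v x))" .
  next
    fix x assume x: "x \<in> ?R"
    let ?q = "map_poly complex_of_int (min_int_poly x)" and ?a = "lead_coeff (min_int_poly x)"
    have alg: "algebraic x" using RK[OF x] algebraic_adjoin algebraic_g by blast
    have a: "?a > 0" and deg: "degree (min_int_poly x) > 0" using min_int_poly(2,4)[OF alg] .
    obtain e where e: "image_mset (\<lambda>r. emb r x) (proots m) = repeat_mset e (proots ?q)"
      "degree m = e * degree (min_int_poly x)" by (rule conjugates[OF RK[OF x]])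
    have conj: "(\<Sum>r\<in>#proots m. h (emb r x)) = real e * (\<Sum>z\<in>#proots ?q. h z)" for h :: "complex \<Rightarrow> real"
    proof -
      have "(\<Sum>r\<in>#proots m. h (emb r x)) = (\<Sum>z\<in>#image_mset (\<lambda>r. emb r x) (proots m). h z)"
        by (simp add: image_mset.compositionality o_def)
      also have "\<dots> = real e * (\<Sum>z\<in>#proots ?q. h z)" unfolding e(1) sum_mset_repeat_mset ..
      finally show ?thesis .
    qed
    \<comment> \<open>The formula for the leading coefficient needs all of its prime divisors; those
      outside T drop out again, because x is integral there.\<close>
    let ?T' = "T \<union> prime_factors (nat ?a)"
    have "real e * ln (real_of_int ?a) =
        real e * (\<Sum>p\<in>?T'. \<Sum>z\<in>#proots ?q. ln (max 1 (padic_abs p z)))"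
      using T by (subst ln_lead_coeff[OF RK[OF x], of ?T']) auto
    also have "\<dots> = (\<Sum>p\<in>?T'. \<Sum>r\<in>#proots m. ln (max 1 (padic_abs p (emb r x))))"
      unfolding sum_distrib_left
      by (intro sum.cong refl conj[of "\<lambda>z. ln (max 1 (padic_abs _ z))", symmetric])
    also have "\<dots> = (\<Sum>p\<in>T. \<Sum>r\<in>#proots m. ln (max 1 (padic_abs p (emb r x))))"
    proof (rule sum.mono_neutral_right)
      show "finite ?T'" "T \<subseteq> ?T'" using T by auto
      show "\<forall>p\<in>?T' - T. (\<Sum>r\<in>#proots m. ln (max 1 (padic_abs p (emb r x)))) = 0"
      proof
        fix p assume p: "p \<in> ?T' - T"
        hence "prime p" by auto
        have "ln (max 1 (padic_abs p (emb r x))) = 0" if "r \<in># proots m" for r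
        proof -
          have "padic_abs p (emb r x) \<le> 1"
            using x p that \<open>prime p\<close> by (auto simp: integers_outside_def)
          thus ?thesis by (simp add: max_absorb1)
        qed
        hence "(\<Sum>r\<in>#proots m. ln (max 1 (padic_abs p (emb r x)))) = (\<Sum>r\<in>#proots m. 0)"
          by (intro arg_cong[of _ _ sum_mset] image_mset_cong)
        thus "(\<Sum>r\<in>#proots m. ln (max 1 (padic_abs p (emb r x)))) = 0" by simp
      qed
    qed
    finally have ln_a: "real e * ln (real_of_int ?a) = \<dots>" .
    have "weil_height x * real (card ?A) =
        real e * ln (real_of_int ?a) + real e * (\<Sum>z\<in>#proots ?q. ln (max 1 (cmod z)))"
      using deg a by (simp add: weil_height_def Let_def len e(2) field_simps)
    also have "\<dots> = (\<Sum>v\<in>?V. ln (max 1 (place_abs rs v x)))"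
      unfolding ln_a sum_V[of "\<lambda>t. ln (max 1 t)"] conj[of "\<lambda>z. ln (max 1 (cmod z))", symmetric] by simp
    finally show "weil_height x * real (card ?A) = (\<Sum>v\<in>?V. ln (max 1 (place_abs rs v x)))" .
  qed
qed

end

theorem ex_places:
  assumes "finite E" "\<And>x. x \<in> E \<Longrightarrow> algebraic x"
  obtains R and V A :: "(nat \<times> nat) set" and ab where "places R V A ab" "E \<subseteq> R"
proof -
  obtain g where g: "algebraic g" "E \<subseteq> adjoin g" using primitive_element[OF assms] by blast
  obtain p where p: "over \<rat> p" "p \<noteq> 0" "poly p g = 0" using g(1) algebraic_iff_over by blast
  obtain m where m: "over \<rat> m" "lead_coeff m = 1" "poly m g = 0"
    "\<And>f. over \<rat> f \<Longrightarrow> poly f g = 0 \<Longrightarrow> m dvd f" using rat.ex_minimal_poly[OF p] by blast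
  have "m \<noteq> 0" using m(2) by auto
  then interpret number_field g m using m by unfold_locales auto
  obtain rs where rs: "mset rs = proots m" using ex_mset by blast
  define T where "T = (\<Union>x\<in>E. {p. prime p \<and> (\<exists>r. r \<in># proots m \<and> padic_abs p (emb r x) > 1)})"
  have T: "finite T" "\<And>p. p \<in> T \<Longrightarrow> prime p"
    using assms(1) g(2) finite_bad_primes by (auto simp: T_def)
  have "E \<subseteq> integers_outside T"
    using g(2) by (fastforce simp: integers_outside_def T_def not_less)
  with places[OF rs T] show ?thesis by (rule that)
qed

section \<open>Pade approximations on the line x + y + z = 0\<close>

definition antideriv :: "complex poly \<Rightarrow> complex poly" where
  "antideriv p = (\<Sum>k\<le>degree p. monom (coeff p k / of_nat (Suc k)) (Suc k))"

lemma poly_extI: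
  fixes p q :: "complex poly"
  assumes "\<And>x. poly p x = poly q x"
  shows "p = q"
  using assms poly_eq_poly_eq_iff[of p q] by auto

lemma pderiv_antideriv: "pderiv (antideriv p) = p"
proof (rule poly_eqI)
  fix n
  have "coeff (antideriv p) (Suc n) = (\<Sum>k\<le>degree p. if k = n then coeff p k / of_nat (Suc k) else 0)"
    by (simp add: antideriv_def coeff_sum)
  also have "\<dots> = coeff p n / of_nat (Suc n)"
    by (simp add: sum.delta' coeff_eq_0)
  finally show "coeff (pderiv (antideriv p)) n = coeff p n"
    by (simp add: coeff_pderiv del: of_nat_Suc)
qed

text \<open>The integral of f along any path from a to b, defined by a formal antiderivative so that
  no integration theory enters.\<close>

definition seg_int :: "complex \<Rightarrow> complex \<Rightarrow> complex poly \<Rightarrow> complex" where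
  "seg_int a b f = poly (antideriv f) b - poly (antideriv f) a"

lemma seg_int_pderiv: "seg_int a b (pderiv h) = poly h b - poly h a"
proof -
  have "pderiv (antideriv (pderiv h) - h) = 0" by (simp add: pderiv_diff pderiv_antideriv)
  hence "degree (antideriv (pderiv h) - h) = 0" by (simp add: pderiv_eq_0_iff)
  then obtain c where "antideriv (pderiv h) - h = [:c:]" by (rule degree_eq_zeroE)
  hence "antideriv (pderiv h) = h + [:c:]" by (simp add: algebra_simps)
  thus ?thesis by (simp add: seg_int_def)
qed

lemma seg_int_add: "seg_int a b (f + g) = seg_int a b f + seg_int a b g"
  using seg_int_pderiv[of a b "antideriv f + antideriv g"]
  by (simp add: pderiv_add pderiv_antideriv seg_int_def)

lemma seg_int_smult: "seg_int a b (smult c f) = c * seg_int a b f"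
  using seg_int_pderiv[of a b "smult c (antideriv f)"]
  by (simp add: pderiv_smult pderiv_antideriv seg_int_def algebra_simps)

lemma seg_int_diff: "seg_int a b (f - g) = seg_int a b f - seg_int a b g"
  using seg_int_add[of a b f "smult (- 1) g"] seg_int_smult[of a b "- 1" g] by simp

lemma seg_int_0: "seg_int a b 0 = 0"
  by (simp add: seg_int_def antideriv_def)

lemma seg_int_sum: "seg_int a b (\<Sum>i\<in>I. f i) = (\<Sum>i\<in>I. seg_int a b (f i))"
  by (induction I rule: infinite_finite_induct) (simp_all add: seg_int_0 seg_int_add)

lemma seg_int_triangle: "seg_int a b f + seg_int b c f + seg_int c a f = 0"
  by (simp add: seg_int_def)

text \<open>Euler's Beta integral. Partial integration trades a factor t - b for a factor t - a; the
  boundary terms vanish.\<close>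

lemma seg_int_beta:
  "seg_int a b ([:- a, 1:] ^ i * [:- b, 1:] ^ j) =
    (- 1) ^ j * (b - a) ^ (i + j + 1) * fact i * fact j / fact (i + j + 1)"
proof (induction j arbitrary: i)
  case 0
  have "pderiv (smult (1 / of_nat (Suc i)) ([:- a, 1:] ^ Suc i)) = [:- a, 1:] ^ i"
    by (simp add: pderiv_smult pderiv_power_Suc pderiv_pCons del: of_nat_Suc power_Suc)
  from seg_int_pderiv[of a b "smult (1 / of_nat (Suc i)) ([:- a, 1:] ^ Suc i)", unfolded this]
  have "seg_int a b ([:- a, 1:] ^ i) = (b - a) ^ Suc i / of_nat (Suc i)"
    by (simp only: poly_smult poly_power) (simp del: of_nat_Suc)
  thus ?case by (simp add: fact_Suc del: of_nat_Suc)
next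
  case (Suc j)
  let ?u = "[:- a, 1:] :: complex poly" and ?w = "[:- b, 1:] :: complex poly"
  have "pderiv (?u ^ Suc i * ?w ^ Suc j) =
      smult (of_nat (Suc i)) (?u ^ i * ?w ^ Suc j) + smult (of_nat (Suc j)) (?u ^ Suc i * ?w ^ j)"
    unfolding pderiv_mult pderiv_power_Suc
    by (rule poly_extI) (simp add: pderiv_pCons algebra_simps)
  hence "of_nat (Suc i) * seg_int a b (?u ^ i * ?w ^ Suc j) + of_nat (Suc j) * seg_int a b (?u ^ Suc i * ?w ^ j) = 0"
    using seg_int_pderiv[of a b "?u ^ Suc i * ?w ^ Suc j"]
    by (simp add: seg_int_add seg_int_smult poly_power del: of_nat_Suc power_Suc)
  hence "seg_int a b (?u ^ i * ?w ^ Suc j) = - of_nat (Suc j) * seg_int a b (?u ^ Suc i * ?w ^ j) / of_nat (Suc i)"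
    by (simp add: field_simps add_eq_0_iff del: of_nat_Suc power_Suc)
  also have "\<dots> = (- 1) ^ Suc j * (b - a) ^ (i + Suc j + 1) * fact i * fact (Suc j) / fact (i + Suc j + 1)"
    unfolding Suc.IH[of "Suc i"] by (simp add: fact_Suc[of i] fact_Suc[of j] del: of_nat_Suc power_Suc fact_Suc) (simp add: mult_ac)
  finally show ?case .
qed

text \<open>The form W of degree N: what remains of the integral of ((t - a)(t - b)(t - c))^N over a
  side after removing (b - a)^(2N+1) and N!^3 / (3N+1)!. After this normalisation the coefficients
  are integers.\<close>

definition pade :: "nat \<Rightarrow> complex \<Rightarrow> complex \<Rightarrow> complex" where
  "pade N x y = (\<Sum>k\<le>N. of_nat (((N + k) choose N) * ((2 * N - k) choose N)) * ((- x) ^ k * y ^ (N - k)))"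

lemma choose_fact_identity:
  assumes "k \<le> N"
  shows "of_nat (N choose k) * fact (N + k) * fact (2 * N - k) =
    (fact N ^ 3 * of_nat (((N + k) choose N) * ((2 * N - k) choose N)) :: complex)"
proof -
  have "2 * N - k - N = N - k" using assms by simp
  thus ?thesis using assms
    by (simp add: binomial_fact power3_eq_cube field_simps)
qed

definition cubic :: "complex \<Rightarrow> complex \<Rightarrow> complex \<Rightarrow> complex poly" where
  "cubic a b c = [:- a, 1:] * [:- b, 1:] * [:- c, 1:]"

text \<open>Rests on the identity (b - a)(t - c) = (b - c)(t - a) + (c - a)(t - b). Its N-th power
  is expanded and integrated termwise by the Beta formula; the factor (b - a)^N introduced for this
  purpose is cancelled at the end.\<close>

lemma seg_int_cubic_power:
  assumes "a \<noteq> b"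
  shows "seg_int a b (cubic a b c ^ N) =
    (b - a) ^ (2 * N + 1) * fact N ^ 3 / fact (3 * N + 1) * pade N (b - c) (c - a)"
proof -
  define u :: "complex poly" where "u = [:- a, 1:]"
  define w :: "complex poly" where "w = [:- b, 1:]"
  define v :: "complex poly" where "v = [:- c, 1:]"
  let ?X = "b - c" and ?Y = "c - a"
  have lin: "smult (b - a) v = smult ?X u + smult ?Y w"
    by (simp add: u_def v_def w_def algebra_simps)
  have "smult ((b - a) ^ N) (cubic a b c ^ N) = u ^ N * w ^ N * (smult (b - a) v) ^ N"
    unfolding cubic_def u_def[symmetric] v_def[symmetric] w_def[symmetric]
    by (rule poly_extI) (simp add: poly_power power_mult_distrib mult_ac)
  also have "(smult (b - a) v) ^ N =
      (\<Sum>k\<le>N. of_nat (N choose k) * (smult ?X u) ^ k * (smult ?Y w) ^ (N - k))"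
    unfolding lin by (rule binomial_ring)
  also have "u ^ N * w ^ N * \<dots> =
      (\<Sum>k\<le>N. smult (of_nat (N choose k) * ?X ^ k * ?Y ^ (N - k)) (u ^ (N + k) * w ^ (2 * N - k)))"
    unfolding sum_distrib_left
  proof (intro sum.cong refl)
    fix k assume "k \<in> {..N}"
    hence e: "2 * N - k = N + (N - k)" by simp
    have of: "of_nat (N choose k) * q = smult (of_nat (N choose k)) q" for q :: "complex poly"
      by (simp add: of_nat_poly)
    show "u ^ N * w ^ N * (of_nat (N choose k) * (smult ?X u) ^ k * (smult ?Y w) ^ (N - k)) =
      smult (of_nat (N choose k) * ?X ^ k * ?Y ^ (N - k)) (u ^ (N + k) * w ^ (2 * N - k))"
      unfolding e power_add mult.assoc[of "of_nat (N choose k)"] of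
      by (rule poly_extI) (simp add: poly_power power_mult_distrib mult_ac)
  qed
  finally have "(b - a) ^ N * seg_int a b (cubic a b c ^ N) =
      (\<Sum>k\<le>N. of_nat (N choose k) * ?X ^ k * ?Y ^ (N - k) * seg_int a b (u ^ (N + k) * w ^ (2 * N - k)))"
    using seg_int_smult[of a b "(b - a) ^ N" "cubic a b c ^ N"] by (simp add: seg_int_sum seg_int_smult)
  also have "\<dots> = (\<Sum>k\<le>N. (b - a) ^ N * ((b - a) ^ (2 * N + 1) * fact N ^ 3 / fact (3 * N + 1) *
      (of_nat (((N + k) choose N) * ((2 * N - k) choose N)) * ((- ?X) ^ k * ?Y ^ (N - k)))))"
  proof (intro sum.cong refl)
    fix k assume "k \<in> {..N}"
    hence k: "k \<le> N" by simp
    have e: "N + k + (2 * N - k) + 1 = N + (2 * N + 1)" "N + (2 * N + 1) = 3 * N + 1" using k by auto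
    have "(- 1) ^ (2 * N - k) = (- 1 :: complex) ^ k"
    proof -
      have "(- 1 :: complex) ^ (2 * N - k) * (- 1) ^ k = 1"
        using k by (simp flip: power_add)
      moreover have "(- 1 :: complex) ^ k * (- 1) ^ k = 1" by (simp flip: power_add mult_2)
      ultimately show ?thesis by (metis mult.assoc mult.commute mult_1)
    qed
    hence "of_nat (N choose k) * ?X ^ k * ?Y ^ (N - k) * seg_int a b (u ^ (N + k) * w ^ (2 * N - k)) =
        (of_nat (N choose k) * fact (N + k) * fact (2 * N - k)) * ?X ^ k * ?Y ^ (N - k) *
        ((- 1) ^ k * (b - a) ^ (N + (2 * N + 1)) / fact (3 * N + 1))"
      unfolding u_def w_def seg_int_beta e(1) by (simp add: e(2))
    also have "\<dots> = (b - a) ^ N * ((b - a) ^ (2 * N + 1) * fact N ^ 3 / fact (3 * N + 1) *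
      (of_nat (((N + k) choose N) * ((2 * N - k) choose N)) * ((- ?X) ^ k * ?Y ^ (N - k))))"
      unfolding choose_fact_identity[OF k] power_add[of "b - a" N] power_minus[of ?X k]
      by (simp only: times_divide_eq_right times_divide_eq_left mult_ac)
    finally show "of_nat (N choose k) * ?X ^ k * ?Y ^ (N - k) * seg_int a b (u ^ (N + k) * w ^ (2 * N - k)) =
      (b - a) ^ N * ((b - a) ^ (2 * N + 1) * fact N ^ 3 / fact (3 * N + 1) *
      (of_nat (((N + k) choose N) * ((2 * N - k) choose N)) * ((- ?X) ^ k * ?Y ^ (N - k))))" .
  qed
  also have "\<dots> = (b - a) ^ N * ((b - a) ^ (2 * N + 1) * fact N ^ 3 / fact (3 * N + 1) * pade N ?X ?Y)"
    by (simp only: pade_def sum_distrib_left)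
  finally have "(b - a) ^ N * seg_int a b (cubic a b c ^ N) = \<dots>" .
  moreover have "(b - a) ^ N \<noteq> 0" using assms by simp
  ultimately show ?thesis by (simp only: mult_left_cancel simp_thms)
qed

lemma cubic_rotate: "cubic a b c = cubic b c a"
  by (simp only: cubic_def mult_ac)

text \<open>Of all triangles with these sides the one with centroid 0 is taken, so that its cubic
  has no quadratic term.\<close>

lemma vertices:
  fixes x y z :: complex
  assumes "x + y + z = 0" "x \<noteq> 0" "y \<noteq> 0" "z \<noteq> 0"
  obtains a b c where "b - c = x" "c - a = y" "a - b = z" "a + b + c = 0" "a \<noteq> b" "b \<noteq> c" "c \<noteq> a"
proof -
  have z: "z = - x - y" using assms(1) by (simp add: add_eq_0_iff algebra_simps)
  define a b c where "a = (z - y) / 3" and "b = (x - z) / 3" and "c = (y - x) / 3"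
  have "b - c = x" "c - a = y" "a - b = z" "a + b + c = 0"
    by (simp_all add: a_def b_def c_def z field_simps)
  moreover from this(1-3) assms have "a \<noteq> b" "b \<noteq> c" "c \<noteq> a" by auto
  ultimately show ?thesis by (rule that)
qed

lemma pade_relation:
  assumes "x + y + z = 0" "x \<noteq> 0" "y \<noteq> 0" "z \<noteq> 0"
  shows "x ^ (2 * N + 1) * pade N y z + y ^ (2 * N + 1) * pade N z x + z ^ (2 * N + 1) * pade N x y = 0"
proof -
  obtain a b c where abc: "b - c = x" "c - a = y" "a - b = z" "a \<noteq> b" "b \<noteq> c" "c \<noteq> a"
    using vertices[OF assms] by metis
  define K where "K = (fact N ^ 3 / fact (3 * N + 1) :: complex)"
  have K: "K \<noteq> 0"
    by (simp only: K_def divide_eq_0_iff power_eq_0_iff fact_nonzero simp_thms)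
  have neg: "b - a = - z" "c - b = - x" "a - c = - y" using abc by auto
  have *: "seg_int a b (cubic a b c ^ N) = - K * (z ^ (2 * N + 1) * pade N x y)"
    "seg_int b c (cubic a b c ^ N) = - K * (x ^ (2 * N + 1) * pade N y z)"
    "seg_int c a (cubic a b c ^ N) = - K * (y ^ (2 * N + 1) * pade N z x)"
    using seg_int_cubic_power[OF abc(4), of c N] seg_int_cubic_power[OF abc(5), of a N, folded cubic_rotate[of a]]
      seg_int_cubic_power[OF abc(6), of b N, folded cubic_rotate[of b], folded cubic_rotate[of a]]
    by (simp_all add: abc neg K_def)
  have "- K * (x ^ (2 * N + 1) * pade N y z + y ^ (2 * N + 1) * pade N z x + z ^ (2 * N + 1) * pade N x y) = 0"
    using seg_int_triangle[of a b "cubic a b c ^ N" c] unfolding * by (simp add: algebra_simps)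
  thus ?thesis using K by simp
qed

section \<open>Moments of powers of the cubic\<close>

definition poly_t :: "complex poly" where "poly_t = [:0, 1:]"

lemma poly_poly_t [simp]: "poly poly_t x = x"
  and pderiv_poly_t: "pderiv poly_t = 1" "pderiv (poly_t\<^sup>2) = smult 2 poly_t"
  by (simp_all add: poly_t_def pderiv_pCons one_pCons power2_eq_square)

text \<open>The derivatives of t g^(n+1) and t^2 g^(n+1) integrate to 0, since g vanishes at both
  ends. They are reduced by means of t g' = 3 g - 2 P t - 3 Q. Keeping the first moment along with
  the integral makes the recurrence one of first order.\<close>

lemma moment_recurrence:
  fixes P Q :: complex
  defines "g \<equiv> [:Q, P, 0, 1:]"
  assumes "poly g a = 0" "poly g b = 0"
  defines "m0 \<equiv> \<lambda>n. seg_int a b (g ^ n)" and "m1 \<equiv> \<lambda>n. seg_int a b (poly_t * g ^ n)"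
  shows "of_nat (3 * n + 4) * m0 (Suc n) = of_nat (Suc n) * (2 * P * m1 n + 3 * Q * m0 n)"
    and "3 * of_nat (3 * n + 5) * m1 (Suc n) = of_nat (Suc n) * (9 * Q * m1 n - 2 * P\<^sup>2 * m0 n)"
proof -
  have dg: "pderiv g = [:P, 0, 3:]" by (simp add: g_def pderiv_pCons)
  define c :: complex where "c = of_nat (Suc n)"
  have c': "of_nat (3 * n + 4) = 3 * c + 1" "of_nat (3 * n + 5) = 3 * c + 2" by (simp_all add: c_def)
  have dgn: "pderiv (g ^ Suc n) = smult c (g ^ n * [:P, 0, 3:])"
    by (simp only: pderiv_power_Suc dg c_def mult_smult_left)
  have g_eq: "g ^ Suc n = g ^ n * g" by simp
  have 0: "seg_int a b (pderiv (h * g ^ Suc n)) = 0" for h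
    using assms(2,3) by (simp add: seg_int_pderiv poly_power)
  have "pderiv (poly_t * g ^ Suc n) = g ^ n * (g + smult c (poly_t * [:P, 0, 3:]))"
    unfolding pderiv_mult dgn pderiv_poly_t by (rule poly_extI) (simp add: g_eq algebra_simps del: power_Suc)
  also have "g + smult c (poly_t * [:P, 0, 3:]) = smult (3 * c + 1) g + smult (- 2 * c * P) poly_t + [:- 3 * c * Q:]"
    by (rule poly_extI) (simp add: g_def algebra_simps)
  also have "g ^ n * \<dots> = smult (3 * c + 1) (g ^ Suc n) + smult (- 2 * c * P) (poly_t * g ^ n) + smult (- 3 * c * Q) (g ^ n)"
    by (rule poly_extI) (simp add: g_eq algebra_simps del: power_Suc)
  finally have "(3 * c + 1) * m0 (Suc n) - 2 * c * P * m1 n - 3 * c * Q * m0 n = 0"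
    using 0[of poly_t] by (simp add: seg_int_add seg_int_diff seg_int_smult m0_def m1_def del: power_Suc)
  thus "of_nat (3 * n + 4) * m0 (Suc n) = of_nat (Suc n) * (2 * P * m1 n + 3 * Q * m0 n)"
    unfolding c' c_def[symmetric] by (simp add: algebra_simps)
  have "pderiv (poly_t\<^sup>2 * g ^ Suc n) = g ^ n * (smult 2 poly_t * g + smult c (poly_t\<^sup>2 * [:P, 0, 3:]))"
    unfolding pderiv_mult dgn pderiv_poly_t by (rule poly_extI) (simp add: g_eq algebra_simps del: power_Suc)
  \<comment> \<open>The term in t^2 is traded for g', whose product with g^n is again a derivative
    of a polynomial that vanishes at both ends.\<close>
  also have "smult 2 poly_t * g + smult c (poly_t\<^sup>2 * [:P, 0, 3:]) =
      smult (3 * c + 2) (poly_t * g) + smult (- 3 * c * Q) poly_t + smult (- 2 / 3 * P) (smult c [:P, 0, 3:]) + [:2 / 3 * c * P\<^sup>2:]"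
    by (rule poly_extI) (simp add: g_def algebra_simps power2_eq_square)
  also have "g ^ n * \<dots> = smult (3 * c + 2) (poly_t * g ^ Suc n) + smult (- 3 * c * Q) (poly_t * g ^ n) +
      smult (- 2 / 3 * P) (pderiv (1 * g ^ Suc n)) + smult (2 / 3 * c * P\<^sup>2) (g ^ n)"
    unfolding mult_1 dgn by (rule poly_extI) (simp add: g_eq algebra_simps del: power_Suc)
  finally have "(3 * c + 2) * m1 (Suc n) - 3 * c * Q * m1 n + 2 / 3 * c * P\<^sup>2 * m0 n = 0"
    using 0[of "poly_t\<^sup>2"] 0[of 1] by (simp add: seg_int_add seg_int_diff seg_int_smult m0_def m1_def del: power_Suc mult_1)
  thus "3 * of_nat (3 * n + 5) * m1 (Suc n) = of_nat (Suc n) * (9 * Q * m1 n - 2 * P\<^sup>2 * m0 n)"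
    unfolding c' c_def[symmetric] by (simp add: field_simps)
qed

text \<open>The step from n to n + 1 multiplies the determinant by a non-zero multiple of 27 Q^2 + 4
  P^3, up to sign the discriminant of g, which is not 0 for distinct roots. For n = 0 the
  determinant is half a Vandermonde determinant.\<close>

lemma moment_det_nonzero:
  fixes P Q :: complex
  defines "g \<equiv> [:Q, P, 0, 1:]"
  assumes g: "g = cubic a b c" and "a + b + c = 0" and "a \<noteq> b" "b \<noteq> c" "c \<noteq> a"
  defines "m0 \<equiv> \<lambda>s t n. seg_int s t (g ^ n)" and "m1 \<equiv> \<lambda>s t n. seg_int s t (poly_t * g ^ n)"
  shows "m0 a b n * m1 b c n \<noteq> m0 b c n * m1 a b n"
proof (induction n)
  case 0
  have s1: "seg_int s t 1 = t - s" for s t :: complex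
    using seg_int_pderiv[of s t poly_t] by (simp add: pderiv_poly_t)
  have s2: "seg_int s t poly_t = (t\<^sup>2 - s\<^sup>2) / 2" for s t :: complex
    using seg_int_pderiv[of s t "smult (1 / 2) (poly_t\<^sup>2)"]
    by (simp add: pderiv_smult pderiv_poly_t poly_power diff_divide_distrib)
  have "m0 a b 0 * m1 b c 0 - m0 b c 0 * m1 a b 0 = (b - a) * (c - b) * (c - a) / 2"
    by (simp add: m0_def m1_def s1 s2) (simp add: power2_eq_square field_simps)
  thus ?case using assms by auto
next
  case (Suc n)
  have c: "c = - a - b" using assms(3) by (simp add: add_eq_0_iff algebra_simps)
  have PQ: "P = a * b + b * c + c * a" "Q = - a * b * c"
    using g assms(3) by (auto simp: g_def cubic_def algebra_simps)
  have roots: "poly g a = 0" "poly g b = 0" "poly g c = 0" by (simp_all add: g cubic_def del: mult_pCons_left mult_pCons_right)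
  note ab = moment_recurrence[OF roots(1,2)[unfolded g_def], of n, folded g_def]
  note bc = moment_recurrence[OF roots(2,3)[unfolded g_def], of n, folded g_def]
  define d where "d = m0 a b n * m1 b c n - m0 b c n * m1 a b n"
  have "27 * Q\<^sup>2 + 4 * P ^ 3 = - ((a - b) * (b - c) * (c - a))\<^sup>2"
    unfolding PQ c by algebra
  hence disc: "27 * Q\<^sup>2 + 4 * P ^ 3 \<noteq> 0" using assms(4-6) by simp
  have "(of_nat (3 * n + 4) * m0 a b (Suc n)) * (3 * of_nat (3 * n + 5) * m1 b c (Suc n)) -
      (of_nat (3 * n + 4) * m0 b c (Suc n)) * (3 * of_nat (3 * n + 5) * m1 a b (Suc n)) =
      (of_nat (Suc n))\<^sup>2 * ((27 * Q\<^sup>2 + 4 * P ^ 3) * d)"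
    unfolding m0_def m1_def ab bc d_def by algebra
  also have "\<dots> \<noteq> 0" using Suc.IH disc by (simp add: d_def del: of_nat_Suc)
  finally show ?case by auto
qed

text \<open>The first recurrence expresses the integrals of g^(N+1) by the two moments of g^N. In
  the dependency the terms with Q cancel, and P times a non-zero determinant remains, so P = 0. This
  is the equilateral triangle, a true exception.\<close>

lemma pade_consecutive_independent:
  assumes "x + y + z = 0" "x \<noteq> 0" "y \<noteq> 0" "z \<noteq> 0"
    and dep: "(x ^ (2 * N + 1) * pade N y z) * (z ^ (2 * Suc N + 1) * pade (Suc N) x y) =
      (z ^ (2 * N + 1) * pade N x y) * (x ^ (2 * Suc N + 1) * pade (Suc N) y z)"
  shows "x\<^sup>2 + x * y + y\<^sup>2 = 0"
proof -
  obtain a b c where abc: "b - c = x" "c - a = y" "a - b = z" "a + b + c = 0" "a \<noteq> b" "b \<noteq> c" "c \<noteq> a"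
    by (rule vertices[OF assms(1-4)])
  define P where "P = a * b + b * c + c * a"
  define Q where "Q = - a * b * c"
  define g where "g = [:Q, P, 0, 1:]"
  have c: "c = - a - b" using abc(4) by (simp add: add_eq_0_iff algebra_simps)
  have gc: "g = cubic a b c"
    unfolding g_def P_def Q_def cubic_def c by (rule poly_extI) (simp add: algebra_simps)
  have roots: "poly g a = 0" "poly g b = 0" "poly g c = 0" by (simp_all add: gc cubic_def del: mult_pCons_left mult_pCons_right)
  define K where "K n = (fact n ^ 3 / fact (3 * n + 1) :: complex)" for n
  have neg: "b - a = - z" "c - b = - x" "a - c = - y" using abc by auto
  have ab: "seg_int a b (g ^ n) = - K n * (z ^ (2 * n + 1) * pade n x y)"
    and bc: "seg_int b c (g ^ n) = - K n * (x ^ (2 * n + 1) * pade n y z)" for n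
    using seg_int_cubic_power[OF abc(5), of c n] seg_int_cubic_power[OF abc(6), of a n, folded cubic_rotate[of a]]
    by (simp_all add: abc neg K_def gc)
  let ?m0 = "\<lambda>s t n. seg_int s t (g ^ n)" and ?m1 = "\<lambda>s t n. seg_int s t (poly_t * g ^ n)"
  have "?m0 a b N * ?m0 b c (Suc N) = ?m0 b c N * ?m0 a b (Suc N)"
    using dep unfolding ab bc by (simp only: mult_ac minus_mult_left[symmetric] minus_mult_right[symmetric])
  hence "?m0 a b N * (of_nat (3 * N + 4) * ?m0 b c (Suc N)) = ?m0 b c N * (of_nat (3 * N + 4) * ?m0 a b (Suc N))"
    by (metis mult.left_commute)
  hence "of_nat (Suc N) * (?m0 a b N * (2 * P * ?m1 b c N + 3 * Q * ?m0 b c N)) =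
      of_nat (Suc N) * (?m0 b c N * (2 * P * ?m1 a b N + 3 * Q * ?m0 a b N))"
    unfolding moment_recurrence(1)[OF roots(1,2)[unfolded g_def], of N, folded g_def]
      moment_recurrence(1)[OF roots(2,3)[unfolded g_def], of N, folded g_def]
    by (metis mult.left_commute)
  hence "?m0 a b N * (2 * P * ?m1 b c N + 3 * Q * ?m0 b c N) = ?m0 b c N * (2 * P * ?m1 a b N + 3 * Q * ?m0 a b N)"
    by (simp del: of_nat_Suc)
  hence "P * (?m0 a b N * ?m1 b c N - ?m0 b c N * ?m1 a b N) = 0"
    by (simp add: algebra_simps)
  moreover have "?m0 a b N * ?m1 b c N - ?m0 b c N * ?m1 a b N \<noteq> 0"
    using moment_det_nonzero[OF gc[unfolded g_def] abc(4-7), of N, folded g_def] by simp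
  ultimately have "P = 0" by simp
  have "x\<^sup>2 + x * y + y\<^sup>2 = - 3 * P"
    unfolding P_def abc(1,2)[symmetric] c by (simp add: power2_eq_square algebra_simps)
  thus ?thesis using \<open>P = 0\<close> by simp
qed

section \<open>Heights of points on the line\<close>

definition max3 :: "(3 \<Rightarrow> 'v \<Rightarrow> real) \<Rightarrow> 'v \<Rightarrow> real" where
  "max3 X v = max (X 1 v) (max (X 2 v) (X 3 v))"

lemma max3_ge: "X i v \<le> max3 X v"
  using exhaust_3[of i] by (auto simp: max3_def)

lemma max3_le: "(\<And>i. X i v \<le> B) \<Longrightarrow> max3 X v \<le> B"
  by (simp add: max3_def)

definition pade_vec :: "nat \<Rightarrow> (3 \<Rightarrow> complex) \<Rightarrow> 3 \<Rightarrow> complex" where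
  "pade_vec N x i = (if i = 1 then pade N (x 2) (x 3) else if i = 2 then pade N (x 3) (x 1) else pade N (x 1) (x 2))"

text \<open>The summands of \<open>pade_relation\<close>. The degenerate case for y is that y is
  proportional to this vector; then the cross product vanishes.\<close>

definition pade_point :: "nat \<Rightarrow> (3 \<Rightarrow> complex) \<Rightarrow> 3 \<Rightarrow> complex" where
  "pade_point N x i = x i ^ (2 * N + 1) * pade_vec N x i"

context places
begin

definition units :: "complex set" where
  "units = {x \<in> R. x \<noteq> 0 \<and> inverse x \<in> R}"

lemma units_mult: "x \<in> units \<Longrightarrow> y \<in> units \<Longrightarrow> x * y \<in> units"
  and units_inverse: "x \<in> units \<Longrightarrow> inverse x \<in> units"
  and units_power: "x \<in> units \<Longrightarrow> x ^ n \<in> units"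
  and units_R: "x \<in> units \<Longrightarrow> x \<in> R" and units_nz: "x \<in> units \<Longrightarrow> x \<noteq> 0"
  by (auto simp: units_def simp flip: power_inverse)

lemma card_A: "card A > 0"
  using A_nonempty A_subset fin finite_subset by (auto simp: card_gt_0_iff)

context
  fixes v assumes v: "v \<in> V"
begin

lemma ab_nonneg: "x \<in> R \<Longrightarrow> ab v x \<ge> 0"
  using ab_pos[OF v, of x] v by (cases "x = 0") auto

lemma ab_1 [simp]: "ab v 1 = 1"
  using ab_mult[OF v one one] ab_pos[OF v one] by simp

lemma ab_uminus: "x \<in> R \<Longrightarrow> ab v (- x) = ab v x"
proof -
  assume x: "x \<in> R"
  have m: "- 1 \<in> R" by (rule uminus) simp
  have "ab v (- 1) * ab v (- 1) = 1" using ab_mult[OF v m m] by simp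
  moreover have "ab v (- 1) \<ge> 0" using ab_nonneg[OF m] .
  ultimately have "ab v (- 1) = 1" by (metis abs_of_nonneg real_sqrt_mult_self real_sqrt_one real_sqrt_mult)
  thus ?thesis using ab_mult[OF v m x] by simp
qed

lemma ab_power: "x \<in> R \<Longrightarrow> ab v (x ^ n) = ab v x ^ n"
  by (induction n) (auto simp: ab_mult[OF v] power)

lemma ln_ab_mult: "x \<in> units \<Longrightarrow> y \<in> units \<Longrightarrow> ln (ab v (x * y)) = ln (ab v x) + ln (ab v y)"
  using ab_pos[OF v] by (simp add: ab_mult[OF v] units_R units_nz ln_mult_pos)

lemma ln_ab_power: "x \<in> units \<Longrightarrow> ln (ab v (x ^ n)) = real n * ln (ab v x)"
  using ab_pos[OF v] by (simp add: ab_power units_R units_nz ln_realpow)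

lemma ln_ab_inverse: "x \<in> units \<Longrightarrow> ln (ab v (inverse x)) = - ln (ab v x)"
  using ln_ab_mult[of x "inverse x"] units_inverse[of x] by (simp add: units_nz)

lemma ab_sum_arch:
  assumes "v \<in> A" "\<And>i. i \<in> I \<Longrightarrow> f i \<in> R"
  shows "ab v (\<Sum>i\<in>I. f i) \<le> (\<Sum>i\<in>I. ab v (f i))"
  using assms(2)
proof (induction I rule: infinite_finite_induct)
  case (insert i I)
  have "ab v (f i + (\<Sum>i\<in>I. f i)) \<le> ab v (f i) + ab v (\<Sum>i\<in>I. f i)"
    using insert by (intro triangle assms(1)) auto
  thus ?case using insert by simp
qed (use v in auto)

lemma ab_sum_nonarch:
  assumes "v \<notin> A" "\<And>i. i \<in> I \<Longrightarrow> f i \<in> R" "\<And>i. i \<in> I \<Longrightarrow> ab v (f i) \<le> B" "B \<ge> 0"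
  shows "ab v (\<Sum>i\<in>I. f i) \<le> B"
  using assms(2,3)
proof (induction I rule: infinite_finite_induct)
  case (insert i I)
  have "ab v (f i + (\<Sum>i\<in>I. f i)) \<le> max (ab v (f i)) (ab v (\<Sum>i\<in>I. f i))"
    using insert assms(1) v by (intro ultrametric) auto
  also have "\<dots> \<le> B" using insert by simp
  finally show ?case using insert by simp
qed (use v assms(4) in auto)

lemma ab_of_nat_le: "ab v (of_nat n) \<le> (if v \<in> A then real n else 1)"
proof -
  have eq: "(of_nat n :: complex) = (\<Sum>i<n. 1)" by simp
  show ?thesis
  proof (cases "v \<in> A")
    case True
    thus ?thesis unfolding eq using ab_sum_arch[of "{..<n}" "\<lambda>_. 1"] by simp
  next
    case False
    thus ?thesis unfolding eq using ab_sum_nonarch[of "{..<n}" "\<lambda>_. 1" 1] by simp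
  qed
qed

text \<open>At an archimedean place the coefficients are at most 2^(N+k) 2^(2N-k) = 8^N and there
  are N + 1 <= 2^N terms, whence 16^N. At the other places integers cost nothing.\<close>

lemma ab_pade_le:
  assumes x: "x \<in> R" "ab v x \<le> M" and y: "y \<in> R" "ab v y \<le> M"
  shows "ab v (pade N x y) \<le> (if v \<in> A then 16 ^ N else 1) * M ^ N"
proof -
  have M: "M \<ge> 0" using ab_nonneg[OF x(1)] x(2) by simp
  define c where "c k = ((N + k) choose N) * ((2 * N - k) choose N)" for k
  define f where "f k = of_nat (c k) * ((- x) ^ k * y ^ (N - k))" for k
  have fR: "f k \<in> R" for k
    unfolding f_def by (intro mult of_nat power uminus x y)
  have "ab v ((- x) ^ k * y ^ (N - k)) \<le> M ^ N" if "k \<le> N" for k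
  proof -
    have "ab v ((- x) ^ k * y ^ (N - k)) = ab v x ^ k * ab v y ^ (N - k)"
      using x y by (simp add: ab_mult[OF v] ab_power ab_uminus power uminus)
    also have "\<dots> \<le> M ^ k * M ^ (N - k)"
      using x y M by (intro mult_mono power_mono zero_le_power ab_nonneg) auto
    also have "\<dots> = M ^ N" using that by (simp flip: power_add)
    finally show ?thesis .
  qed
  moreover have "ab v (f k) = ab v (of_nat (c k)) * ab v ((- x) ^ k * y ^ (N - k))" for k
    unfolding f_def by (intro ab_mult[OF v] of_nat mult power uminus x y)
  ultimately have f_le: "ab v (f k) \<le> ab v (of_nat (c k)) * M ^ N" if "k \<le> N" for k
    using that by (simp add: mult_left_mono ab_nonneg)
  have pade: "pade N x y = (\<Sum>k\<le>N. f k)" by (simp add: pade_def f_def c_def)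
  show ?thesis
  proof (cases "v \<in> A")
    case True
    have "ab v (f k) \<le> 8 ^ N * M ^ N" if k: "k \<le> N" for k
    proof -
      have "c k \<le> 2 ^ (N + k) * 2 ^ (2 * N - k)"
        unfolding c_def by (intro mult_le_mono binomial_le_pow2)
      also have "\<dots> = (2 ^ (3 * N) :: nat)" using k by (simp flip: power_add)
      also have "\<dots> = 8 ^ N" by (simp add: power_mult)
      finally have "real (c k) \<le> 8 ^ N" by (metis of_nat_le_iff of_nat_numeral of_nat_power)
      moreover have "ab v (of_nat (c k)) \<le> real (c k)" using ab_of_nat_le[of "c k"] True by simp
      ultimately have "ab v (of_nat (c k)) \<le> 8 ^ N" by (rule order_trans[rotated])
      hence "ab v (of_nat (c k)) * M ^ N \<le> 8 ^ N * M ^ N" using M by (intro mult_right_mono) auto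
      thus ?thesis using f_le[OF k] by linarith
    qed
    hence "(\<Sum>k\<le>N. ab v (f k)) \<le> (\<Sum>k\<le>N. 8 ^ N * M ^ N)" by (intro sum_mono) auto
    also have "\<dots> = real (N + 1) * 8 ^ N * M ^ N" by simp
    also have "\<dots> \<le> 2 ^ N * 8 ^ N * M ^ N"
    proof (intro mult_right_mono)
      have "N + 1 \<le> 2 ^ N" by (induction N) auto
      thus "real (N + 1) \<le> 2 ^ N" by (metis of_nat_le_iff of_nat_numeral of_nat_power)
    qed (use M in auto)
    also have "(2 :: real) ^ N * 8 ^ N = 16 ^ N" by (simp flip: power_mult_distrib)
    finally show ?thesis using ab_sum_arch[where I = "{..N}" and f = f, OF True fR] True unfolding pade by simp
  next
    case False
    have "ab v (f k) \<le> M ^ N" if "k \<le> N" for k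
    proof -
      have "ab v (of_nat (c k)) * M ^ N \<le> 1 * M ^ N"
        using ab_of_nat_le[of "c k"] False M by (intro mult_right_mono) auto
      thus ?thesis using f_le[OF that] by linarith
    qed
    thus ?thesis using ab_sum_nonarch[where I = "{..N}" and f = f and B = "M ^ N", OF False fR] False M
      unfolding pade by simp
  qed
qed

lemma ab_cross_le:
  assumes "a \<in> R" "b \<in> R" "c \<in> R" "d \<in> R" "ab v a \<le> B" "ab v c \<le> B" "ab v b \<le> C" "ab v d \<le> C"
  shows "ab v (a * b - c * d) \<le> (if v \<in> A then 2 else 1) * (B * C)"
proof -
  have BC: "ab v (a * b) \<le> B * C" "ab v (- (c * d)) \<le> B * C"
    using assms ab_nonneg[OF assms(1)] ab_nonneg[OF assms(2)] ab_nonneg[OF assms(3)] ab_nonneg[OF assms(4)]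
    by (auto simp: ab_mult[OF v] ab_uminus mult intro!: mult_mono)
  have R: "a * b \<in> R" "- (c * d) \<in> R" using assms by auto
  show ?thesis
  proof (cases "v \<in> A")
    case True
    from triangle[OF this R] show ?thesis using BC True by simp
  next
    case False
    hence "v \<in> V - A" using v by simp
    from ultrametric[OF this R] show ?thesis using BC False by simp
  qed
qed

end

definition log_abs :: "(3 \<Rightarrow> complex) \<Rightarrow> 3 \<Rightarrow> 'v \<Rightarrow> real" where
  "log_abs x i v = ln (ab v (x i))"

text \<open>For X = \<open>log_abs x\<close> this is the projective height of x. It is defined for
  arbitrary vectors of local values so that multiplication of exponents by any real number, also a
  negative one, makes sense.\<close>

definition H :: "(3 \<Rightarrow> 'v \<Rightarrow> real) \<Rightarrow> real" where
  "H X = (\<Sum>v\<in>V. max3 X v) / card A"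

lemma sum_ln_units: "x \<in> units \<Longrightarrow> (\<Sum>v\<in>V. ln (ab v x)) = 0"
proof -
  assume x: "x \<in> units"
  have "0 \<le> (\<Sum>v\<in>V. ln (ab v x))" "0 \<le> (\<Sum>v\<in>V. ln (ab v (inverse x)))"
    by (rule sum_ln_nonneg[OF units_R[OF x] units_nz[OF x]],
        rule sum_ln_nonneg[OF units_R[OF units_inverse[OF x]] units_nz[OF units_inverse[OF x]]])
  moreover have "(\<Sum>v\<in>V. ln (ab v (inverse x))) = - (\<Sum>v\<in>V. ln (ab v x))"
    using x by (simp add: ln_ab_inverse sum_negf)
  ultimately show ?thesis by simp
qed

text \<open>The factor N + 1 is (2N + 1) - N: the vector s has height (2N + 1) h(x), and the forms W
  cost N h(x). The constant is the logarithm of 2 times 16^N, where 2 counts the terms of an entry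
  of the cross product and 16^N comes from the forms.\<close>

lemma pade_inequality:
  fixes x y :: "3 \<Rightarrow> complex"
  assumes x: "\<And>i. x i \<in> units" "x 1 + x 2 + x 3 = 0"
    and y: "\<And>i. y i \<in> units" "y 1 + y 2 + y 3 = 0"
    and nondeg: "y i0 * pade_point N x j0 \<noteq> y j0 * pade_point N x i0"
  shows "real (N + 1) * H (log_abs x) \<le>
    H (\<lambda>i v. log_abs y i v - real (2 * N + 1) * log_abs x i v) + real (4 * N + 1) * ln 2"
proof -
  define s where "s i = x i ^ (2 * N + 1)" for i
  define l where "l i = y i * inverse (s i)" for i
  define W where "W = pade_vec N x"
  define D where "D i = (if i = 1 then l 2 * W 3 - l 3 * W 2 else if i = 2 then l 3 * W 1 - l 1 * W 3
    else l 1 * W 2 - l 2 * W 1)" for i :: 3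
  define L where "L i v = log_abs y i v - real (2 * N + 1) * log_abs x i v" for i v
  have neq: "(2 :: 3) \<noteq> 1" "(3 :: 3) \<noteq> 1" "(3 :: 3) \<noteq> 2" by auto
  have s: "s i \<in> units" for i unfolding s_def by (rule units_power) (rule x)
  have l: "l i \<in> units" for i unfolding l_def by (intro units_mult units_inverse s y)
  have snz: "s i \<noteq> 0" for i using s units_nz by blast
  have W_R: "W i \<in> R" for i
    unfolding W_def pade_vec_def pade_def using x(1) units_R by (auto intro!: sum mult of_nat power)
  have D_R: "D i \<in> R" for i unfolding D_def using l[THEN units_R] W_R by auto
  have sly: "s i * l i = y i" for i using snz by (simp add: l_def)
  hence sl: "s 1 * l 1 + s 2 * l 2 + s 3 * l 3 = 0" using y(2) by simp
  have sW: "s 1 * W 1 + s 2 * W 2 + s 3 * W 3 = 0"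
    using pade_relation[OF x(2) x(1)[THEN units_nz] x(1)[THEN units_nz] x(1)[THEN units_nz], of N]
    by (simp add: s_def W_def pade_vec_def)
  have cross: "s i * D j = s j * D i" for i j
  proof -
    have "s 1 * D 2 = s 2 * D 1" "s 1 * D 3 = s 3 * D 1" "s 2 * D 3 = s 3 * D 2"
      using sl sW unfolding D_def by (simp_all add: neq) algebra+
    thus ?thesis using exhaust_3[of i] exhaust_3[of j] by auto
  qed
  have "\<exists>i. D i \<noteq> 0"
  proof (rule ccontr)
    assume "\<not> ?thesis"
    hence "D 1 = 0" "D 2 = 0" "D 3 = 0" by auto
    hence "l 2 * W 3 = l 3 * W 2" "l 3 * W 1 = l 1 * W 3" "l 1 * W 2 = l 2 * W 1"
      by (simp_all add: D_def)
    hence lW: "l i * W j = l j * W i" for i j using exhaust_3[of i] exhaust_3[of j] by auto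
    have "s i0 * l i0 * (s j0 * W j0) = (s i0 * s j0) * (l i0 * W j0)" by (simp only: mult_ac)
    also have "\<dots> = s j0 * l j0 * (s i0 * W i0)" unfolding lW[of i0 j0] by (simp only: mult_ac)
    finally have "s i0 * l i0 * (s j0 * W j0) = s j0 * l j0 * (s i0 * W i0)" .
    hence "y i0 * pade_point N x j0 = y j0 * pade_point N x i0"
      unfolding sly by (simp only: pade_point_def W_def s_def)
    with nondeg show False by blast
  qed
  then obtain j where j: "D j \<noteq> 0" ..
  have Dnz: "D i \<noteq> 0" for i using cross[of i j] j snz by (metis mult_eq_0_iff)
  \<comment> \<open>The difference of the logarithms of s i and D i does not depend on i, so the
    index attaining the maximum may vary with v.\<close>
  have ln_s: "ln (ab v (s i)) = ln (ab v (D i)) + (ln (ab v (s j)) - ln (ab v (D j)))" if v: "v \<in> V" for v i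
  proof -
    have "ln (ab v (s i * D j)) = ln (ab v (s j * D i))" by (simp add: cross)
    thus ?thesis
      using ab_pos[OF v D_R Dnz] ab_pos[OF v units_R[OF s] snz]
      by (simp add: ab_mult[OF v units_R[OF s] D_R] ln_mult_pos)
  qed
  have ln_s': "ln (ab v (s i)) = real (2 * N + 1) * log_abs x i v" if "v \<in> V" for v i
    unfolding s_def log_abs_def by (rule ln_ab_power[OF that x(1)])
  have ln_l: "ln (ab v (l i)) = L i v" if v: "v \<in> V" for v i
    unfolding l_def ln_ab_mult[OF v y(1) units_inverse[OF s]] ln_ab_inverse[OF v s] ln_s'[OF v]
    by (simp add: L_def log_abs_def)
  have D_le: "ln (ab v (D i)) \<le> max3 L v + real N * max3 (log_abs x) v + (if v \<in> A then real (4 * N + 1) * ln 2 else 0)"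
    if v: "v \<in> V" for v i
  proof -
    define M where "M = exp (max3 (log_abs x) v)"
    define B where "B = exp (max3 L v)"
    have le_exp: "t \<le> exp b" if "0 < t" "ln t \<le> b" for t b :: real
      using that by (metis exp_le_cancel_iff exp_ln)
    have xM: "ab v (x i) \<le> M" for i
      unfolding M_def
      by (rule le_exp[OF ab_pos[OF v units_R[OF x(1)] units_nz[OF x(1)]]])
         (rule max3_ge[of "log_abs x" i v, unfolded log_abs_def[of x i v]])
    have lB: "ab v (l i) \<le> B" for i
      unfolding B_def
      by (rule le_exp[OF ab_pos[OF v units_R[OF l] units_nz[OF l]]])
         (rule max3_ge[of L i v, folded ln_l[OF v]])
    define C where "C = (if v \<in> A then 16 ^ N else 1) * M ^ N"
    have "ab v (pade N (x i) (x j)) \<le> C" for i j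
      unfolding C_def by (rule ab_pade_le[OF v units_R[OF x(1)] xM units_R[OF x(1)] xM])
    hence WC: "ab v (W i) \<le> C" for i by (simp add: W_def pade_vec_def)
    define C' where "C' = (if v \<in> A then 2 else 1) * (B * C)"
    have "ab v (l i * W j - l h * W k) \<le> C'" for i j h k
      unfolding C'_def by (rule ab_cross_le[OF v units_R[OF l] W_R units_R[OF l] W_R lB lB WC WC])
    hence "ab v (D i) \<le> C'" by (simp add: D_def)
    moreover have "ab v (D i) > 0" by (rule ab_pos[OF v D_R Dnz])
    ultimately have "ln (ab v (D i)) \<le> ln C'" by (subst ln_le_cancel_iff) auto
    also have "\<dots> = max3 L v + real N * max3 (log_abs x) v + (if v \<in> A then real (4 * N + 1) * ln 2 else 0)"
    proof -
      have "ln (M ^ N) = real N * max3 (log_abs x) v" "ln B = max3 L v" "M > 0" "B > 0"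
        by (simp_all add: M_def B_def ln_realpow)
      moreover have "ln (16 ^ N :: real) = real (4 * N) * ln 2"
      proof -
        have "(16 :: real) ^ N = 2 ^ (4 * N)" by (simp add: power_mult)
        thus ?thesis by (simp add: ln_realpow)
      qed
      ultimately show ?thesis by (simp add: C_def C'_def ln_mult_pos algebra_simps)
    qed
    finally show ?thesis .
  qed
  have "real (2 * N + 1) * max3 (log_abs x) v \<le> max3 L v + real N * max3 (log_abs x) v
      + (if v \<in> A then real (4 * N + 1) * ln 2 else 0) + (ln (ab v (s j)) - ln (ab v (D j)))"
    if v: "v \<in> V" for v
  proof -
    obtain i where i: "max3 (log_abs x) v = log_abs x i v"
      unfolding max3_def by (metis max_def)
    show ?thesis using D_le[OF v, of i] ln_s[OF v, of i] unfolding ln_s'[OF v, of i] i by linarith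
  qed
  hence "(\<Sum>v\<in>V. real (2 * N + 1) * max3 (log_abs x) v) \<le> (\<Sum>v\<in>V. max3 L v + real N * max3 (log_abs x) v
      + (if v \<in> A then real (4 * N + 1) * ln 2 else 0) + (ln (ab v (s j)) - ln (ab v (D j))))"
    by (rule sum_mono)
  also have "\<dots> = (\<Sum>v\<in>V. max3 L v) + real N * (\<Sum>v\<in>V. max3 (log_abs x) v)
      + (\<Sum>v\<in>V. if v \<in> A then real (4 * N + 1) * ln 2 else 0)
      + ((\<Sum>v\<in>V. ln (ab v (s j))) - (\<Sum>v\<in>V. ln (ab v (D j))))"
    by (simp only: sum.distrib sum_subtractf sum_distrib_left)
  also have "(\<Sum>v\<in>V. if v \<in> A then real (4 * N + 1) * ln 2 else 0) = card A * (real (4 * N + 1) * ln 2)"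
  proof -
    have "V \<inter> A = A" using A_subset by auto
    thus ?thesis using fin by (simp add: sum.If_cases)
  qed
  also have "(\<Sum>v\<in>V. ln (ab v (s j))) = 0" by (rule sum_ln_units[OF s])
  \<comment> \<open>The unit s j contributes 0. Of D j only membership in R is known, but its sum is
    non-negative and enters with a minus sign.\<close>
  finally have "real (2 * N + 1) * (\<Sum>v\<in>V. max3 (log_abs x) v) \<le> (\<Sum>v\<in>V. max3 L v)
      + real N * (\<Sum>v\<in>V. max3 (log_abs x) v) + card A * (real (4 * N + 1) * ln 2)"
    using sum_ln_nonneg[OF D_R Dnz, of j] by (simp add: sum_distrib_left)
  hence "real (N + 1) * (\<Sum>v\<in>V. max3 (log_abs x) v) \<le> (\<Sum>v\<in>V. max3 L v) + card A * (real (4 * N + 1) * ln 2)"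
    by (simp add: algebra_simps)
  hence "real (N + 1) * (\<Sum>v\<in>V. max3 (log_abs x) v) / card A \<le>
      ((\<Sum>v\<in>V. max3 L v) + card A * (real (4 * N + 1) * ln 2)) / card A"
    by (intro divide_right_mono) auto
  thus ?thesis using card_A unfolding H_def L_def by (simp add: add_divide_distrib)
qed

section \<open>Comparison of heights by means of the product formula\<close>

lemma H_add: "H (\<lambda>i v. X i v + Y i v) \<le> H X + H Y"
proof -
  have "(\<Sum>v\<in>V. max3 (\<lambda>i v. X i v + Y i v) v) \<le> (\<Sum>v\<in>V. max3 X v + max3 Y v)"
    by (intro sum_mono max3_le add_mono max3_ge)
  thus ?thesis using card_A by (simp add: H_def sum.distrib divide_right_mono flip: add_divide_distrib)
qed

lemma H_scale:
  assumes "s \<ge> 0"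
  shows "H (\<lambda>i v. s * X i v) = s * H X"
proof -
  have "max3 (\<lambda>i v. s * X i v) v = s * max3 X v" for v
    using assms by (simp add: max3_def max_mult_distrib_left)
  thus ?thesis by (simp add: H_def flip: sum_distrib_left)
qed

text \<open>The product formula as a property of X that passes to negatives; the comparisons of
  heights below rest on it.\<close>

definition balanced :: "(3 \<Rightarrow> 'v \<Rightarrow> real) \<Rightarrow> bool" where
  "balanced X \<longleftrightarrow> (\<forall>i. (\<Sum>v\<in>V. X i v) = 0)"

definition ratio_height :: "(3 \<Rightarrow> 'v \<Rightarrow> real) \<Rightarrow> 3 \<Rightarrow> 3 \<Rightarrow> real" where
  "ratio_height X i j = (\<Sum>v\<in>V. max 0 (X i v - X j v)) / card A"

lemma balanced_log_abs: "(\<And>i. x i \<in> units) \<Longrightarrow> balanced (log_abs x)"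
  by (simp add: balanced_def log_abs_def sum_ln_units)

lemma ratio_height_uminus: "ratio_height (\<lambda>i v. - X i v) i j = ratio_height X j i"
  by (simp add: ratio_height_def)

context
  fixes X assumes bal: "balanced X"
begin

lemma ratio_height_commute: "ratio_height X i j = ratio_height X j i"
proof -
  have "(\<Sum>v\<in>V. max 0 (X i v - X j v)) - (\<Sum>v\<in>V. max 0 (X j v - X i v)) = (\<Sum>v\<in>V. X i v - X j v)"
    unfolding sum_subtractf[symmetric] by (intro sum.cong) auto
  also have "\<dots> = 0" using bal by (simp add: sum_subtractf balanced_def)
  finally show ?thesis by (simp add: ratio_height_def)
qed

text \<open>Adding X j v, whose sum over v is 0, turns each summand on the left into a maximum of
  two coordinates.\<close>

lemma ratio_height_le_H: "ratio_height X i j \<le> H X"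
proof -
  have "(\<Sum>v\<in>V. max 0 (X i v - X j v)) = (\<Sum>v\<in>V. max 0 (X i v - X j v) + X j v)"
    using bal by (simp add: sum.distrib balanced_def)
  also have "\<dots> \<le> (\<Sum>v\<in>V. max3 X v)"
    using max3_ge[of X i] max3_ge[of X j] by (intro sum_mono) (auto simp: max_def)
  finally show ?thesis by (simp add: H_def ratio_height_def divide_right_mono)
qed

lemma H_le_ratio_heights: "H X \<le> ratio_height X 2 1 + ratio_height X 3 1"
proof -
  have "(\<Sum>v\<in>V. max3 X v) \<le> (\<Sum>v\<in>V. X 1 v + (max 0 (X 2 v - X 1 v) + max 0 (X 3 v - X 1 v)))"
    by (intro sum_mono) (auto simp: max3_def max_def)
  also have "\<dots> = (\<Sum>v\<in>V. max 0 (X 2 v - X 1 v)) + (\<Sum>v\<in>V. max 0 (X 3 v - X 1 v))"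
    using bal by (simp add: sum.distrib balanced_def)
  finally show ?thesis unfolding H_def ratio_height_def add_divide_distrib[symmetric]
    by (intro divide_right_mono) auto
qed

text \<open>For three real numbers, twice the difference of maximum and minimum is the sum of the
  pairwise distances. Separate bounds for the two heights would only give 4 times the largest ratio
  height instead of 3 times.\<close>

lemma H_plus_H_uminus_le:
  "H X + H (\<lambda>i v. - X i v) \<le> ratio_height X 1 2 + ratio_height X 1 3 + ratio_height X 2 3"
proof -
  have "(\<Sum>v\<in>V. 2 * (max3 X v + max3 (\<lambda>i v. - X i v) v)) \<le>
    (\<Sum>v\<in>V. (max 0 (X 1 v - X 2 v) + max 0 (X 2 v - X 1 v)) + (max 0 (X 1 v - X 3 v) + max 0 (X 3 v - X 1 v))
      + (max 0 (X 2 v - X 3 v) + max 0 (X 3 v - X 2 v)))"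
    by (intro sum_mono) (auto simp: max3_def max_def)
  hence "2 * (H X + H (\<lambda>i v. - X i v)) \<le> (ratio_height X 1 2 + ratio_height X 2 1) +
      (ratio_height X 1 3 + ratio_height X 3 1) + (ratio_height X 2 3 + ratio_height X 3 2)"
    unfolding H_def ratio_height_def add_divide_distrib[symmetric] times_divide_eq_right
    by (intro divide_right_mono) (simp_all add: sum.distrib sum_distrib_left)
  thus ?thesis
    unfolding ratio_height_commute[of 2 1] ratio_height_commute[of 3 1] ratio_height_commute[of 3 2]
    by argo
qed

text \<open>-X belongs to the coordinatewise inverse, projectively (x_2 x_3 : x_3 x_1 : x_1 x_2), a
  map of degree 2. Hence a negative exponent of \<alpha> costs up to twice as much as a positive
  one.\<close>

lemma H_uminus_le: "H (\<lambda>i v. - X i v) \<le> 2 * H X"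
proof -
  have "balanced (\<lambda>i v. - X i v)" using bal by (simp add: balanced_def sum_negf)
  from places.H_le_ratio_heights[OF places_axioms this] show ?thesis
    using ratio_height_le_H[of 1 2] ratio_height_le_H[of 1 3] by (simp add: ratio_height_uminus)
qed

end

lemma weil_height_ratio:
  assumes "\<And>i. x i \<in> units"
  shows "weil_height (x i / x j) = ratio_height (log_abs x) i j"
proof -
  have u: "x i / x j \<in> units" using units_mult[OF assms units_inverse[OF assms]] by (simp add: field_simps)
  have "ln (max 1 (ab v (x i / x j))) = max 0 (log_abs x i v - log_abs x j v)" if v: "v \<in> V" for v
  proof -
    have "ln (ab v (x i / x j)) = log_abs x i v - log_abs x j v"
      using ln_ab_mult[OF v assms units_inverse[OF assms], of i j] ln_ab_inverse[OF v assms]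
      by (simp add: log_abs_def divide_inverse)
    moreover have "ab v (x i / x j) > 0" using ab_pos[OF v units_R[OF u] units_nz[OF u]] .
    moreover from this have "1 \<le> ab v (x i / x j) \<longleftrightarrow> 0 \<le> ln (ab v (x i / x j))" by simp
    ultimately show ?thesis by (auto simp: max_def)
  qed
  hence "weil_height (x i / x j) * card A = (\<Sum>v\<in>V. max 0 (log_abs x i v - log_abs x j v))"
    by (simp add: weil_height_eq[OF units_R[OF u]])
  thus ?thesis using card_A by (simp add: ratio_height_def field_simps)
qed

text \<open>Both Pade vectors are proportional to y, hence to each other, which leaves only the
  equilateral case. There the three coordinates have the same cube, so they agree in absolute value
  at every place, and the height is 0 by the product formula.\<close>

lemma H_eq_0_if_degenerate:
  assumes x: "\<And>i. x i \<in> units" "x 1 + x 2 + x 3 = 0" and y: "\<And>i. y i \<in> units"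
    and deg: "\<And>i j. y i * pade_point N x j = y j * pade_point N x i"
      "\<And>i j. y i * pade_point (Suc N) x j = y j * pade_point (Suc N) x i"
  shows "H (log_abs x) = 0"
proof -
  have neq: "(2 :: 3) \<noteq> 1" "(3 :: 3) \<noteq> 1" "(3 :: 3) \<noteq> 2" by auto
  have ynz: "y i \<noteq> 0" for i using y units_nz by blast
  have "(y 1 * y 3) * (pade_point N x 1 * pade_point (Suc N) x 3) =
      (y 3 * pade_point N x 1) * (y 1 * pade_point (Suc N) x 3)" by (simp add: mult_ac)
  also have "\<dots> = (y 1 * pade_point N x 3) * (y 3 * pade_point (Suc N) x 1)"
    unfolding deg(1)[of 3 1] deg(2)[of 1 3] ..
  also have "\<dots> = (y 1 * y 3) * (pade_point N x 3 * pade_point (Suc N) x 1)" by (simp add: mult_ac)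
  finally have "pade_point N x 1 * pade_point (Suc N) x 3 = pade_point N x 3 * pade_point (Suc N) x 1"
    using ynz by simp
  hence q: "(x 1)\<^sup>2 + x 1 * x 2 + (x 2)\<^sup>2 = 0"
    unfolding pade_point_def pade_vec_def
    by (intro pade_consecutive_independent[OF x(2) x(1)[THEN units_nz] x(1)[THEN units_nz] x(1)[THEN units_nz]])
       (simp add: neq)
  have x3: "x 3 = - x 1 - x 2" using x(2) by (simp add: add_eq_0_iff algebra_simps)
  have "x 2 ^ 3 = x 1 ^ 3" using q by algebra
  moreover have "x 3 ^ 3 = x 1 ^ 3" unfolding x3 using q by algebra
  ultimately have cube: "x i ^ 3 = x 1 ^ 3" for i using exhaust_3[of i] by auto
  have eq: "log_abs x i v = log_abs x 1 v" if v: "v \<in> V" for i v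
    using ln_ab_power[OF v x(1), of i 3] ln_ab_power[OF v x(1), of 1 3] unfolding cube[of i] log_abs_def by simp
  have "max3 (log_abs x) v = log_abs x 1 v" if v: "v \<in> V" for v
    unfolding max3_def eq[OF v, of 2] eq[OF v, of 3] by simp
  hence "H (log_abs x) = (\<Sum>v\<in>V. log_abs x 1 v) / card A" unfolding H_def by (simp cong: sum.cong)
  also have "\<dots> = 0" using balanced_log_abs[of x, OF x(1)] by (simp add: balanced_def)
  finally show ?thesis .
qed

definition term_vec :: "(3 \<Rightarrow> complex) \<Rightarrow> (3 \<Rightarrow> complex) \<Rightarrow> nat \<Rightarrow> 3 \<Rightarrow> complex" where
  "term_vec \<alpha> c n i = c i * \<alpha> i ^ n"

context
  fixes \<alpha> c :: "3 \<Rightarrow> complex"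
  assumes \<alpha>: "\<And>i. \<alpha> i \<in> units" and c: "\<And>i. c i \<in> units"
begin

lemma term_vec_units: "term_vec \<alpha> c n i \<in> units"
  unfolding term_vec_def by (intro units_mult units_power \<alpha> c)

lemma log_abs_term_vec: "v \<in> V \<Longrightarrow> log_abs (term_vec \<alpha> c n) i v = real n * log_abs \<alpha> i v + log_abs c i v"
  unfolding log_abs_def term_vec_def by (simp add: ln_ab_mult ln_ab_power units_power \<alpha> c)

end

lemma H_cong: "(\<And>i v. v \<in> V \<Longrightarrow> X i v = Y i v) \<Longrightarrow> H X = H Y"
  unfolding H_def by (intro arg_cong2[where f = "(/)"] sum.cong refl) (simp add: max3_def)

lemma H_term_vec_ge:
  assumes \<alpha>: "\<And>i. \<alpha> i \<in> units" and c: "\<And>i. c i \<in> units"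
  shows "real n * H (log_abs \<alpha>) \<le> H (log_abs (term_vec \<alpha> c n)) + H (\<lambda>i v. - log_abs c i v)"
proof -
  have "real n * H (log_abs \<alpha>) = H (\<lambda>i v. real n * log_abs \<alpha> i v)" by (simp add: H_scale)
  also have "\<dots> = H (\<lambda>i v. log_abs (term_vec \<alpha> c n) i v + - log_abs c i v)"
    by (intro H_cong) (simp add: log_abs_term_vec[OF \<alpha> c])
  also have "\<dots> \<le> H (log_abs (term_vec \<alpha> c n)) + H (\<lambda>i v. - log_abs c i v)" by (rule H_add)
  finally show ?thesis .
qed

text \<open>The vector y / x^(2N+1) is \<alpha>^\<delta> times d / c^(2N+1), which costs 2N + 1
  times the height of 1/c; replacing the height of x by n h costs this height another N + 1 times.
  The factor 2 for negative \<delta> is that of \<open>H_uminus_le\<close>.\<close>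

lemma gap_inequality:
  fixes n m N :: nat
  assumes \<alpha>: "\<And>i. \<alpha> i \<in> units" and c: "\<And>i. c i \<in> units" and d: "\<And>i. d i \<in> units"
  defines "x \<equiv> term_vec \<alpha> c n" and "y \<equiv> term_vec \<alpha> d m"
  assumes "x 1 + x 2 + x 3 = 0" "y 1 + y 2 + y 3 = 0"
    and nondeg: "y i0 * pade_point N x j0 \<noteq> y j0 * pade_point N x i0"
  defines "h \<equiv> H (log_abs \<alpha>)" and "\<delta> \<equiv> real m - real (2 * N + 1) * real n"
  shows "real (N + 1) * (real n * h) \<le> max (\<delta> * h) (- 2 * \<delta> * h) + H (log_abs d)
    + real (3 * N + 2) * H (\<lambda>i v. - log_abs c i v) + real (4 * N + 1) * ln 2"
proof -
  let ?c' = "\<lambda>i v. - log_abs c i v"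
  let ?k = "real (2 * N + 1)"
  have 1: "real (N + 1) * H (log_abs x) \<le> H (\<lambda>i v. log_abs y i v - ?k * log_abs x i v) + real (4 * N + 1) * ln 2"
    by (rule pade_inequality[OF _ assms(6) _ assms(7) nondeg])
       (auto simp: x_def y_def intro!: term_vec_units \<alpha> c d)
  have "H (\<lambda>i v. log_abs y i v - ?k * log_abs x i v) = H (\<lambda>i v. \<delta> * log_abs \<alpha> i v + (log_abs d i v + ?k * ?c' i v))"
    by (intro H_cong) (simp add: x_def y_def log_abs_term_vec[OF \<alpha> c] log_abs_term_vec[OF \<alpha> d] \<delta>_def algebra_simps)
  also have "\<dots> \<le> H (\<lambda>i v. \<delta> * log_abs \<alpha> i v) + (H (log_abs d) + H (\<lambda>i v. ?k * ?c' i v))"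
    by (intro order_trans[OF H_add] add_left_mono H_add)
  also have "H (\<lambda>i v. ?k * ?c' i v) = ?k * H ?c'" by (rule H_scale) simp
  also have "H (\<lambda>i v. \<delta> * log_abs \<alpha> i v) \<le> max (\<delta> * h) (- 2 * \<delta> * h)"
  proof (cases "\<delta> \<ge> 0")
    case True
    thus ?thesis by (simp add: H_scale h_def)
  next
    case False
    have "H (\<lambda>i v. \<delta> * log_abs \<alpha> i v) = H (\<lambda>i v. (- \<delta>) * - log_abs \<alpha> i v)" by simp
    also have "\<dots> = - \<delta> * H (\<lambda>i v. - log_abs \<alpha> i v)" using False by (intro H_scale) simp
    also have "\<dots> \<le> - \<delta> * (2 * h)"
      using False H_uminus_le[OF balanced_log_abs[of \<alpha>, OF \<alpha>]] unfolding h_def by (intro mult_left_mono) auto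
    finally show ?thesis by simp
  qed
  finally have 2: "H (\<lambda>i v. log_abs y i v - ?k * log_abs x i v) \<le>
      max (\<delta> * h) (- 2 * \<delta> * h) + (H (log_abs d) + ?k * H ?c')" by simp
  have "real (N + 1) * (real n * h) \<le> real (N + 1) * (H (log_abs x) + H ?c')"
    using H_term_vec_ge[OF \<alpha> c] unfolding h_def x_def by (intro mult_left_mono) auto
  thus ?thesis using 1 2 by (simp add: algebra_simps)
qed

end

section \<open>Counting zeros\<close>

lemma pade_point_0: "pade_point 0 x i = x i"
  by (simp add: pade_point_def pade_vec_def pade_def)

text \<open>For N = 0 the Pade vector is x itself, so degeneracy makes x and y proportional; this is
  an equivalence of c and d by the translation m - n.\<close>

lemma (in places) inequivalent_nondegenerate:
  fixes \<alpha> c d :: "complex ^ 3" and n m :: nat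
  assumes units: "\<And>i. \<alpha> $ i \<in> units" "\<And>i. c $ i \<in> units" "\<And>i. d $ i \<in> units"
    and ineq: "\<not> equivalent_coeffs \<alpha> c d"
  defines "x \<equiv> term_vec (($) \<alpha>) (($) c) n" and "y \<equiv> term_vec (($) \<alpha>) (($) d) m"
  shows "\<exists>i j. y i * pade_point 0 x j \<noteq> y j * pade_point 0 x i"
proof (rule ccontr)
  assume "\<not> ?thesis"
  hence proportional: "y i * x j = y j * x i" for i j by (simp add: pade_point_0)
  have xu: "x i \<in> units" and yu: "y i \<in> units" for i
    unfolding x_def y_def by (rule term_vec_units; rule units)+
  define \<mu> where "\<mu> = x 1 * inverse (y 1)"
  have \<mu>: "\<mu> \<in> units" unfolding \<mu>_def by (intro units_mult units_inverse xu yu)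
  have "c $ i = \<mu> * (\<alpha> $ i) powi (int m - int n) * d $ i" for i
  proof -
    have nz: "\<alpha> $ i \<noteq> 0" "y 1 \<noteq> 0" using units yu units_nz by blast+
    have "x i = \<mu> * y i" using proportional[of 1 i] nz(2) by (simp add: \<mu>_def field_simps)
    hence "c $ i * (\<alpha> $ i) ^ n = \<mu> * (d $ i * (\<alpha> $ i) ^ m)" by (simp add: x_def y_def term_vec_def)
    thus ?thesis using nz(1) by (simp add: power_int_diff field_simps)
  qed
  moreover have "algebraic \<mu>" "\<mu> \<noteq> 0" using \<mu> algebraic units_R units_nz by auto
  ultimately have "equivalent_coeffs \<alpha> c d" unfolding equivalent_coeffs_def by blast
  with ineq show False ..
qed

lemma max_ratio_height_le_iff:
  "max_ratio_height x \<le> B \<longleftrightarrow> weil_height (x $ 1 / x $ 2) \<le> B \<and>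
     weil_height (x $ 1 / x $ 3) \<le> B \<and> weil_height (x $ 2 / x $ 3) \<le> B"
  by (simp add: max_ratio_height_def)

text \<open>
  The heights \<open>h\<close>, \<open>a c\<close> and \<open>b c\<close> are the projective heights of \<open>\<alpha>\<close>, of \<open>c\<close> and of the
  coordinatewise inverse of \<open>c\<close>, computed over one field for all sequences at once.
\<close>

lemma zeros_inequalities:
  fixes \<alpha> :: "complex ^ 3" and S :: "(complex ^ 3) set" and n :: "complex ^ 3 \<Rightarrow> nat"
  assumes \<alpha>: "\<alpha> \<in> nonzero_algebraic_vectors" and S: "finite S" "S \<subseteq> nonzero_algebraic_vectors"
    and \<theta>: "\<And>c. c \<in> S \<Longrightarrow> max_ratio_height c \<le> \<theta>"
    and vanish: "\<And>c. c \<in> S \<Longrightarrow> exp_sum_seq \<alpha> c (n c) = 0"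
    and ineq: "pairwise (\<lambda>c c'. \<not> equivalent_coeffs \<alpha> c c') S"
  obtains h :: real and a b :: "complex ^ 3 \<Rightarrow> real" where
    "max_ratio_height \<alpha> \<le> h" "h \<le> 2 * max_ratio_height \<alpha>"
    "\<And>c. c \<in> S \<Longrightarrow> 0 \<le> a c" "\<And>c. c \<in> S \<Longrightarrow> 0 \<le> b c" "\<And>c. c \<in> S \<Longrightarrow> a c \<le> 2 * \<theta>" "\<And>c. c \<in> S \<Longrightarrow> b c \<le> 2 * \<theta>"
    "\<And>c. c \<in> S \<Longrightarrow> a c + b c \<le> 3 * \<theta>"
    "\<And>c d. c \<in> S \<Longrightarrow> d \<in> S \<Longrightarrow> c \<noteq> d \<Longrightarrow> n c \<le> n d \<Longrightarrow>
       2 * (real (n c) * h) \<le> real (n d) * h + a d + 2 * b c + ln 2"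
    "\<And>c d N. c \<in> S \<Longrightarrow> d \<in> S \<Longrightarrow> real (n c) * h \<le> b c \<or>
       (\<exists>K\<in>{N, Suc N}. \<exists>\<delta>. \<delta> = real (n d) - real (2 * K + 1) * real (n c) \<and>
          real (K + 1) * (real (n c) * h) \<le> max (\<delta> * h) (- 2 * \<delta> * h) + a d
            + real (3 * K + 2) * b c + real (4 * K + 1) * ln 2)"
proof -
  define E0 where "E0 = range (($) \<alpha>) \<union> (\<Union>c\<in>S. range (($) c))"
  \<comment> \<open>Inverses are included so that all coordinates become units of R.\<close>
  define E where "E = E0 \<union> inverse ` E0"
  have E0: "algebraic x \<and> x \<noteq> 0" if "x \<in> E0" for x
    using that \<alpha> S(2) unfolding E0_def nonzero_algebraic_vectors_def by auto
  have "finite E" unfolding E_def E0_def using S(1) by auto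
  moreover have "algebraic x" if "x \<in> E" for x using that E0 unfolding E_def by auto
  ultimately obtain R and V A :: "(nat \<times> nat) set" and ab where "places R V A ab" and ER: "E \<subseteq> R"
    by (rule ex_places)
  then interpret places R V A ab by simp
  have E0_units: "x \<in> units" if "x \<in> E0" for x
    using that E0 ER unfolding E_def units_def by auto
  have \<alpha>u: "\<alpha> $ i \<in> units" for i by (rule E0_units) (simp add: E0_def)
  have cu: "c $ i \<in> units" if "c \<in> S" for c i by (rule E0_units) (use that in \<open>auto simp: E0_def\<close>)
  define L where "L x = log_abs (($) x)" for x :: "complex ^ 3"
  define h where "h = H (L \<alpha>)"
  define a where "a c = H (L c)" for c
  define b where "b c = H (\<lambda>i v. - L c i v)" for c
  have balanced: "balanced (L x)" if "\<And>i. x $ i \<in> units" for x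
    unfolding L_def using that by (rule balanced_log_abs)
  have ratio: "weil_height (x $ i / x $ j) = ratio_height (L x) i j" if "\<And>i. x $ i \<in> units" for x i j
    unfolding L_def using that by (rule weil_height_ratio)
  have max_le: "max_ratio_height x \<le> B \<longleftrightarrow> ratio_height (L x) 1 2 \<le> B \<and> ratio_height (L x) 1 3 \<le> B \<and>
      ratio_height (L x) 2 3 \<le> B" if "\<And>i. x $ i \<in> units" for x B
    unfolding max_ratio_height_le_iff using ratio[OF that] by simp
  have nonneg: "ratio_height X i j \<ge> 0" for X i j
    unfolding ratio_height_def by (intro divide_nonneg_nonneg sum_nonneg) auto
  have H_nonneg: "H X \<ge> 0" if "balanced X" for X
    using nonneg[of X 1 2] ratio_height_le_H[OF that, of 1 2] by linarith
  have H_le: "H X \<le> 2 * B" if "balanced X" "ratio_height X 1 2 \<le> B" "ratio_height X 1 3 \<le> B" for X B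
    using H_le_ratio_heights[OF that(1)] that ratio_height_commute[OF that(1), of 2 1]
      ratio_height_commute[OF that(1), of 3 1] by linarith
  have neg: "balanced (\<lambda>i v. - X i v)" if "balanced X" for X
    using that by (simp add: balanced_def sum_negf)
  have \<theta>': "ratio_height (L c) 1 2 \<le> \<theta>" "ratio_height (L c) 1 3 \<le> \<theta>" "ratio_height (L c) 2 3 \<le> \<theta>" if "c \<in> S" for c
    using \<theta>[OF that] max_le[OF cu[OF that]] by auto
  have terms: "x 1 + x 2 + x 3 = 0" if "c \<in> S" "x = term_vec (($) \<alpha>) (($) c) (n c)" for c x
    using vanish[OF that(1)] by (simp add: that(2) term_vec_def exp_sum_seq_def sum_3)
  show ?thesis
  proof (rule that[of h a b])
    show "max_ratio_height \<alpha> \<le> h"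
      using ratio_height_le_H[OF balanced[OF \<alpha>u]] max_le[OF \<alpha>u] unfolding h_def by auto
    show "h \<le> 2 * max_ratio_height \<alpha>"
      unfolding h_def using max_le[OF \<alpha>u, of "max_ratio_height \<alpha>"] by (intro H_le balanced \<alpha>u) auto
    fix c assume c: "c \<in> S"
    note bal = balanced[OF cu[OF c]]
    show "0 \<le> a c" "0 \<le> b c" unfolding a_def b_def by (intro H_nonneg bal neg)+
    show "a c \<le> 2 * \<theta>" unfolding a_def by (intro H_le bal \<theta>' c)
    have "ratio_height (\<lambda>i v. - L c i v) 1 2 \<le> \<theta>" "ratio_height (\<lambda>i v. - L c i v) 1 3 \<le> \<theta>"
      unfolding ratio_height_uminus ratio_height_commute[OF bal, of 2 1] ratio_height_commute[OF bal, of 3 1]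
      by (intro \<theta>' c)+
    thus "b c \<le> 2 * \<theta>" unfolding b_def by (intro H_le bal neg)
    show "a c + b c \<le> 3 * \<theta>"
      unfolding a_def b_def using H_plus_H_uminus_le[OF bal] \<theta>'[OF c] by linarith
  next
    fix c d assume c: "c \<in> S" and d: "d \<in> S" and cd: "c \<noteq> d" "n c \<le> n d"
    have "\<not> equivalent_coeffs \<alpha> c d" using pairwiseD[OF ineq c d cd(1)] .
    then obtain i j where "term_vec (($) \<alpha>) (($) d) (n d) i * pade_point 0 (term_vec (($) \<alpha>) (($) c) (n c)) j \<noteq>
        term_vec (($) \<alpha>) (($) d) (n d) j * pade_point 0 (term_vec (($) \<alpha>) (($) c) (n c)) i"
      using inequivalent_nondegenerate[OF \<alpha>u cu[OF c] cu[OF d]] by blast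
    from gap_inequality[OF \<alpha>u cu[OF c] cu[OF d] terms[OF c refl] terms[OF d refl] this]
    have "real (n c) * h \<le> max ((real (n d) - real (n c)) * h) (- 2 * (real (n d) - real (n c)) * h) + a d + 2 * b c + ln 2"
      by (simp add: h_def a_def b_def L_def)
    \<comment> \<open>For N = 0 the exponent is non-negative, so the factor 2 for negative exponents
      does not enter.\<close>
    moreover have "0 \<le> (real (n d) - real (n c)) * h"
      using cd(2) H_nonneg[OF balanced[OF \<alpha>u]] unfolding h_def by (intro mult_nonneg_nonneg) auto
    hence "max ((real (n d) - real (n c)) * h) (- 2 * (real (n d) - real (n c)) * h) = (real (n d) - real (n c)) * h"
      unfolding mult.assoc by (intro max_absorb1) argo
    ultimately show "2 * (real (n c) * h) \<le> real (n d) * h + a d + 2 * b c + ln 2"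
      by (simp add: algebra_simps)
  next
    fix c d N assume c: "c \<in> S" and d: "d \<in> S"
    define x where "x = term_vec (($) \<alpha>) (($) c) (n c)"
    define y where "y = term_vec (($) \<alpha>) (($) d) (n d)"
    have x: "x i \<in> units" and y: "y i \<in> units" for i
      unfolding x_def y_def by (rule term_vec_units[OF \<alpha>u cu[OF c]], rule term_vec_units[OF \<alpha>u cu[OF d]])
    show "real (n c) * h \<le> b c \<or> (\<exists>K\<in>{N, Suc N}. \<exists>\<delta>. \<delta> = real (n d) - real (2 * K + 1) * real (n c) \<and>
          real (K + 1) * (real (n c) * h) \<le> max (\<delta> * h) (- 2 * \<delta> * h) + a d
            + real (3 * K + 2) * b c + real (4 * K + 1) * ln 2)"
    \<comment> \<open>If both N and N + 1 are degenerate, the point x has height 0, and n h is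
      bounded by the height of 1/c alone.\<close>
    proof (cases "\<exists>K\<in>{N, Suc N}. \<exists>i j. y i * pade_point K x j \<noteq> y j * pade_point K x i")
      case True
      then obtain K i j where K: "K \<in> {N, Suc N}" "y i * pade_point K x j \<noteq> y j * pade_point K x i" by blast
      from gap_inequality[OF \<alpha>u cu[OF c] cu[OF d] terms[OF c refl] terms[OF d refl] K(2)[unfolded x_def y_def]] K(1)
      show ?thesis unfolding h_def a_def b_def L_def by blast
    next
      case False
      hence "H (log_abs x) = 0" by (intro H_eq_0_if_degenerate[where N = N, OF x terms[OF c x_def] y]) auto
      moreover have "real (n c) * h \<le> H (log_abs x) + b c"
        unfolding h_def b_def L_def x_def
        by (rule H_term_vec_ge[where \<alpha> = "($) \<alpha>" and c = "($) c", OF \<alpha>u cu[OF c]])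
      ultimately show ?thesis by simp
    qed
  qed
qed

text \<open>In the order of increasing n each step multiplies F by at least q; the induction removes
  an element with the largest n. F is kept apart from n because exact doubling holds only after a
  shift.\<close>

lemma growth_along_chain:
  fixes n :: "'a \<Rightarrow> nat" and F :: "'a \<Rightarrow> real"
  assumes "finite S" "card S = Suc k" "q \<ge> 0"
    and "\<And>c d. c \<in> S \<Longrightarrow> d \<in> S \<Longrightarrow> c \<noteq> d \<Longrightarrow> n c \<le> n d \<Longrightarrow> q * F c \<le> F d"
    and "\<And>c. c \<in> S \<Longrightarrow> lo \<le> F c"
  shows "\<exists>c\<in>S. q ^ k * lo \<le> F c"
proof -
  have "\<exists>c\<in>S. (\<forall>d\<in>S. n d \<le> n c) \<and> q ^ k * lo \<le> F c"
    using assms(1,2,4,5)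
  proof (induction k arbitrary: S)
    case 0
    then obtain c where "S = {c}" by (auto simp: card_1_singleton_iff)
    thus ?case using 0 by auto
  next
    case (Suc k)
    have "finite (n ` S)" "n ` S \<noteq> {}" using Suc.prems(1,2) by auto
    then obtain c where c: "c \<in> S" "n c = Max (n ` S)" using Max_in by (metis imageE)
    have max: "n d \<le> n c" if "d \<in> S" for d using that c(2) Suc.prems(1) by simp
    have "card (S - {c}) = Suc k" "finite (S - {c})" using c Suc.prems(1,2) by auto
    then obtain d where d: "d \<in> S - {c}" "q ^ k * lo \<le> F d"
      using Suc.IH[of "S - {c}"] Suc.prems(3,4) by (metis DiffD1)
    have "q ^ Suc k * lo = q * (q ^ k * lo)" by simp
    also have "\<dots> \<le> q * F d" using d(2) assms(3) by (rule mult_left_mono)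
    also have "\<dots> \<le> F c" using Suc.prems(3)[of d c] d(1) c(1) max by auto
    finally show ?case using c(1) max by blast
  qed
  thus ?thesis by blast
qed

text \<open>Reduces the count to finite sets, for which one number field serves all sequences; it
  also yields finiteness.\<close>

lemma finite_card_le_if_subsets:
  assumes "\<And>T. T \<subseteq> S \<Longrightarrow> finite T \<Longrightarrow> card T = Suc k \<Longrightarrow> False"
  shows "finite S \<and> card S \<le> k"
proof (rule ccontr)
  assume "\<not> (finite S \<and> card S \<le> k)"
  hence "infinite S \<or> Suc k \<le> card S" by auto
  then obtain T where "T \<subseteq> S" "finite T" "card T = Suc k"
    by (metis infinite_arbitrarily_large obtain_subset_with_card_n)
  thus False by (rule assms)
qed

text \<open>Five steps of ratio 1.9 give a pair of indices n and m with m / n >= 24, since 1.9^5 >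
  24. Nondegeneracy at K then forces m / n <= 1.545 K + 0.545 or m / n >= 2.91 K + 1.91, and a
  suitable pair of consecutive K violates both.\<close>

lemma no_six_large_zeros:
  fixes \<alpha> :: "complex ^ 3" and \<theta> :: real and n :: "complex ^ 3 \<Rightarrow> nat"
  assumes \<alpha>: "\<alpha> \<in> nonzero_algebraic_vectors" and \<xi>: "max_ratio_height \<alpha> > 0" and \<theta>0: "\<theta> \<ge> 0"
    and S: "finite S" "S \<subseteq> nonzero_algebraic_vectors" "card S = 6"
    and \<theta>: "\<And>c. c \<in> S \<Longrightarrow> max_ratio_height c \<le> \<theta>"
    and vanish: "\<And>c. c \<in> S \<Longrightarrow> exp_sum_seq \<alpha> c (n c) = 0"
    and large: "\<And>c. c \<in> S \<Longrightarrow> 33.1 + 73.1 * \<theta> \<le> real (n c) * max_ratio_height \<alpha>"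
    and ineq: "pairwise (\<lambda>c c'. \<not> equivalent_coeffs \<alpha> c c') S"
  shows False
proof -
  obtain h a b where h: "max_ratio_height \<alpha> \<le> h" "h \<le> 2 * max_ratio_height \<alpha>"
    and ab: "\<And>c. c \<in> S \<Longrightarrow> 0 \<le> a c" "\<And>c. c \<in> S \<Longrightarrow> 0 \<le> b c" "\<And>c. c \<in> S \<Longrightarrow> a c \<le> 2 * \<theta>" "\<And>c. c \<in> S \<Longrightarrow> b c \<le> 2 * \<theta>"
      "\<And>c. c \<in> S \<Longrightarrow> a c + b c \<le> 3 * \<theta>"
    and gap: "\<And>c d. c \<in> S \<Longrightarrow> d \<in> S \<Longrightarrow> c \<noteq> d \<Longrightarrow> n c \<le> n d \<Longrightarrow>
       2 * (real (n c) * h) \<le> real (n d) * h + a d + 2 * b c + ln 2"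
    and pade: "\<And>c d N. c \<in> S \<Longrightarrow> d \<in> S \<Longrightarrow> real (n c) * h \<le> b c \<or>
       (\<exists>K\<in>{N, Suc N}. \<exists>\<delta>. \<delta> = real (n d) - real (2 * K + 1) * real (n c) \<and>
          real (K + 1) * (real (n c) * h) \<le> max (\<delta> * h) (- 2 * \<delta> * h) + a d
            + real (3 * K + 2) * b c + real (4 * K + 1) * ln 2)"
    by (rule zeros_inequalities[OF \<alpha> S(1,2) \<theta> vanish ineq]) blast+
  have hpos: "h > 0" using h \<xi> by simp
  have nh: "33.1 + 73.1 * \<theta> \<le> real (n c) * h" if "c \<in> S" for c
    using large[OF that] h(1) by (meson mult_left_mono of_nat_0_le_iff order_trans)
  have q: "1.9 * real (n c) \<le> real (n d)" if "c \<in> S" "d \<in> S" "c \<noteq> d" "n c \<le> n d" for c d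
  proof -
    \<comment> \<open>One tenth of the threshold, 3.31 + 7.31 \<theta>, exceeds the error 6 \<theta>
      + ln 2 of the gap inequality; hence 1.9 instead of 2.\<close>
    have "1.9 * (real (n c) * h) \<le> real (n d) * h"
      using gap[OF that] nh[OF that(1)] ab(3)[OF that(2)] ab(4)[OF that(1)] \<theta>0 ln2_le_25_over_36 by linarith
    hence "(1.9 * real (n c)) * h \<le> real (n d) * h" by (simp only: mult.assoc)
    thus ?thesis using hpos by (rule mult_right_le_imp_le)
  qed
  have "finite (n ` S)" "n ` S \<noteq> {}" using S(1,3) by auto
  then obtain c where c: "c \<in> S" "n c = Min (n ` S)" using Min_in by (metis imageE)
  have "n c \<le> n d" if "d \<in> S" for d using that c(2) S(1) by simp
  hence "\<exists>d\<in>S. 1.9 ^ 5 * real (n c) \<le> real (n d)"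
    using growth_along_chain[of S 5 "1.9" n "\<lambda>c. real (n c)" "real (n c)"] S(1,3) q by simp
  then obtain d where d: "d \<in> S" "1.9 ^ 5 * real (n c) \<le> real (n d)" by blast
  have d24: "24 * real (n c) \<le> real (n d)"
  proof -
    have "24 * real (n c) \<le> 1.9 ^ 5 * real (n c)" by (intro mult_right_mono) (simp_all add: power_divide)
    with d(2) show ?thesis by linarith
  qed
  have npos: "n c > 0" using nh[OF c(1)] \<theta>0 by (cases "n c") auto
  \<comment> \<open>Puts m / n between 5 N / 2 and 5 (N + 1) / 2. The slope 5/2 lies between 1.545
    and 2.91, so for N > 8 the ratio is in the excluded interval of N as well as in that of N +
    1.\<close>
  define N where "N = 2 * n d div (5 * n c)"
  have "5 * n c * N \<le> 2 * n d" unfolding N_def by (rule times_div_less_eq_dividend)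
  hence "real (5 * n c * N) \<le> real (2 * n d)" by (simp only: of_nat_le_iff)
  hence N1: "5 * (real N * real (n c)) \<le> 2 * real (n d)" by (simp add: algebra_simps)
  have "2 * n d < 5 * n c + 5 * n c * N"
    unfolding N_def using npos by (intro dividend_less_times_div) simp
  hence "real (2 * n d) < real (5 * n c + 5 * n c * N)" by (simp only: of_nat_less_iff)
  hence N2: "2 * real (n d) < 5 * (real N * real (n c)) + 5 * real (n c)" by (simp add: algebra_simps)
  have N3: "8 * real (n c) < real N * real (n c)" using N2 d24 npos by linarith
  have "\<not> real (n c) * h \<le> b c" using nh[OF c(1)] ab(4)[OF c(1)] \<theta>0 by linarith
  then obtain K \<delta> where K: "K \<in> {N, Suc N}" and \<delta>: "\<delta> = real (n d) - real (2 * K + 1) * real (n c)"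
    and ineq: "real (K + 1) * (real (n c) * h) \<le> max (\<delta> * h) (- 2 * \<delta> * h) + a d
            + real (3 * K + 2) * b c + real (4 * K + 1) * ln 2"
    using pade[OF c(1) d(1), of N] by blast
  have "real (3 * K + 2) * b c \<le> real (3 * K + 2) * (2 * \<theta>)" using ab(4)[OF c(1)] by (rule mult_left_mono) simp
  hence 1: "real (3 * K + 2) * b c \<le> 6 * (real K * \<theta>) + 4 * \<theta>" by (simp add: algebra_simps)
  have "real (4 * K + 1) * ln 2 \<le> real (4 * K + 1) * (25 / 36)"
    using ln2_le_25_over_36 by (rule mult_left_mono) simp
  hence 2: "real (4 * K + 1) * ln 2 \<le> 100 / 36 * real K + 25 / 36" by (simp add: algebra_simps)
  \<comment> \<open>Nine percent of the main term covers all errors: 6.579 against 6 in the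
    coefficients of K \<theta> and of \<theta>, and 2.979 against 100/36 and 25/36 in those of K and
    of 1.\<close>
  have "real (K + 1) * (9 / 100 * (33.1 + 73.1 * \<theta>)) \<le> real (K + 1) * (9 / 100 * (real (n c) * h))"
    using nh[OF c(1)] by (intro mult_left_mono) auto
  moreover have "6579 / 1000 * (real K * \<theta>) + 6579 / 1000 * \<theta> + 2979 / 1000 * real K + 2979 / 1000 = real (K + 1) * (9 / 100 * (33.1 + 73.1 * \<theta>))"
    by (simp add: field_simps)
  ultimately have 3: "6579 / 1000 * (real K * \<theta>) + 6579 / 1000 * \<theta> + 2979 / 1000 * real K + 2979 / 1000 \<le> 9 / 100 * (real (K + 1) * (real (n c) * h))"
    by argo
  have 4: "0 \<le> real K * \<theta>" "0 \<le> real K" using \<theta>0 by simp_all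
  have "91 / 100 * (real (K + 1) * (real (n c) * h)) \<le> max (\<delta> * h) (- 2 * \<delta> * h)"
    using 1 2 3 4 ineq ab(3)[OF d(1)] \<theta>0 by argo
  also have "max (\<delta> * h) (- 2 * \<delta> * h) = max \<delta> (- 2 * \<delta>) * h"
    using hpos by (simp add: max_mult_distrib_right)
  finally have "(91 / 100 * (real (K + 1) * real (n c))) * h \<le> max \<delta> (- 2 * \<delta>) * h" by (simp add: mult_ac)
  hence "91 / 100 * (real (K + 1) * real (n c)) \<le> max \<delta> (- 2 * \<delta>)" using hpos by (rule mult_right_le_imp_le)
  hence "91 / 100 * (real (K + 1) * real (n c)) \<le> \<delta> \<or> 91 / 100 * (real (K + 1) * real (n c)) \<le> - 2 * \<delta>"
    by (simp add: max_def split: if_splits)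
  moreover have "real (K + 1) * real (n c) = real K * real (n c) + real (n c)"
    "\<delta> = real (n d) - 2 * (real K * real (n c)) - real (n c)"
    by (simp_all add: \<delta> algebra_simps)
  moreover have "real K * real (n c) = real N * real (n c) \<or> real K * real (n c) = real N * real (n c) + real (n c)"
    using K by (auto simp: algebra_simps)
  moreover have "real (n c) > 0" using npos by simp
  ultimately show False using N1 N2 N3 by argo
qed

text \<open>Twenty zeros mean 19 doublings, which carry the lower bound 2.1 + \<theta> beyond twice
  the upper threshold.\<close>

lemma no_twenty_moderate_zeros:
  fixes \<alpha> :: "complex ^ 3" and \<theta> :: real and n :: "complex ^ 3 \<Rightarrow> nat"
  assumes \<alpha>: "\<alpha> \<in> nonzero_algebraic_vectors" and \<xi>: "max_ratio_height \<alpha> > 0" and \<theta>0: "\<theta> \<ge> 0"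
    and S: "finite S" "S \<subseteq> nonzero_algebraic_vectors" "card S = 20"
    and \<theta>: "\<And>c. c \<in> S \<Longrightarrow> max_ratio_height c \<le> \<theta>"
    and vanish: "\<And>c. c \<in> S \<Longrightarrow> exp_sum_seq \<alpha> c (n c) = 0"
    and lower: "\<And>c. c \<in> S \<Longrightarrow> 2.8 + 6 * \<theta> \<le> real (n c) * max_ratio_height \<alpha>"
    and upper: "\<And>c. c \<in> S \<Longrightarrow> real (n c) * max_ratio_height \<alpha> < 33.1 + 73.1 * \<theta>"
    and ineq: "pairwise (\<lambda>c c'. \<not> equivalent_coeffs \<alpha> c c') S"
  shows False
proof -
  obtain h a b where h: "max_ratio_height \<alpha> \<le> h" "h \<le> 2 * max_ratio_height \<alpha>"
    and ab: "\<And>c. c \<in> S \<Longrightarrow> 0 \<le> a c" "\<And>c. c \<in> S \<Longrightarrow> 0 \<le> b c" "\<And>c. c \<in> S \<Longrightarrow> a c \<le> 2 * \<theta>" "\<And>c. c \<in> S \<Longrightarrow> b c \<le> 2 * \<theta>"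
      "\<And>c. c \<in> S \<Longrightarrow> a c + b c \<le> 3 * \<theta>"
    and gap: "\<And>c d. c \<in> S \<Longrightarrow> d \<in> S \<Longrightarrow> c \<noteq> d \<Longrightarrow> n c \<le> n d \<Longrightarrow>
       2 * (real (n c) * h) \<le> real (n d) * h + a d + 2 * b c + ln 2"
    by (rule zeros_inequalities[OF \<alpha> S(1,2) \<theta> vanish ineq]) blast+
  \<comment> \<open>The shift makes the gap inequality read 2 F c <= F d: it absorbs 2 b c and ln 2,
    and its part 3 \<theta> bounds a d + b d.\<close>
  define F where "F c = real (n c) * h - b c - (3 * \<theta> + ln 2)" for c
  have "2 * F c \<le> F d" if "c \<in> S" "d \<in> S" "c \<noteq> d" "n c \<le> n d" for c d
    using gap[OF that] ab(5)[OF that(2)] unfolding F_def by argo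
  \<comment> \<open>Here 2.8 - ln 2 > 2.1, and of 6 \<theta> at most 2 \<theta> goes to b c and 3
    \<theta> to the shift.\<close>
  moreover have "2.1 + \<theta> \<le> F c" if "c \<in> S" for c
  proof -
    have "real (n c) * max_ratio_height \<alpha> \<le> real (n c) * h" using h(1) by (rule mult_left_mono) simp
    thus ?thesis using lower[OF that] ab(4)[OF that] ln2_le_25_over_36 unfolding F_def by linarith
  qed
  ultimately obtain c where c: "c \<in> S" "2 ^ 19 * (2.1 + \<theta>) \<le> F c"
    using growth_along_chain[of S 19 2 n F "2.1 + \<theta>"] S(1,3) by auto
  \<comment> \<open>The thresholds are stated with the largest ratio height, while h can be twice as
    large.\<close>
  have "real (n c) * h \<le> 2 * (real (n c) * max_ratio_height \<alpha>)"
    using mult_left_mono[OF h(2), of "real (n c)"] by simp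
  moreover have "F c \<le> real (n c) * h" using ab(2)[OF c(1)] \<theta>0 ln_gt_zero[of "2 :: real"] unfolding F_def by linarith
  ultimately have "2 ^ 19 * (2.1 + \<theta>) \<le> 2 * (33.1 + 73.1 * \<theta>)"
    using c(2) upper[OF c(1)] by argo
  thus False using \<theta>0 by simp
qed

theorem theorem1p1:
  fixes \<alpha> :: "complex ^ 3" and \<xi> \<theta> :: real
  assumes "\<alpha> \<in> nonzero_algebraic_vectors"
    and "\<xi> = max_ratio_height \<alpha>" and "\<xi> > 0" and "\<theta> \<ge> 0"
  shows "(\<forall>S \<subseteq> {c \<in> nonzero_algebraic_vectors. max_ratio_height c \<le> \<theta> \<and>
             (\<exists>n. exp_sum_seq \<alpha> c n = 0 \<and> real n \<ge> (2.8 + 6 * \<theta>) / \<xi>)}.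
           pairwise (\<lambda>c c'. \<not> equivalent_coeffs \<alpha> c c') S \<longrightarrow> finite S \<and> card S \<le> 24) \<and>
         (\<forall>S \<subseteq> {c \<in> nonzero_algebraic_vectors. max_ratio_height c \<le> \<theta> \<and>
             (\<exists>n. exp_sum_seq \<alpha> c n = 0 \<and> real n \<ge> (33.1 + 73.1 * \<theta>) / \<xi>)}.
           pairwise (\<lambda>c c'. \<not> equivalent_coeffs \<alpha> c c') S \<longrightarrow> finite S \<and> card S \<le> 5)"
proof -
  let ?P = "pairwise (\<lambda>c c'. \<not> equivalent_coeffs \<alpha> c c')"
  let ?Z = "\<lambda>B. {c \<in> nonzero_algebraic_vectors. max_ratio_height c \<le> \<theta> \<and>
             (\<exists>n. exp_sum_seq \<alpha> c n = 0 \<and> real n \<ge> B / \<xi>)}"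
  have zeros: "\<exists>n. \<forall>c\<in>T. exp_sum_seq \<alpha> c (n c) = 0 \<and> B \<le> real (n c) * max_ratio_height \<alpha>"
    if "T \<subseteq> ?Z B" for T B
  proof -
    have "\<forall>c\<in>T. \<exists>n. exp_sum_seq \<alpha> c n = 0 \<and> B \<le> real n * max_ratio_height \<alpha>"
      using that assms(2,3) by (auto simp: divide_le_eq)
    thus ?thesis by (rule bchoice)
  qed
  have large: False if T: "T \<subseteq> nonzero_algebraic_vectors" "\<And>c. c \<in> T \<Longrightarrow> max_ratio_height c \<le> \<theta>" "finite T" "card T \<ge> 6" "?P T"
    and n: "\<And>c. c \<in> T \<Longrightarrow> exp_sum_seq \<alpha> c (n c) = 0 \<and> 33.1 + 73.1 * \<theta> \<le> real (n c) * max_ratio_height \<alpha>" for T n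
  proof -
    obtain U where U: "U \<subseteq> T" "card U = 6" "finite U" using obtain_subset_with_card_n[OF T(4)] by metis
    show False
      by (rule no_six_large_zeros[of \<alpha> \<theta> U n]) (use assms U T n pairwise_subset[OF T(5) U(1)] in auto)
  qed
  have "finite S \<and> card S \<le> 5" if S: "S \<subseteq> ?Z (33.1 + 73.1 * \<theta>)" "?P S" for S
  proof (rule finite_card_le_if_subsets)
    fix T assume T: "T \<subseteq> S" "finite T" "card T = Suc 5"
    obtain n where n: "\<And>c. c \<in> T \<Longrightarrow> exp_sum_seq \<alpha> c (n c) = 0 \<and> 33.1 + 73.1 * \<theta> \<le> real (n c) * max_ratio_height \<alpha>"
      using zeros[of T "33.1 + 73.1 * \<theta>"] S(1) T(1) by blast
    show False by (rule large[of T n]) (use S T n pairwise_subset[OF S(2) T(1)] in auto)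
  qed
  moreover have "finite S \<and> card S \<le> 24" if S: "S \<subseteq> ?Z (2.8 + 6 * \<theta>)" "?P S" for S
  proof (rule finite_card_le_if_subsets)
    fix T assume T: "T \<subseteq> S" "finite T" "card T = Suc 24"
    obtain n where n: "\<And>c. c \<in> T \<Longrightarrow> exp_sum_seq \<alpha> c (n c) = 0 \<and> 2.8 + 6 * \<theta> \<le> real (n c) * max_ratio_height \<alpha>"
      using zeros[of T "2.8 + 6 * \<theta>"] S(1) T(1) by blast
    \<comment> \<open>A set of 25 sequences has at most 5 members above the second threshold, so at
      least 20 remain between the two.\<close>
    define L where "L = {c \<in> T. 33.1 + 73.1 * \<theta> \<le> real (n c) * max_ratio_height \<alpha>}"
    have "\<not> card L \<ge> 6"
    proof
      assume "card L \<ge> 6"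
      moreover have "?P L" by (rule pairwise_subset[OF S(2)]) (use T(1) in \<open>auto simp: L_def\<close>)
      ultimately show False by (intro large[of L n]) (use S(1) T(1,2) n in \<open>auto simp: L_def\<close>)
    qed
    moreover have "card (T - L) = card T - card L" using T(2) by (intro card_Diff_subset) (auto simp: L_def)
    ultimately have "card (T - L) \<ge> 20" using T(3) by simp
    then obtain U where U: "U \<subseteq> T - L" "card U = 20" "finite U" using obtain_subset_with_card_n by metis
    have "?P U" by (rule pairwise_subset[OF S(2)]) (use T(1) U(1) in auto)
    thus False
      by (intro no_twenty_moderate_zeros[of \<alpha> \<theta> U n]) (use assms U S(1) T(1) n in \<open>auto simp: L_def not_le\<close>)
  qed
  ultimately show ?thesis by blast
qed

end
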